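(* Let $\alpha,\beta\in\mathbb R$ with $\alpha^2+\beta^2=1$, let $(\omega(t),\psi_\pm(t))$ be a one-parameter family of $\mathrm{SU}(3)$-structures on a 6-manifold $M^6$, let $f(t)$ be a family of non-vanishing functions that are constant on $M^6$ for each $t$, and suppose the warped $\mathrm{G}_2$-structures $\varphi(t)=f(t)\,\omega(t)\wedge ds+(\alpha\psi_+(t)-\beta\psi_-(t))$ on $M^6\times S^1$ are closed for all $t$. Then the Laplacian flow equation for $\varphi(t)$ is equivalent to the system $$\begin{cases}f'(t)\,\omega(t)+f(t)\dfrac{\partial}{\partial t}\omega(t)=0,\\[5pt]\alpha\dfrac{\partial}{\partial t}\psi_+(t)-\beta\dfrac{\partial}{\partial t}\psi_-(t)=-d_6\big(\alpha\sigma_2(t)+\beta\pi_2(t)\big),\end{cases}$$ where $\alpha\pi_2(t)-\beta\sigma_2(t)=0$.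
   Context: $\mathrm{SU}(3)$-structures. An $\mathrm{SU}(3)$-structure on a 6-manifold $M^6$ is a triple $(\omega,\psi_+,\psi_-)$ of a 2-form and two 3-forms such that locally there is a coframe $\{e^1,\dots,e^6\}$ (an adapted basis) with $\omega=e^{12}+e^{34}+e^{56}$, $\psi_+=e^{135}-e^{146}-e^{236}-e^{245}$, $\psi_-=-e^{246}+e^{235}+e^{145}+e^{136}$, where $e^{ij}=e^i\wedge e^j$, etc. The induced metric $g_{\omega,\psi_\pm}$ is the one for which adapted bases are orthonormal, the volume form is $vol_6=\frac1{3!}\omega^3=e^{123456}$, and $\ast_6$ is the corresponding Hodge star. $d_6$ denotes the exterior derivative on $M^6$. Put $\Omega^2_8(M^6)=\{\sigma\in\Omega^2(M^6):\sigma\wedge\psi_+=0,\ \ast_6\sigma=-\sigma\wedge\omega\}$ and $\Omega^3_{12}(M^6)=\{\gamma\in\Omega^3(M^6):\gamma\wedge\omega=0,\ \gamma\wedge\psi_\pm=0\}$. The torsion forms are the functions $\sigma_0,\pi_0$, 1-forms $\pi_1,\nu_1$, 2-forms $\pi_2,\sigma_2\in\Omega^2_8(M^6)$ and 3-form $\nu_3\in\Omega^3_{12}(M^6)$ determined by $$d\omega=-\tfrac32\sigma_0\psi_++\tfrac32\pi_0\psi_-+\nu_1\wedge\omega+\nu_3,\quad d\psi_+=\pi_0\omega^2+\pi_1\wedge\psi_+-\pi_2\wedge\omega,\quad d\psi_-=\sigma_0\omega^2+\pi_1\wedge\psi_--\sigma_2\wedge\omega.$$ For a family $(\omega(t),\psi_\pm(t))$,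 the torsion forms at time $t$ are denoted $\sigma_2(t),\pi_2(t)$, etc. Warped $\mathrm{G}_2$-structures. $s$ is the coordinate on $S^1$. The 3-form $\varphi=f\,\omega\wedge ds+(\alpha\psi_+-\beta\psi_-)$ on $M^6\times S^1$ is a $\mathrm{G}_2$-structure with metric $g_{\omega,\psi_\pm}+f^2ds^2$ and volume form $f\,vol_6\wedge ds$; it is closed if $d_7\varphi=0$, $d_7$ being the exterior derivative on $M^6\times S^1$. Laplacian flow. A family of $\mathrm{G}_2$-structures $\varphi(t)$ solves the Laplacian flow if $\frac{\partial}{\partial t}\varphi(t)=\Delta_t\varphi(t)$ and $d_7\varphi(t)=0$, where $\Delta_t$ is the Hodge Laplacian ($\Delta=dd^*+d^*d$) induced by $\varphi(t)$. *)

theory Defs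
  imports "HOL-Analysis.Analysis" "HOL-Combinatorics.Permutations" "HOL-Library.Function_Algebras"
begin

section \<open>Smooth maps and smooth manifolds\<close>

primrec Ck_on :: "nat \<Rightarrow> 'a::euclidean_space set \<Rightarrow> ('a \<Rightarrow> 'b::real_normed_vector) \<Rightarrow> bool" where
  "Ck_on 0 S f \<longleftrightarrow> continuous_on S f"
| "Ck_on (Suc k) S f \<longleftrightarrow>
     (\<forall>x\<in>S. f differentiable (at x)) \<and> (\<forall>u. Ck_on k S (\<lambda>x. frechet_derivative f (at x) u))"

text \<open>Used for open sets only.\<close>

definition smooth_on :: "'a::euclidean_space set \<Rightarrow> ('a \<Rightarrow> 'b::real_normed_vector) \<Rightarrow> bool" where
  "smooth_on S f \<longleftrightarrow> (\<forall>k. Ck_on k S f)"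

text \<open>An atlas is a family of charts indexed by a whole type. This is no restriction, because
  a chart domain may be empty.\<close>

record ('i, 'm, 'e) manifold =
  mtop :: "'m topology"
  cdom :: "'i \<Rightarrow> 'm set"
  coord :: "'i \<Rightarrow> 'm \<Rightarrow> 'e"

definition cinv :: "('i, 'm, 'e) manifold \<Rightarrow> 'i \<Rightarrow> 'e \<Rightarrow> 'm" where
  "cinv M i = inv_into (cdom M i) (coord M i)"

definition smooth_manifold :: "('i, 'm, 'e::euclidean_space) manifold \<Rightarrow> bool" where
  "smooth_manifold M \<longleftrightarrow>
     Hausdorff_space (mtop M) \<and> second_countable (mtop M) \<and>
     (\<Union>i. cdom M i) = topspace (mtop M) \<and>
     (\<forall>i. openin (mtop M) (cdom M i) \<and> open (coord M i ` cdom M i) \<and>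
          homeomorphic_map (subtopology (mtop M) (cdom M i))
                           (top_of_set (coord M i ` cdom M i)) (coord M i)) \<and>
     (\<forall>i j. smooth_on (coord M i ` (cdom M i \<inter> cdom M j)) (coord M j \<circ> cinv M i))"

definition prod_manifold ::
  "('i, 'm, 'e) manifold \<Rightarrow> ('j, 'n, 'f) manifold \<Rightarrow> ('i \<times> 'j, 'm \<times> 'n, 'e \<times> 'f) manifold" where
  "prod_manifold M N =
     \<lparr> mtop = prod_topology (mtop M) (mtop N),
       cdom = (\<lambda>(i, j). cdom M i \<times> cdom N j),
       coord = (\<lambda>(i, j). map_prod (coord M i) (coord N j)) \<rparr>"

text \<open>The unit circle. For every real \<open>a\<close> there is a chart on the complement of \<open>cis a\<close>; its
  coordinate is the angle \<open>s\<close> in the interval from \<open>a\<close> to \<open>a + 2 * pi\<close>.\<close>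

definition circle :: "(real, complex, real) manifold" where
  "circle =
     \<lparr> mtop = top_of_set (sphere 0 1),
       cdom = (\<lambda>a. cis ` {a<..<a + 2 * pi}),
       coord = (\<lambda>a. inv_into {a<..<a + 2 * pi} cis) \<rparr>"


section \<open>Alternating forms on a vector space\<close>

text \<open>A \<open>k\<close>-linear form takes a sequence of vectors and depends on the entries with index
  below \<open>k\<close> only.\<close>

type_synonym 'e mform = "(nat \<Rightarrow> 'e) \<Rightarrow> real"

definition alternating :: "nat \<Rightarrow> 'e::real_vector mform \<Rightarrow> bool" where
  "alternating k a \<longleftrightarrow>
     (\<forall>v w. (\<forall>j<k. v j = w j) \<longrightarrow> a v = a w) \<and>
     (\<forall>v. \<forall>j<k. linear (\<lambda>x. a (v(j := x)))) \<and>
     (\<forall>v. \<forall>j<k. \<forall>l<k. j \<noteq> l \<and> v j = v l \<longrightarrow> a v = 0)"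

text \<open>Normalised such that the wedge of covectors is the determinant of their values.\<close>

definition mwedge :: "nat \<Rightarrow> nat \<Rightarrow> 'e mform \<Rightarrow> 'e mform \<Rightarrow> 'e mform" where
  "mwedge k l a b = (\<lambda>v.
     (\<Sum>p | p permutes {..<k + l}. of_int (sign p) * a (\<lambda>j. v (p j)) * b (\<lambda>j. v (p (k + j))))
       / (fact k * fact l))"

definition orthonormal_frame :: "('e::euclidean_space \<Rightarrow> 'e \<Rightarrow> real) \<Rightarrow> (nat \<Rightarrow> 'e) \<Rightarrow> bool" where
  "orthonormal_frame g u \<longleftrightarrow>
     (\<forall>i<DIM('e). \<forall>j<DIM('e). g (u i) (u j) = (if i = j then 1 else 0))"

text \<open>The Hodge star on \<open>k\<close>-forms in index notation: the value of \<open>\<star>a\<close> on \<open>w\<close> is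
  \<open>1/k! a\<^sup>I vol\<^sub>I(w)\<close>, summed over all multi-indices \<open>I\<close> of length \<open>k\<close> with respect to an
  orthonormal frame, on whose choice the sum does not depend. It is characterised by
  \<open>b \<and> \<star>a = <b, a> vol\<close> for all \<open>k\<close>-forms \<open>b\<close>.\<close>

definition mhodge ::
  "('e::euclidean_space \<Rightarrow> 'e \<Rightarrow> real) \<Rightarrow> 'e mform \<Rightarrow> nat \<Rightarrow> 'e mform \<Rightarrow> 'e mform" where
  "mhodge g vol k a = (\<lambda>w.
     let u = (SOME u. orthonormal_frame g u) in
       (\<Sum>I \<in> {..<k} \<rightarrow>\<^sub>E {..<DIM('e)}.
          a (\<lambda>j. u (I j)) * vol (\<lambda>j. if j < k then u (I j) else w (j - k))) / fact k)"


section \<open>Differential forms\<close>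

text \<open>Fields of multilinear forms are given by their local representations: \<open>\<eta> i p\<close> is the form
  at the point \<open>p\<close> of the domain of the chart \<open>i\<close>, expressed in the coordinates of \<open>i\<close>. The values
  of \<open>\<eta> i\<close> outside of the chart domain are irrelevant, so that fields are compared with
  \<open>feq_on\<close> or \<open>feq\<close> and not with equality. A bilinear form field (metric) is represented
  likewise.\<close>

type_synonym ('i, 'm, 'e) field = "'i \<Rightarrow> 'm \<Rightarrow> 'e mform"
type_synonym ('i, 'm, 'e) metric = "'i \<Rightarrow> 'm \<Rightarrow> 'e \<Rightarrow> 'e \<Rightarrow> real"

definition feq_on ::
  "('i, 'm, 'e) manifold \<Rightarrow> 'm set \<Rightarrow> ('i, 'm, 'e) field \<Rightarrow> ('i, 'm, 'e) field \<Rightarrow> bool" where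
  "feq_on M U \<eta> \<theta> \<longleftrightarrow> (\<forall>i. \<forall>p \<in> cdom M i \<inter> U. \<eta> i p = \<theta> i p)"

abbreviation feq ::
  "('i, 'm, 'e) manifold \<Rightarrow> ('i, 'm, 'e) field \<Rightarrow> ('i, 'm, 'e) field \<Rightarrow> bool" where
  "feq M \<equiv> feq_on M (topspace (mtop M))"

text \<open>Smooth \<open>k\<close>-forms on the open set \<open>U\<close>. The last condition is the transformation law under a
  change of coordinates.\<close>

definition Omega_on ::
  "('i, 'm, 'e::euclidean_space) manifold \<Rightarrow> 'm set \<Rightarrow> nat \<Rightarrow> ('i, 'm, 'e) field set" where
  "Omega_on M U k = {\<eta>.
     (\<forall>i. \<forall>p \<in> cdom M i \<inter> U. alternating k (\<eta> i p)) \<and>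
     (\<forall>i v. smooth_on (coord M i ` (cdom M i \<inter> U)) (\<lambda>x. \<eta> i (cinv M i x) v)) \<and>
     (\<forall>i j. \<forall>p \<in> cdom M i \<inter> cdom M j \<inter> U. \<forall>v.
        \<eta> i p v =
        \<eta> j p (\<lambda>l. frechet_derivative (coord M j \<circ> cinv M i) (at (coord M i p)) (v l)))}"

abbreviation Omega :: "('i, 'm, 'e::euclidean_space) manifold \<Rightarrow> nat \<Rightarrow> ('i, 'm, 'e) field set" where
  "Omega M \<equiv> Omega_on M (topspace (mtop M))"

definition fscale :: "real \<Rightarrow> ('i, 'm, 'e) field \<Rightarrow> ('i, 'm, 'e) field" (infixr "*\<^sub>F" 75) where
  "r *\<^sub>F \<eta> = (\<lambda>i p v. r * \<eta> i p v)"

text \<open>In the notation for the wedge product the subscripts are the degrees of the factors.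
  Functions are forms of degree \<open>0\<close>.\<close>

definition wedge ::
  "('i, 'm, 'e) field \<Rightarrow> nat \<Rightarrow> nat \<Rightarrow> ('i, 'm, 'e) field \<Rightarrow> ('i, 'm, 'e) field"
  ("(_ \<and>\<^bsub>_,_\<^esub>/ _)" [71, 0, 0, 70] 70) where
  "\<eta> \<and>\<^bsub>k,l\<^esub> \<theta> = (\<lambda>i p. mwedge k l (\<eta> i p) (\<theta> i p))"

text \<open>For a coframe \<open>e\<close>, \<open>emon e [i, j, \<dots>]\<close> is \<open>e\<^sup>i \<and> e\<^sup>j \<and> \<dots>\<close>.\<close>

primrec emon :: "(nat \<Rightarrow> ('i, 'm, 'e) field) \<Rightarrow> nat list \<Rightarrow> ('i, 'm, 'e) field" where
  "emon e [] = (\<lambda>_ _ _. 1)"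
| "emon e (k # ks) = e k \<and>\<^bsub>1,length ks\<^esub> emon e ks"

definition ext_deriv ::
  "('i, 'm, 'e::euclidean_space) manifold \<Rightarrow> nat \<Rightarrow> ('i, 'm, 'e) field \<Rightarrow> ('i, 'm, 'e) field" where
  "ext_deriv M k \<eta> = (\<lambda>i p v.
     \<Sum>l\<le>k. (-1) ^ l *
       frechet_derivative (\<lambda>x. \<eta> i (cinv M i x) (\<lambda>j. if j < l then v j else v (Suc j)))
         (at (coord M i p)) (v l))"

definition hodge ::
  "('i, 'm, 'e::euclidean_space) metric \<Rightarrow> ('i, 'm, 'e) field \<Rightarrow> nat
     \<Rightarrow> ('i, 'm, 'e) field \<Rightarrow> ('i, 'm, 'e) field" where
  "hodge g vol k \<eta> = (\<lambda>i p. mhodge (g i p) (vol i p) k (\<eta> i p))"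

text \<open>The formal adjoint of the exterior derivative on \<open>k\<close>-forms, \<open>k > 0\<close>, of a Riemannian
  manifold.\<close>

definition codiff ::
  "('i, 'm, 'e::euclidean_space) manifold \<Rightarrow> ('i, 'm, 'e) metric \<Rightarrow> ('i, 'm, 'e) field \<Rightarrow> nat
     \<Rightarrow> ('i, 'm, 'e) field \<Rightarrow> ('i, 'm, 'e) field" where
  "codiff M g vol k \<eta> =
     (-1) ^ (DIM('e) * (k + 1) + 1) *\<^sub>F
       hodge g vol (DIM('e) - k + 1) (ext_deriv M (DIM('e) - k) (hodge g vol k \<eta>))"

definition hodge_laplacian ::
  "('i, 'm, 'e::euclidean_space) manifold \<Rightarrow> ('i, 'm, 'e) metric \<Rightarrow> ('i, 'm, 'e) field \<Rightarrow> nat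
     \<Rightarrow> ('i, 'm, 'e) field \<Rightarrow> ('i, 'm, 'e) field" where
  "hodge_laplacian M g vol k \<eta> =
     (if k = 0 then 0 else ext_deriv M (k - 1) (codiff M g vol k \<eta>)) +
     codiff M g vol (k + 1) (ext_deriv M k \<eta>)"

text \<open>A one-parameter family of \<open>k\<close>-forms, and its derivative with respect to the parameter. Only
  differentiability in the parameter is required; this covers smooth families.\<close>

definition form_family ::
  "('i, 'm, 'e::euclidean_space) manifold \<Rightarrow> real set \<Rightarrow> nat
     \<Rightarrow> (real \<Rightarrow> ('i, 'm, 'e) field) \<Rightarrow> bool" where
  "form_family M T k \<eta> \<longleftrightarrow>
     (\<forall>t\<in>T. \<eta> t \<in> Omega M k) \<and>
     (\<forall>i. \<forall>p \<in> cdom M i. \<forall>v. (\<lambda>t. \<eta> t i p v) differentiable_on T)"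

definition tderiv :: "real set \<Rightarrow> (real \<Rightarrow> ('i, 'm, 'e) field) \<Rightarrow> real \<Rightarrow> ('i, 'm, 'e) field" where
  "tderiv T \<eta> t = (\<lambda>i p v. vector_derivative (\<lambda>\<tau>. \<eta> \<tau> i p v) (at t within T))"


section \<open>Forms on a product with the circle\<close>

text \<open>Pullback along the projection to the first factor.\<close>

definition pr1 :: "('i, 'm, 'e) field \<Rightarrow> ('i \<times> 'j, 'm \<times> 'n, 'e \<times> 'f) field" where
  "pr1 \<eta> = (\<lambda>(i, j) (p, q) v. \<eta> i p (\<lambda>l. fst (v l)))"

definition ds :: "('i \<times> real, 'm \<times> complex, 'e \<times> real) field" where
  "ds = (\<lambda>_ _ v. snd (v 0))"


section \<open>SU(3)-structures\<close>

definition coframe ::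
  "('i, 'm, 'e::euclidean_space) manifold \<Rightarrow> 'm set \<Rightarrow> (nat \<Rightarrow> ('i, 'm, 'e) field) \<Rightarrow> bool" where
  "coframe M U e \<longleftrightarrow>
     (\<forall>k \<in> {1..DIM('e)}. e k \<in> Omega_on M U 1) \<and>
     (\<forall>i. \<forall>p \<in> cdom M i \<inter> U. \<forall>x.
        (\<forall>k \<in> {1..DIM('e)}. e k i p (\<lambda>_. x) = 0) \<longrightarrow> x = 0)"

definition orthonormal_coframe ::
  "('i, 'm, 'e::euclidean_space) manifold \<Rightarrow> 'm set \<Rightarrow> ('i, 'm, 'e) metric
     \<Rightarrow> (nat \<Rightarrow> ('i, 'm, 'e) field) \<Rightarrow> bool" where
  "orthonormal_coframe M U g e \<longleftrightarrow>
     (\<forall>i. \<forall>p \<in> cdom M i \<inter> U. \<forall>x y.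
        g i p x y = (\<Sum>k = 1..DIM('e). e k i p (\<lambda>_. x) * e k i p (\<lambda>_. y)))"

definition su3_adapted ::
  "('i, 'm, real^6) manifold \<Rightarrow> 'm set \<Rightarrow> (nat \<Rightarrow> ('i, 'm, real^6) field)
     \<Rightarrow> ('i, 'm, real^6) field \<Rightarrow> ('i, 'm, real^6) field \<Rightarrow> ('i, 'm, real^6) field \<Rightarrow> bool" where
  "su3_adapted M U e \<omega> \<psi>p \<psi>m \<longleftrightarrow>
     coframe M U e \<and>
     feq_on M U \<omega> (emon e [1,2] + emon e [3,4] + emon e [5,6]) \<and>
     feq_on M U \<psi>p (emon e [1,3,5] - emon e [1,4,6] - emon e [2,3,6] - emon e [2,4,5]) \<and>
     feq_on M U \<psi>m (- emon e [2,4,6] + emon e [2,3,5] + emon e [1,4,5] + emon e [1,3,6])"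

definition su3_structure ::
  "('i, 'm, real^6) manifold
     \<Rightarrow> ('i, 'm, real^6) field \<Rightarrow> ('i, 'm, real^6) field \<Rightarrow> ('i, 'm, real^6) field \<Rightarrow> bool" where
  "su3_structure M \<omega> \<psi>p \<psi>m \<longleftrightarrow>
     \<omega> \<in> Omega M 2 \<and> \<psi>p \<in> Omega M 3 \<and> \<psi>m \<in> Omega M 3 \<and>
     (\<forall>p \<in> topspace (mtop M). \<exists>U e. openin (mtop M) U \<and> p \<in> U \<and> su3_adapted M U e \<omega> \<psi>p \<psi>m)"

text \<open>\<open>g\<close> is the metric induced by an SU(3)-structure.\<close>

definition su3_metric ::
  "('i, 'm, real^6) manifold
     \<Rightarrow> ('i, 'm, real^6) field \<Rightarrow> ('i, 'm, real^6) field \<Rightarrow> ('i, 'm, real^6) field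
     \<Rightarrow> ('i, 'm, real^6) metric \<Rightarrow> bool" where
  "su3_metric M \<omega> \<psi>p \<psi>m g \<longleftrightarrow>
     (\<forall>U e. openin (mtop M) U \<and> su3_adapted M U e \<omega> \<psi>p \<psi>m \<longrightarrow> orthonormal_coframe M U g e)"

definition vol6 :: "('i, 'm, 'e) field \<Rightarrow> ('i, 'm, 'e) field" where
  "vol6 \<omega> = (1 / fact 3) *\<^sub>F ((\<omega> \<and>\<^bsub>2,2\<^esub> \<omega>) \<and>\<^bsub>4,2\<^esub> \<omega>)"

definition Omega2_8 ::
  "('i, 'm, real^6) manifold \<Rightarrow> ('i, 'm, real^6) field \<Rightarrow> ('i, 'm, real^6) field
     \<Rightarrow> ('i, 'm, real^6) metric \<Rightarrow> ('i, 'm, real^6) field set" where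
  "Omega2_8 M \<omega> \<psi>p g = {\<sigma> \<in> Omega M 2.
     feq M (\<sigma> \<and>\<^bsub>2,3\<^esub> \<psi>p) 0 \<and> feq M (hodge g (vol6 \<omega>) 2 \<sigma>) (- (\<sigma> \<and>\<^bsub>2,2\<^esub> \<omega>))}"

definition Omega3_12 ::
  "('i, 'm, real^6) manifold
     \<Rightarrow> ('i, 'm, real^6) field \<Rightarrow> ('i, 'm, real^6) field \<Rightarrow> ('i, 'm, real^6) field
     \<Rightarrow> ('i, 'm, real^6) field set" where
  "Omega3_12 M \<omega> \<psi>p \<psi>m = {\<gamma> \<in> Omega M 3.
     feq M (\<gamma> \<and>\<^bsub>3,2\<^esub> \<omega>) 0 \<and> feq M (\<gamma> \<and>\<^bsub>3,3\<^esub> \<psi>p) 0 \<and> feq M (\<gamma> \<and>\<^bsub>3,3\<^esub> \<psi>m) 0}"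

text \<open>\<open>\<sigma>0, \<pi>0, \<pi>1, \<nu>1, \<pi>2, \<sigma>2, \<nu>3\<close> are the torsion forms of an SU(3)-structure with metric \<open>g\<close>.\<close>

definition torsion_forms ::
  "('i, 'm, real^6) manifold
     \<Rightarrow> ('i, 'm, real^6) field \<Rightarrow> ('i, 'm, real^6) field \<Rightarrow> ('i, 'm, real^6) field
     \<Rightarrow> ('i, 'm, real^6) metric
     \<Rightarrow> ('i, 'm, real^6) field \<Rightarrow> ('i, 'm, real^6) field \<Rightarrow> ('i, 'm, real^6) field
     \<Rightarrow> ('i, 'm, real^6) field \<Rightarrow> ('i, 'm, real^6) field \<Rightarrow> ('i, 'm, real^6) field
     \<Rightarrow> ('i, 'm, real^6) field \<Rightarrow> bool" where
  "torsion_forms M \<omega> \<psi>p \<psi>m g \<sigma>0 \<pi>0 \<pi>1 \<nu>1 \<pi>2 \<sigma>2 \<nu>3 \<longleftrightarrow>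
     \<sigma>0 \<in> Omega M 0 \<and> \<pi>0 \<in> Omega M 0 \<and> \<pi>1 \<in> Omega M 1 \<and> \<nu>1 \<in> Omega M 1 \<and>
     \<pi>2 \<in> Omega2_8 M \<omega> \<psi>p g \<and> \<sigma>2 \<in> Omega2_8 M \<omega> \<psi>p g \<and> \<nu>3 \<in> Omega3_12 M \<omega> \<psi>p \<psi>m \<and>
     feq M (ext_deriv M 2 \<omega>)
       ((- 3/2) *\<^sub>F (\<sigma>0 \<and>\<^bsub>0,3\<^esub> \<psi>p) + (3/2) *\<^sub>F (\<pi>0 \<and>\<^bsub>0,3\<^esub> \<psi>m) + (\<nu>1 \<and>\<^bsub>1,2\<^esub> \<omega>) + \<nu>3) \<and>
     feq M (ext_deriv M 3 \<psi>p)
       ((\<pi>0 \<and>\<^bsub>0,4\<^esub> (\<omega> \<and>\<^bsub>2,2\<^esub> \<omega>)) + (\<pi>1 \<and>\<^bsub>1,3\<^esub> \<psi>p) - (\<pi>2 \<and>\<^bsub>2,2\<^esub> \<omega>)) \<and>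
     feq M (ext_deriv M 3 \<psi>m)
       ((\<sigma>0 \<and>\<^bsub>0,4\<^esub> (\<omega> \<and>\<^bsub>2,2\<^esub> \<omega>)) + (\<pi>1 \<and>\<^bsub>1,3\<^esub> \<psi>m) - (\<sigma>2 \<and>\<^bsub>2,2\<^esub> \<omega>))"


section \<open>G2-structures and the Laplacian flow\<close>

definition g2_adapted ::
  "('i, 'm, 'e::euclidean_space) manifold \<Rightarrow> 'm set \<Rightarrow> (nat \<Rightarrow> ('i, 'm, 'e) field)
     \<Rightarrow> ('i, 'm, 'e) field \<Rightarrow> bool" where
  "g2_adapted N U e \<phi> \<longleftrightarrow>
     coframe N U e \<and>
     feq_on N U \<phi> (emon e [1,2,7] + emon e [3,4,7] + emon e [5,6,7]
       + emon e [1,3,5] - emon e [1,4,6] - emon e [2,3,6] - emon e [2,4,5])"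

text \<open>\<open>\<phi>\<close> is a G2-structure on the 7-manifold \<open>N\<close>, with induced metric \<open>g\<close> and volume form \<open>vol\<close>.
  These are determined by \<open>\<phi>\<close>, since the stabiliser of the model 3-form lies in SO(7).\<close>

definition g2_structure ::
  "('i, 'm, 'e::euclidean_space) manifold \<Rightarrow> ('i, 'm, 'e) field
     \<Rightarrow> ('i, 'm, 'e) metric \<Rightarrow> ('i, 'm, 'e) field \<Rightarrow> bool" where
  "g2_structure N \<phi> g vol \<longleftrightarrow>
     DIM('e) = 7 \<and> \<phi> \<in> Omega N 3 \<and>
     (\<forall>p \<in> topspace (mtop N). \<exists>U e. openin (mtop N) U \<and> p \<in> U \<and>
        g2_adapted N U e \<phi> \<and> orthonormal_coframe N U g e \<and>
        feq_on N U vol (emon e [1,2,3,4,5,6,7]))"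

definition laplacian_flow ::
  "('i, 'm, 'e::euclidean_space) manifold \<Rightarrow> real set \<Rightarrow> (real \<Rightarrow> ('i, 'm, 'e) field)
     \<Rightarrow> (real \<Rightarrow> ('i, 'm, 'e) metric) \<Rightarrow> (real \<Rightarrow> ('i, 'm, 'e) field) \<Rightarrow> bool" where
  "laplacian_flow N T \<phi> g vol \<longleftrightarrow>
     (\<forall>t\<in>T. g2_structure N (\<phi> t) (g t) (vol t) \<and>
        (\<forall>i. \<forall>p \<in> cdom N i. \<forall>v.
           ((\<lambda>\<tau>. \<phi> \<tau> i p v) has_real_derivative hodge_laplacian N (g t) (vol t) 3 (\<phi> t) i p v)
             (at t within T)) \<and>
        feq N (ext_deriv N 3 (\<phi> t)) 0)"

definition warped_form ::
  "real \<Rightarrow> real \<Rightarrow> real \<Rightarrow> ('i, 'm, 'e) field \<Rightarrow> ('i, 'm, 'e) field \<Rightarrow> ('i, 'm, 'e) field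
     \<Rightarrow> ('i \<times> real, 'm \<times> complex, 'e \<times> real) field" where
  "warped_form \<alpha> \<beta> f \<omega> \<psi>p \<psi>m =
     f *\<^sub>F (pr1 \<omega> \<and>\<^bsub>2,1\<^esub> ds) + (\<alpha> *\<^sub>F pr1 \<psi>p - \<beta> *\<^sub>F pr1 \<psi>m)"

definition warped_metric ::
  "real \<Rightarrow> ('i, 'm, 'e) metric \<Rightarrow> ('i \<times> real, 'm \<times> complex, 'e \<times> real) metric" where
  "warped_metric f g = (\<lambda>(i, a) (p, z) x y. g i p (fst x) (fst y) + f\<^sup>2 * (snd x * snd y))"

definition warped_vol ::
  "real \<Rightarrow> ('i, 'm, 'e) field \<Rightarrow> ('i \<times> real, 'm \<times> complex, 'e \<times> real) field" where
  "warped_vol f \<omega> = f *\<^sub>F (pr1 (vol6 \<omega>) \<and>\<^bsub>6,1\<^esub> ds)"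

end

theory Submission
  imports Defs
begin

text \<open>Put \<open>\<rho> = \<alpha>\<psi>\<^sub>+ - \<beta>\<psi>\<^sub>-\<close> and \<open>\<Psi> = \<alpha>\<psi>\<^sub>- + \<beta>\<psi>\<^sub>+\<close>, so that \<open>\<phi> = f \<omega> \<and> ds + \<rho>\<close>. Since \<open>\<alpha> + i\<beta>\<close> is a
  phase and \<open>\<rho> + i\<Psi> = (\<alpha> + i\<beta>)(\<psi>\<^sub>+ + i\<psi>\<^sub>-)\<close>, the triple \<open>(\<omega>, \<rho>, \<Psi>)\<close> is again an SU(3)-structure with
  the same metric: rotate \<open>e\<^sup>1, e\<^sup>2\<close> (\<open>su3_frame_rotate\<close>). Completed by \<open>f ds\<close>, the rotated coframe is
  adapted to \<open>\<phi>\<close>, which is therefore a G2-structure with the warped metric (\<open>g2_structure_\<phi>\<close>), and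
  \<open>\<star>\<phi> = \<omega>\<^sup>2 / 2 + f \<Psi> \<and> ds\<close> (\<open>mhodge_warped\<close>, \<open>star_omega\<close>, \<open>star_psip\<close>).

  As \<open>f\<close> is constant on \<open>M\<close>, closedness of \<open>\<phi>\<close> means \<open>d\<omega> = 0\<close> and \<open>d\<rho> = 0\<close> (\<open>closed_point\<close>). The first
  equation forces \<open>\<sigma>\<^sub>0 = \<pi>\<^sub>0 = 0\<close>. The second one becomes \<open>\<pi>\<^sub>1 \<and> \<rho> = \<tau> \<and> \<omega>\<close> with \<open>\<tau> = \<alpha>\<pi>\<^sub>2 - \<beta>\<sigma>\<^sub>2\<close>; the two
  sides lie in different irreducible components of the \<open>4\<close>-forms, so that \<open>\<pi>\<^sub>1 = 0\<close> and \<open>\<tau> = 0\<close>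
  (\<open>closed_torsion\<close>). What remains of the torsion is \<open>\<sigma> = \<alpha>\<sigma>\<^sub>2 + \<beta>\<pi>\<^sub>2\<close>, with
  \<open>d\<Psi> = - \<sigma> \<and> \<omega> = \<star>\<^sub>6 \<sigma>\<close>. Because \<open>d(\<omega>\<^sup>2) = 0\<close>, one gets \<open>d\<star>\<phi> = f (\<star>\<^sub>6 \<sigma>) \<and> ds\<close>, whose star is \<open>\<sigma>\<close>; hence
  \<open>d\<^sup>*\<phi> = - \<sigma>\<close> and \<open>\<Delta>\<phi> = - d\<sigma>\<close> (\<open>laplacian_\<phi>\<close>). This form has no component along \<open>ds\<close>, and the two
  equations of the system are the components of \<open>\<partial>\<phi>/\<partial>t = - d\<sigma>\<close> along \<open>ds\<close> and along \<open>M\<close>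
  (\<open>flow_equation_split\<close>).

  The algebraic identities are verified at a point: an alternating form is determined by its values
  on increasing sequences of vectors of a frame (\<open>alternating_eq_frame\<close>), wedge products are evaluated
  by the recursion for the contraction with a vector (\<open>mwedge_Suc_Suc\<close>), and the Hodge star is
  evaluated on complementary vectors of an orthonormal frame (\<open>mhodge_frame\<close>).\<close>

section \<open>Alternating forms\<close>

lemma alternating_cong: "alternating k a \<Longrightarrow> (\<And>j. j < k \<Longrightarrow> v j = w j) \<Longrightarrow> a v = a w"
  by (simp add: alternating_def)

lemma alternating_linear: "alternating k a \<Longrightarrow> j < k \<Longrightarrow> linear (\<lambda>x. a (v(j := x)))"
  by (simp add: alternating_def)

lemma alternating_eq_0:
  "alternating k a \<Longrightarrow> j < k \<Longrightarrow> l < k \<Longrightarrow> j \<noteq> l \<Longrightarrow> v j = v l \<Longrightarrow> a v = 0"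
  unfolding alternating_def by blast

lemma alternating_zero_arg:
  assumes "alternating k a" "j < k" "v j = 0"
  shows "a v = 0"
  using linear_0[OF alternating_linear[OF assms(1,2), of v]] assms(3)
  by (metis fun_upd_triv)

lemma alternating_swap:
  assumes a: "alternating k a" and j: "j < k" "l < k" "j \<noteq> l"
  shows "a (v \<circ> Transposition.transpose j l) = - a v"
proof -
  define B where "B x y = a (v(j := x, l := y))" for x y
  have add2: "B x (y + z) = B x y + B x z" for x y z
    unfolding B_def using linear_add[OF alternating_linear[OF a j(2), of "v(j := x)"]] by simp
  have add1: "B (x + z) y = B x y + B z y" for x y z
    unfolding B_def using linear_add[OF alternating_linear[OF a j(1), of "v(l := y)"]] j(3)
    by (simp add: fun_upd_twist[OF j(3)])
  have zero: "B x x = 0" for x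
    unfolding B_def by (rule alternating_eq_0[OF a j]) (use j in auto)
  have "B (v l) (v j) = - B (v j) (v l)"
    using zero[of "v j + v l"] by (simp only: add1 add2) (simp add: zero)
  moreover have "v \<circ> Transposition.transpose j l = v(j := v l, l := v j)"
    using j by (auto simp: fun_eq_iff Transposition.transpose_def)
  ultimately show ?thesis
    by (simp add: B_def)
qed

lemma alternating_permute:
  assumes a: "alternating k a" and p: "p permutes {..<k}"
  shows "a (v \<circ> p) = of_int (sign p) * a v"
proof -
  have "finite {..<k}" by simp
  from this p show ?thesis
  proof (induction p rule: permutes_rev_induct)
    case id
    then show ?case by simp
  next
    case (swap x y p)
    have "a (v \<circ> (p \<circ> Transposition.transpose x y)) = - a (v \<circ> p)"
      unfolding o_assoc using swap by (intro alternating_swap[OF a]) auto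
    moreover have "sign (p \<circ> Transposition.transpose x y) = - sign p"
      using swap by (subst sign_compose)
        (auto intro: permutes_imp_permutation[of "{..<k}"] permutation_swap_id simp: sign_swap_id)
    ultimately show ?case
      using swap.IH by (simp only: of_int_minus minus_mult_left)
  qed
qed

lemma alternating_prefix:
  assumes "alternating n a"
  shows "alternating (n - k) (\<lambda>w. a (\<lambda>j. if j < k then c j else w (j - k)))"
  unfolding alternating_def
proof (intro conjI allI impI)
  fix v w :: "nat \<Rightarrow> 'a" assume "\<forall>j<n - k. v j = w j"
  then show "a (\<lambda>j. if j < k then c j else v (j - k)) = a (\<lambda>j. if j < k then c j else w (j - k))"
    by (intro alternating_cong[OF assms]) auto
next
  fix v :: "nat \<Rightarrow> 'a" and j assume j: "j < n - k"
  have "(\<lambda>i. if i < k then c i else (v(j := x)) (i - k))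
      = (\<lambda>i. if i < k then c i else v (i - k))(k + j := x)" for x
    by (auto simp: fun_eq_iff)
  then show "linear (\<lambda>x. a (\<lambda>i. if i < k then c i else (v(j := x)) (i - k)))"
    using alternating_linear[OF assms, of "k + j"] j by simp
next
  fix v :: "nat \<Rightarrow> 'a" and j l assume "j < n - k" "l < n - k" "j \<noteq> l \<and> v j = v l"
  then show "a (\<lambda>j. if j < k then c j else v (j - k)) = 0"
    by (intro alternating_eq_0[OF assms, of "k + j" "k + l"]) auto
qed

lemma alternating_add:
  assumes a: "alternating k a" and b: "alternating k b"
  shows "alternating k (\<lambda>v. a v + b v)"
  unfolding alternating_def
proof (intro conjI allI impI)
  show "a v + b v = a w + b w" if "\<forall>j<k. v j = w j" for v w
    using alternating_cong[OF a, of v w] alternating_cong[OF b, of v w] that by simp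
  show "linear (\<lambda>x. a (v(j := x)) + b (v(j := x)))" if "j < k" for v j
    by (intro linear_compose_add alternating_linear[OF a that] alternating_linear[OF b that])
  show "a v + b v = 0" if "j < k" "l < k" "j \<noteq> l \<and> v j = v l" for v j l
    using alternating_eq_0[OF a that(1,2), of v] alternating_eq_0[OF b that(1,2), of v] that by simp
qed

lemma alternating_scale:
  assumes a: "alternating k a" shows "alternating k (\<lambda>v. c * a v)"
  unfolding alternating_def
proof (intro conjI allI impI)
  show "c * a v = c * a w" if "\<forall>j<k. v j = w j" for v w
    using alternating_cong[OF a, of v w] that by simp
  show "linear (\<lambda>x. c * a (v(j := x)))" if "j < k" for v j
    using linear_compose_scale_right[OF alternating_linear[OF a that], of c] by simp
  show "c * a v = 0" if "j < k" "l < k" "j \<noteq> l \<and> v j = v l" for v j l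
    using alternating_eq_0[OF a that(1,2), of v] that by simp
qed

lemma alternating_zero: "alternating k (\<lambda>v. 0)"
  by (simp add: alternating_def linear_zero)

lemma alternating_sum:
  assumes "\<And>i. i \<in> A \<Longrightarrow> alternating k (a i)"
  shows "alternating k (\<lambda>v. \<Sum>i\<in>A. a i v)"
  using assms by (induction A rule: infinite_finite_induct) (auto simp: alternating_zero alternating_add)

lemma alternating_diff:
  assumes "alternating k a" "alternating k b" shows "alternating k (\<lambda>v. a v - b v)"
  using alternating_add[OF assms(1) alternating_scale[OF assms(2), of "-1"]] by simp

lemma alternating_pullback:
  assumes a: "alternating k a" and L: "linear L"
  shows "alternating k (\<lambda>v. a (\<lambda>j. L (v j)))"
  unfolding alternating_def
proof (intro conjI allI impI)
  fix v w :: "nat \<Rightarrow> 'b" assume "\<forall>j<k. v j = w j"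
  then show "a (\<lambda>j. L (v j)) = a (\<lambda>j. L (w j))"
    by (intro alternating_cong[OF a]) auto
next
  fix v :: "nat \<Rightarrow> 'b" and j assume j: "j < k"
  have "(\<lambda>i. L ((v(j := x)) i)) = (\<lambda>i. L (v i))(j := L x)" for x
    by auto
  then show "linear (\<lambda>x. a (\<lambda>i. L ((v(j := x)) i)))"
    using linear_compose[OF L alternating_linear[OF a j]] by (simp add: o_def)
next
  fix v :: "nat \<Rightarrow> 'b" and j l assume "j < k" "l < k" "j \<noteq> l \<and> v j = v l"
  then show "a (\<lambda>j. L (v j)) = 0"
    by (intro alternating_eq_0[OF a, of j l]) auto
qed

text \<open>The interior product.\<close>

definition contract :: "'e \<Rightarrow> 'e mform \<Rightarrow> 'e mform" where
  "contract x a = (\<lambda>v. a (case_nat x v))"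

lemma case_nat_upd: "case_nat x (v(j := y)) = (case_nat x v)(Suc j := y)"
  by (auto simp: fun_eq_iff split: nat.split)

lemma alternating_contract:
  assumes a: "alternating (Suc k) a"
  shows "alternating k (contract x a)"
  unfolding alternating_def contract_def
proof (intro conjI allI impI)
  fix v w :: "nat \<Rightarrow> 'a" assume "\<forall>j<k. v j = w j"
  then show "a (case_nat x v) = a (case_nat x w)"
    by (intro alternating_cong[OF a]) (auto split: nat.split)
next
  fix v :: "nat \<Rightarrow> 'a" and j assume j: "j < k"
  then show "linear (\<lambda>y. a (case_nat x (v(j := y))))"
    unfolding case_nat_upd using alternating_linear[OF a] by simp
next
  fix v :: "nat \<Rightarrow> 'a" and j l assume "j < k" "l < k" "j \<noteq> l \<and> v j = v l"
  then show "a (case_nat x v) = 0"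
    by (intro alternating_eq_0[OF a, of "Suc j" "Suc l"]) auto
qed

lemma nth_Cons_case_nat: "(!) (x # xs) = case_nat x ((!) xs)"
  by (auto simp: fun_eq_iff split: nat.split)

lemma contract_nth: "contract x a ((!) xs) = a ((!) (x # xs))"
  by (simp add: contract_def nth_Cons_case_nat)

text \<open>A \<open>k\<close>-form depends on \<open>k\<close> vectors only. These are listed in what follows, and the tuple is \<open>(!) xs\<close>,
  whose entries beyond the length of \<open>xs\<close> are irrelevant.\<close>

lemma alternating_as_list:
  assumes "alternating k a" shows "a v = a ((!) (map v [0..<k]))"
  by (rule alternating_cong[OF assms]) simp

section \<open>The wedge product\<close>

text \<open>Permuting the arguments of an antisymmetrised function multiplies it by the sign. This is why
  the wedge product is alternating.\<close>

lemma mwedge_permute_sum: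
  fixes w :: "nat \<Rightarrow> 'e"
  assumes q: "q permutes {..<n}"
  shows "(\<Sum>p | p permutes {..<n}. of_int (sign p) * F (w \<circ> q \<circ> p))
       = of_int (sign q) * (\<Sum>p | p permutes {..<n}. of_int (sign p) * F (w \<circ> p) :: real)"
proof -
  have "(\<Sum>p | p permutes {..<n}. of_int (sign p) * F (w \<circ> p))
      = (\<Sum>p | p permutes {..<n}. of_int (sign (q \<circ> p)) * F (w \<circ> (q \<circ> p)))"
    by (rule setum_permutations_compose_left[OF q])
  also have "\<dots> = (\<Sum>p | p permutes {..<n}. of_int (sign q) * (of_int (sign p) * F (w \<circ> q \<circ> p)))"
  proof (intro sum.cong refl)
    fix p assume "p \<in> {p. p permutes {..<n}}"
    then have "sign (q \<circ> p) = sign q * sign p"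
      using q by (intro sign_compose) (auto simp: permutation_permutes)
    then show "of_int (sign (q \<circ> p)) * F (w \<circ> (q \<circ> p))
        = of_int (sign q) * (of_int (sign p) * F (w \<circ> q \<circ> p))"
      by (simp add: o_assoc)
  qed
  finally have "(\<Sum>p | p permutes {..<n}. of_int (sign p) * F (w \<circ> p))
    = of_int (sign q) * (\<Sum>p | p permutes {..<n}. of_int (sign p) * F (w \<circ> q \<circ> p))"
    by (simp add: sum_distrib_left)
  moreover have "real_of_int (sign q) * of_int (sign q) = 1"
    by (simp flip: of_int_mult)
  ultimately show ?thesis
    by (simp flip: mult.assoc)
qed

lemma alternating_mwedge:
  assumes a: "alternating k a" and b: "alternating l b"
  shows "alternating (k + l) (mwedge k l a b)"
proof -
  define F where "F w = a w * b (\<lambda>j. w (k + j))" for w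
  define S where "S w = (\<Sum>p | p permutes {..<k + l}. of_int (sign p) * F (w \<circ> p))" for w
  have eq: "mwedge k l a b = (\<lambda>w. 1 / (fact k * fact l) * S w)"
    by (simp add: mwedge_def S_def F_def o_def mult.assoc)
  have F_linear: "linear (\<lambda>x. F (w(j := x)))" if "j < k + l" for w j
  proof (cases "j < k")
    case True
    then have "(\<lambda>i. (w(j := x)) (k + i)) = (\<lambda>i. w (k + i))" for x
      by auto
    then have "(\<lambda>x. F (w(j := x))) = (\<lambda>x. b (\<lambda>i. w (k + i)) * a (w(j := x)))"
      by (simp add: F_def mult.commute)
    then show ?thesis
      using linear_compose_scale_right[OF alternating_linear[OF a True]] by simp
  next
    case False
    then have "(\<lambda>i. (w(j := x)) (k + i)) = (\<lambda>i. w (k + i))(j - k := x)" for x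
      using False by (auto simp: fun_eq_iff)
    moreover have "a (w(j := x)) = a w" for x
      by (intro alternating_cong[OF a]) (use False in auto)
    ultimately have "(\<lambda>x. F (w(j := x))) = (\<lambda>x. a w * b ((\<lambda>i. w (k + i))(j - k := x)))"
      by (simp add: F_def)
    then show ?thesis
      using linear_compose_scale_right[OF alternating_linear[OF b, of "j - k"]] that False by simp
  qed
  have "alternating (k + l) S"
    unfolding alternating_def
  proof (intro conjI allI impI)
    fix v w :: "nat \<Rightarrow> 'a" assume eq: "\<forall>j<k + l. v j = w j"
    have "F (v \<circ> p) = F (w \<circ> p)" if p: "p permutes {..<k + l}" for p
    proof -
      have "v (p j) = w (p j)" if "j < k + l" for j
        using permutes_in_image[OF p, of j] that eq by simp
      then have "a (v \<circ> p) = a (w \<circ> p)" "b (\<lambda>j. (v \<circ> p) (k + j)) = b (\<lambda>j. (w \<circ> p) (k + j))"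
        by (auto intro!: alternating_cong[OF a] alternating_cong[OF b])
      then show ?thesis by (simp add: F_def)
    qed
    then show "S v = S w"
      unfolding S_def by (intro sum.cong) auto
  next
    fix v :: "nat \<Rightarrow> 'a" and j assume j: "j < k + l"
    have "linear (\<lambda>x. of_int (sign p) * F (v(j := x) \<circ> p))" if p: "p permutes {..<k + l}" for p
    proof -
      have "inv p j < k + l"
        using permutes_in_image[OF permutes_inv[OF p], of j] j by simp
      moreover have "v(j := x) \<circ> p = (v \<circ> p)(inv p j := x)" for x
        using permutes_inverses[OF p] by (auto simp: fun_eq_iff)
      ultimately show ?thesis
        using linear_compose_scale_right[OF F_linear[of "inv p j" "v \<circ> p"]] by simp
    qed
    then show "linear (\<lambda>x. S (v(j := x)))"
      unfolding S_def by (intro linear_compose_sum) auto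
  next
    fix v :: "nat \<Rightarrow> 'a" and j m assume jm: "j < k + l" "m < k + l" "j \<noteq> m \<and> v j = v m"
    define q where "q = Transposition.transpose j m"
    have q: "q permutes {..<k + l}" "sign q = -1"
      using jm by (auto simp: q_def permutes_swap_id sign_swap_id)
    have "v \<circ> q = v"
      using jm by (auto simp: q_def fun_eq_iff Transposition.transpose_def)
    then have "S v = - S v"
      unfolding S_def using mwedge_permute_sum[OF q(1), of F v] q(2) by simp
    then show "S v = 0" by simp
  qed
  then show ?thesis
    unfolding eq by (rule alternating_scale)
qed

lemma mwedge_0_left:
  assumes a: "alternating 0 a" and b: "alternating l b"
  shows "mwedge 0 l a b v = a v * b v"
proof -
  have "of_int (sign p) * a (\<lambda>j. v (p j)) * b (\<lambda>j. v (p j)) = a v * b v" if "p permutes {..<l}" for p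
  proof -
    have "a (\<lambda>j. v (p j)) = a v"
      by (rule alternating_cong[OF a]) simp
    moreover have "of_int (sign p) * b (\<lambda>j. v (p j)) = b v"
      using alternating_permute[OF b that, of v]
      by (simp add: o_def flip: mult.assoc of_int_mult)
    ultimately show ?thesis
      by (metis mult.assoc mult.commute)
  qed
  then show ?thesis
    by (simp add: mwedge_def card_permutations[of _ l])
qed

lemma mwedge_0_right:
  assumes a: "alternating k a" and b: "alternating 0 b"
  shows "mwedge k 0 a b v = a v * b v"
proof -
  have "b (\<lambda>j. v (p (k + j))) = b v" for p
    by (rule alternating_cong[OF b]) simp
  moreover have "of_int (sign p) * a (\<lambda>j. v (p j)) = a v" if "p permutes {..<k}" for p
    using alternating_permute[OF a that, of v]
    by (simp add: o_def flip: mult.assoc of_int_mult)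
  ultimately have "(\<Sum>p | p permutes {..<k}. of_int (sign p) * a (\<lambda>j. v (p j)) * b (\<lambda>j. v (p (k + j))))
      = (\<Sum>p | p permutes {..<k}. a v * b v)"
    by (intro sum.cong) auto
  then show ?thesis
    by (simp add: mwedge_def card_permutations[of _ k])
qed

text \<open>A permutation of \<open>{..<n}\<close> acts on the arguments that are left after the first one.\<close>

definition lift_perm :: "(nat \<Rightarrow> nat) \<Rightarrow> nat \<Rightarrow> nat" where
  "lift_perm q = case_nat 0 (\<lambda>j. Suc (q j))"

lemma lift_perm:
  assumes q: "q permutes {..<n}"
  shows "lift_perm q permutes {..<Suc n}" and "sign (lift_perm q) = sign q"
proof -
  have bij: "bij_betw Suc {..<n} (Suc ` {..<n})"
    by (simp add: bij_betw_def)
  have "lift_perm q j = map_permutation {..<n} Suc q j" for j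
  proof (cases j)
    case 0
    then show ?thesis
      by (auto simp: lift_perm_def map_permutation_def restrict_id_def)
  next
    case (Suc i)
    then show ?thesis
      using permutes_not_in[OF q, of i]
      by (auto simp: lift_perm_def map_permutation_def restrict_id_def inv_into_f_f)
  qed
  then have eq: "lift_perm q = map_permutation {..<n} Suc q"
    by auto
  show "lift_perm q permutes {..<Suc n}"
    unfolding eq using map_permutation_permutes[OF bij q] by (rule permutes_subset) auto
  show "sign (lift_perm q) = sign q"
    unfolding eq using q by (intro sign_map_permutation) auto
qed

text \<open>Both sides have \<open>n!\<close> elements, so that injectivity suffices.\<close>

lemma bij_betw_lift_perm:
  "bij_betw lift_perm {q. q permutes {..<n}} {p. p permutes {..<Suc n} \<and> p 0 = 0}"
proof -
  have inj: "inj_on lift_perm {q. q permutes {..<n}}"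
  proof
    fix p q assume "lift_perm p = lift_perm q"
    then have "lift_perm p (Suc j) = lift_perm q (Suc j)" for j by simp
    then show "p = q" by (auto simp: lift_perm_def)
  qed
  have "p permutes {1..<Suc n}" if "p permutes {..<Suc n}" "p 0 = 0" for p
    using that(1) by (rule permutes_superset) (use that(2) in \<open>auto simp: not_le\<close>)
  moreover have "p permutes {..<Suc n} \<and> p 0 = 0" if "p permutes {1..<Suc n}" for p
  proof
    show "p permutes {..<Suc n}"
      using that by (rule permutes_subset) auto
    show "p 0 = 0"
      using permutes_not_in[OF that, of 0] by simp
  qed
  ultimately have "{p. p permutes {..<Suc n} \<and> p 0 = 0} = {p. p permutes {1..<Suc n}}"
    by blast
  moreover have "card {p. p permutes {1..<Suc n}} = fact n" "finite {p. p permutes {1..<Suc n}}"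
    by (auto simp: card_permutations finite_permutations)
  ultimately have fin: "finite {p. p permutes {..<Suc n} \<and> p 0 = 0}"
    and card: "card {p. p permutes {..<Suc n} \<and> p 0 = 0} = fact n"
    by simp_all
  have "card (lift_perm ` {q. q permutes {..<n}}) = fact n"
    using inj by (simp add: card_image card_permutations)
  moreover have "lift_perm ` {q. q permutes {..<n}} \<subseteq> {p. p permutes {..<Suc n} \<and> p 0 = 0}"
    using lift_perm(1) by (auto simp: lift_perm_def)
  ultimately have "lift_perm ` {q. q permutes {..<n}} = {p. p permutes {..<Suc n} \<and> p 0 = 0}"
    using card by (intro card_subset_eq[OF fin]) auto
  with inj show ?thesis
    by (simp add: bij_betw_def)
qed

text \<open>Every permutation sends exactly one position \<open>m\<close> to \<open>0\<close>.\<close>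

lemma sum_permutes_position:
  fixes F :: "(nat \<Rightarrow> nat) \<Rightarrow> real"
  shows "(\<Sum>p | p permutes {..<Suc n}. F p) = (\<Sum>m<Suc n. \<Sum>p | p permutes {..<Suc n} \<and> p m = 0. F p)"
proof -
  have "(\<Sum>m<Suc n. if p m = 0 then F p else 0) = F p" if p: "p permutes {..<Suc n}" for p
  proof -
    have "p m = 0 \<longleftrightarrow> m = inv p 0" for m
      using permutes_inv_eq[OF p] by metis
    moreover have "inv p 0 < Suc n"
      using permutes_in_image[OF permutes_inv[OF p], of 0] by simp
    ultimately show ?thesis by simp
  qed
  then have "(\<Sum>p | p permutes {..<Suc n}. F p)
      = (\<Sum>p | p permutes {..<Suc n}. \<Sum>m<Suc n. if p m = 0 then F p else 0)"
    by (intro sum.cong) auto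
  also have "\<dots> = (\<Sum>m<Suc n. \<Sum>p | p permutes {..<Suc n}. if p m = 0 then F p else 0)"
    by (rule sum.swap)
  also have "\<dots> = (\<Sum>m<Suc n. \<Sum>p | p permutes {..<Suc n} \<and> p m = 0. F p)"
    by (rule sum.cong[OF refl]) (simp add: sum.If_cases finite_permutations Int_def)
  finally show ?thesis .
qed

lemma sum_permutes_move:
  fixes F :: "(nat \<Rightarrow> nat) \<Rightarrow> real"
  assumes c: "c permutes {..<n}" and m: "c m' = m"
  shows "(\<Sum>p | p permutes {..<n} \<and> p m = 0. F p) = (\<Sum>p | p permutes {..<n} \<and> p m' = 0. F (p \<circ> inv c))"
proof (rule sum.reindex_bij_witness[of _ "\<lambda>p. p \<circ> inv c" "\<lambda>p. p \<circ> c"])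
  have inv_m: "inv c m = m'"
    using m permutes_inverses(2)[OF c] by auto
  show "p \<circ> c \<circ> inv c = p" "p \<circ> inv c \<circ> c = p" for p :: "nat \<Rightarrow> nat"
    using permutes_inv_o[OF c] by (auto simp flip: o_assoc)
  then show "F (p \<circ> c \<circ> inv c) = F p" for p
    by simp
  show "p \<circ> c \<in> {p. p permutes {..<n} \<and> p m' = 0}" if "p \<in> {p. p permutes {..<n} \<and> p m = 0}" for p
    using that m permutes_compose[OF c] by auto
  show "p \<circ> inv c \<in> {p. p permutes {..<n} \<and> p m = 0}" if "p \<in> {p. p permutes {..<n} \<and> p m' = 0}" for p
    using that inv_m permutes_compose[OF permutes_inv[OF c]] by auto
qed

text \<open>The cyclic permutation that sends the position \<open>k\<close> to the front.\<close>

definition to_front :: "nat \<Rightarrow> nat \<Rightarrow> nat" where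
  "to_front k j = (if j < k then Suc j else if j = k then 0 else j)"

lemma to_front: "to_front k permutes {..k}" "sign (to_front k) = (-1) ^ k"
proof (induction k)
  case 0
  have "to_front 0 = id" by (auto simp: to_front_def)
  then show "to_front 0 permutes {..0}" "sign (to_front 0) = (-1) ^ 0"
    by (simp_all add: permutes_id)
next
  case (Suc k)
  have eq: "to_front (Suc k) = to_front k \<circ> Transposition.transpose k (Suc k)"
    by (auto simp: to_front_def fun_eq_iff Transposition.transpose_def)
  have sub: "to_front k permutes {..Suc k}"
    using Suc(1) by (rule permutes_subset) auto
  have tr: "Transposition.transpose k (Suc k) permutes {..Suc k}"
    by (rule permutes_swap_id) auto
  show "to_front (Suc k) permutes {..Suc k}"
    unfolding eq by (rule permutes_compose[OF tr sub])
  show "sign (to_front (Suc k)) = (-1) ^ Suc k"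
    unfolding eq using sub tr Suc(2)
    by (subst sign_compose) (auto intro: permutes_imp_permutation[of "{..Suc k}"] simp: sign_swap_id)
qed

text \<open>The contraction with a vector is an antiderivation. For the wedge product as a sum over
  permutations, this is the classification of the permutations by the position of the first
  argument: the positions inside one factor contribute equally, because that factor is
  alternating.\<close>

theorem mwedge_Suc_Suc:
  assumes a: "alternating (Suc k) a" and b: "alternating (Suc l) b"
  shows "mwedge (Suc k) (Suc l) a b (case_nat x v)
    = mwedge k (Suc l) (contract x a) b v + (-1) ^ Suc k * mwedge (Suc k) l a (contract x b) v"
proof -
  define n where "n = Suc (k + l)"
  define w where "w = case_nat x v"
  define F where "F w = a w * b (\<lambda>j. w (Suc k + j))" for w
  define G where "G p = of_int (sign p) * F (w \<circ> p)" for p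
  define S where "S m = (\<Sum>p | p permutes {..<Suc n} \<and> p m = 0. G p)" for m
  have G_swap: "G (p \<circ> Transposition.transpose i j) = G p"
    if p: "p permutes {..<Suc n}" and ij: "i < Suc n" "j < Suc n" "i \<le> k \<longleftrightarrow> j \<le> k" for p i j
  proof (cases "i = j")
    case False
    let ?t = "Transposition.transpose i j"
    have "sign (p \<circ> ?t) = - sign p"
      using p False by (subst sign_compose)
        (auto intro: permutes_imp_permutation[of "{..<Suc n}"] permutation_swap_id simp: sign_swap_id)
    moreover have "F (u \<circ> ?t) = - F u" for u
    proof (cases "i \<le> k")
      case True
      then have "a (u \<circ> ?t) = - a u"
        using ij False by (intro alternating_swap[OF a]) auto
      moreover have "(\<lambda>m. (u \<circ> ?t) (Suc k + m)) = (\<lambda>m. u (Suc k + m))"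
        using True ij by (auto simp: fun_eq_iff Transposition.transpose_def)
      ultimately show ?thesis by (simp add: F_def)
    next
      case i: False
      have "b ((\<lambda>m. u (Suc k + m)) \<circ> Transposition.transpose (i - Suc k) (j - Suc k))
          = - b (\<lambda>m. u (Suc k + m))"
        using i ij False by (intro alternating_swap[OF b]) (auto simp: n_def)
      moreover have "(\<lambda>m. (u \<circ> ?t) (Suc k + m))
          = (\<lambda>m. u (Suc k + m)) \<circ> Transposition.transpose (i - Suc k) (j - Suc k)"
        using i ij by (auto simp: fun_eq_iff Transposition.transpose_def)
      moreover have "a (u \<circ> ?t) = a u"
        using i ij by (intro alternating_cong[OF a]) (auto simp: Transposition.transpose_def)
      ultimately show ?thesis by (simp add: F_def)
    qed
    ultimately show ?thesis
      by (simp add: G_def o_assoc)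
  qed simp
  have S_block: "S i = S j" if ij: "i < Suc n" "j < Suc n" "i \<le> k \<longleftrightarrow> j \<le> k" for i j
  proof -
    have "S i = (\<Sum>p | p permutes {..<Suc n} \<and> p j = 0. G (p \<circ> inv (Transposition.transpose i j)))"
      unfolding S_def by (rule sum_permutes_move) (use ij in \<open>auto intro: permutes_swap_id\<close>)
    also have "\<dots> = S j"
      unfolding S_def using ij by (intro sum.cong) (auto simp: G_swap)
    finally show ?thesis .
  qed
  have "S 0 = (\<Sum>q | q permutes {..<n}. G (lift_perm q))"
    unfolding S_def by (rule sum.reindex_bij_betw[OF bij_betw_lift_perm, symmetric])
  moreover have "G (lift_perm q)
      = of_int (sign q) * contract x a (\<lambda>j. v (q j)) * b (\<lambda>j. v (q (k + j)))"
    if q: "q permutes {..<n}" for q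
  proof -
    have "w \<circ> lift_perm q = case_nat x (\<lambda>j. v (q j))"
      by (auto simp: w_def lift_perm_def fun_eq_iff split: nat.split)
    then show ?thesis
      by (simp add: G_def F_def lift_perm(2)[OF q] contract_def)
  qed
  ultimately have S0: "S 0 = (fact k * fact (Suc l)) * mwedge k (Suc l) (contract x a) b v"
    unfolding mwedge_def n_def by (simp del: fact_Suc)
  have tf: "to_front (Suc k) permutes {..<Suc n}"
    using to_front(1) by (rule permutes_subset) (auto simp: n_def)
  have inv_tf: "inv (inv (to_front (Suc k))) = to_front (Suc k)" "inv (to_front (Suc k)) 0 = Suc k"
  proof -
    have eq: "to_front (Suc k) (Suc k) = 0"
      by (simp add: to_front_def)
    show "inv (to_front (Suc k)) 0 = Suc k"
      using permutes_inverses(2)[OF tf, of "Suc k"] unfolding eq .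
  qed (rule permutes_inv_inv[OF tf])
  have "S (Suc k) = (\<Sum>p | p permutes {..<Suc n} \<and> p 0 = 0. G (p \<circ> to_front (Suc k)))"
    unfolding S_def by (rule sum_permutes_move[OF permutes_inv[OF tf], unfolded inv_tf(1), OF inv_tf(2)])
  also have "\<dots> = (\<Sum>q | q permutes {..<n}. G (lift_perm q \<circ> to_front (Suc k)))"
    by (rule sum.reindex_bij_betw[OF bij_betw_lift_perm, symmetric])
  also have "\<dots> = (\<Sum>q | q permutes {..<n}.
      (-1) ^ Suc k * (of_int (sign q) * a (\<lambda>j. v (q j)) * contract x b (\<lambda>j. v (q (Suc k + j)))))"
  proof (intro sum.cong refl)
    fix q assume "q \<in> {q. q permutes {..<n}}"
    then have q: "q permutes {..<n}" by simp
    have "sign (lift_perm q \<circ> to_front (Suc k)) = sign q * (-1) ^ Suc k"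
      using lift_perm[OF q] tf to_front(2)[of "Suc k"]
      by (subst sign_compose) (auto intro: permutes_imp_permutation[of "{..<Suc n}"])
    moreover have "a (w \<circ> (lift_perm q \<circ> to_front (Suc k))) = a (\<lambda>j. v (q j))"
      by (intro alternating_cong[OF a]) (auto simp: w_def lift_perm_def to_front_def)
    moreover have "(\<lambda>j. (w \<circ> (lift_perm q \<circ> to_front (Suc k))) (Suc k + j))
        = case_nat x (\<lambda>j. v (q (Suc k + j)))"
      by (auto simp: w_def lift_perm_def to_front_def fun_eq_iff split: nat.split)
    ultimately show "G (lift_perm q \<circ> to_front (Suc k))
      = (-1) ^ Suc k * (of_int (sign q) * a (\<lambda>j. v (q j)) * contract x b (\<lambda>j. v (q (Suc k + j))))"
      by (simp add: G_def F_def contract_def)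
  qed
  finally have S1: "S (Suc k) = (fact (Suc k) * fact l) * ((-1) ^ Suc k * mwedge (Suc k) l a (contract x b) v)"
    unfolding mwedge_def n_def by (simp del: fact_Suc power_Suc flip: sum_distrib_left)
  have split: "{..<Suc n} = {..k} \<union> {Suc k..<Suc n}"
    by (auto simp: n_def)
  have "(\<Sum>p | p permutes {..<Suc n}. G p) = (\<Sum>m<Suc n. S m)"
    unfolding S_def by (rule sum_permutes_position)
  also have "\<dots> = (\<Sum>m\<le>k. S m) + (\<Sum>m=Suc k..<Suc n. S m)"
    unfolding split by (rule sum.union_disjoint) auto
  also have "(\<Sum>m\<le>k. S m) = (\<Sum>m\<le>k. S 0)"
    by (intro sum.cong refl S_block) (auto simp: n_def)
  also have "(\<Sum>m=Suc k..<Suc n. S m) = (\<Sum>m=Suc k..<Suc n. S (Suc k))"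
    by (intro sum.cong refl S_block) (auto simp: n_def)
  finally have "(\<Sum>p | p permutes {..<Suc n}. G p) = real (Suc k) * S 0 + real (Suc l) * S (Suc k)"
    by (simp add: n_def)
  then have "mwedge (Suc k) (Suc l) a b w
      = (real (Suc k) * S 0 + real (Suc l) * S (Suc k)) / (fact (Suc k) * fact (Suc l))"
    by (simp add: mwedge_def G_def F_def o_def n_def mult.assoc del: fact_Suc)
  also have "\<dots> = mwedge k (Suc l) (contract x a) b v + (-1) ^ Suc k * mwedge (Suc k) l a (contract x b) v"
  proof -
    have *: "(A * ((K * (B * L)) * X) + B * (((A * K) * L) * Y)) / ((A * K) * (B * L)) = X + Y"
      if "A \<noteq> 0" "B \<noteq> 0" "K \<noteq> 0" "L \<noteq> 0" for A B K L X Y :: real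
      using that by (simp add: field_simps)
    show ?thesis
      unfolding S0 S1 fact_Suc by (rule *) auto
  qed
  finally show ?thesis
    unfolding w_def .
qed

text \<open>For arguments given by a list the recursion is a rewrite rule, which turns wedge products of low
  degree into signed sums over shuffles.\<close>

lemma mwedge_Cons:
  assumes "alternating (Suc k) a" and "alternating (Suc l) b"
  shows "mwedge (Suc k) (Suc l) a b ((!) (x # xs))
    = mwedge k (Suc l) (contract x a) b ((!) xs) + (-1) ^ Suc k * mwedge (Suc k) l a (contract x b) ((!) xs)"
  unfolding nth_Cons_case_nat by (rule mwedge_Suc_Suc[OF assms])

lemma mwedge_0_left_nth:
  assumes "alternating 0 a" and "alternating l b"
  shows "mwedge 0 l a b ((!) xs) = a ((!) []) * b ((!) xs)"
  using mwedge_0_left[OF assms] alternating_cong[OF assms(1), of "(!) xs" "(!) []"] by simp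

lemma mwedge_0_right_nth:
  assumes "alternating k a" and "alternating 0 b"
  shows "mwedge k 0 a b ((!) xs) = a ((!) xs) * b ((!) [])"
  using mwedge_0_right[OF assms] alternating_cong[OF assms(2), of "(!) xs" "(!) []"] by simp

lemmas mwedge_expand =
  numeral_eq_Suc mwedge_Cons mwedge_0_left_nth mwedge_0_right_nth alternating_contract contract_nth

lemma mwedge_1_1:
  assumes "alternating 1 a" "alternating 1 b"
  shows "mwedge 1 1 a b ((!) [x, y]) = a ((!) [x]) * b ((!) [y]) - a ((!) [y]) * b ((!) [x])"
  using assms by (simp add: mwedge_expand)

lemma mwedge_1_2:
  assumes "alternating 1 a" "alternating 2 b"
  shows "mwedge 1 2 a b ((!) [x, y, z])
    = a ((!) [x]) * b ((!) [y, z]) - a ((!) [y]) * b ((!) [x, z]) + a ((!) [z]) * b ((!) [x, y])"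
  using assms by (simp add: mwedge_expand)

lemma mwedge_2_1:
  assumes "alternating 2 a" "alternating 1 b"
  shows "mwedge 2 1 a b ((!) [x, y, z])
    = a ((!) [x, y]) * b ((!) [z]) - a ((!) [x, z]) * b ((!) [y]) + a ((!) [y, z]) * b ((!) [x])"
  using assms by (simp add: mwedge_expand)

lemma mwedge_3_1:
  assumes "alternating 3 a" "alternating 1 b"
  shows "mwedge 3 1 a b ((!) [x, y, z, w])
    = a ((!) [x, y, z]) * b ((!) [w]) - a ((!) [x, y, w]) * b ((!) [z])
      + a ((!) [x, z, w]) * b ((!) [y]) - a ((!) [y, z, w]) * b ((!) [x])"
  using assms by (simp add: mwedge_expand)

lemma mwedge_4_1:
  assumes "alternating 4 a" "alternating 1 b"
  shows "mwedge 4 1 a b ((!) [x, y, z, w, t])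
    = a ((!) [x, y, z, w]) * b ((!) [t]) - a ((!) [x, y, z, t]) * b ((!) [w])
      + a ((!) [x, y, w, t]) * b ((!) [z]) - a ((!) [x, z, w, t]) * b ((!) [y])
      + a ((!) [y, z, w, t]) * b ((!) [x])"
  using assms by (simp add: mwedge_expand)

lemma mwedge_1_3:
  assumes "alternating 1 a" "alternating 3 b"
  shows "mwedge 1 3 a b ((!) [x, y, z, w])
    = a ((!) [x]) * b ((!) [y, z, w]) - a ((!) [y]) * b ((!) [x, z, w])
      + a ((!) [z]) * b ((!) [x, y, w]) - a ((!) [w]) * b ((!) [x, y, z])"
  using assms by (simp add: mwedge_expand)

lemma mwedge_2_2:
  assumes "alternating 2 a" "alternating 2 b"
  shows "mwedge 2 2 a b ((!) [x, y, z, w])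
    = a ((!) [x, y]) * b ((!) [z, w]) - a ((!) [x, z]) * b ((!) [y, w])
      + a ((!) [x, w]) * b ((!) [y, z]) + a ((!) [y, z]) * b ((!) [x, w])
      - a ((!) [y, w]) * b ((!) [x, z]) + a ((!) [z, w]) * b ((!) [x, y])"
  using assms by (simp add: mwedge_expand)

text \<open>If the \<open>1\<close>-form sees only the last vector, a single shuffle survives. For \<open>b = ds\<close> this splits off the
  direction of the circle.\<close>

lemma mwedge_snoc:
  assumes a: "alternating k a" and b: "alternating 1 b"
    and xs: "length xs = k" "\<And>x. x \<in> set xs \<Longrightarrow> b ((!) [x]) = 0"
  shows "mwedge k 1 a b ((!) (xs @ [y])) = a ((!) xs) * b ((!) [y])"
  using a xs
proof (induction xs arbitrary: k a)
  case Nil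
  then show ?case using b by (simp add: mwedge_0_left_nth)
next
  case (Cons x xs)
  then have k: "k = Suc (length xs)" by simp
  have "mwedge (length xs) 1 (contract x a) b ((!) (xs @ [y])) = contract x a ((!) xs) * b ((!) [y])"
    using Cons.prems by (intro Cons.IH) (auto simp: k alternating_contract)
  then show ?case
    using Cons.prems b unfolding k
    by (simp add: mwedge_Cons mwedge_0_right_nth alternating_contract contract_nth)
qed

lemma mwedge_snoc_zero:
  assumes a: "alternating k a" and b: "alternating 1 b"
    and xs: "length xs = Suc k" "\<And>x. x \<in> set xs \<Longrightarrow> b ((!) [x]) = 0"
  shows "mwedge k 1 a b ((!) xs) = 0"
proof -
  have "xs = butlast xs @ [last xs]" and "last xs \<in> set xs"
    using xs(1) by (cases xs rule: rev_cases; simp)+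
  then show ?thesis
    using mwedge_snoc[OF a b, of "butlast xs" "last xs"] xs by (auto dest: in_set_butlastD)
qed

section \<open>Alternating forms on a frame\<close>

lemma alternating_move:
  assumes "alternating k a" and "length (ps @ y # zs @ ws) = k"
  shows "a ((!) (ps @ y # zs @ ws)) = (-1) ^ length zs * a ((!) (ps @ zs @ y # ws))"
  using assms(2)
proof (induction zs arbitrary: ps)
  case Nil
  then show ?case by simp
next
  case (Cons z zs)
  let ?t = "Transposition.transpose (length ps) (Suc (length ps))"
  have "a ((!) (ps @ y # z # zs @ ws)) = a ((!) (ps @ z # y # zs @ ws) \<circ> ?t)"
  proof (rule alternating_cong[OF assms(1)])
    fix j
    consider "j < length ps" | "j = length ps" | "j = Suc (length ps)" | "j > Suc (length ps)"
      by linarith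
    then show "(ps @ y # z # zs @ ws) ! j = ((!) (ps @ z # y # zs @ ws) \<circ> ?t) j"
      by cases (auto simp: nth_append Transposition.transpose_def nth_Cons split: nat.split)
  qed
  also have "\<dots> = - a ((!) (ps @ z # y # zs @ ws))"
    using Cons.prems by (intro alternating_swap[OF assms(1)]) auto
  also have "\<dots> = - ((-1) ^ length zs * a ((!) ((ps @ [z]) @ zs @ y # ws)))"
    using Cons.IH[of "ps @ [z]"] Cons.prems by simp
  finally show ?case by simp
qed

text \<open>The sign of the permutation that sorts a list.\<close>

primrec list_sign :: "nat list \<Rightarrow> real" where
  "list_sign [] = 1"
| "list_sign (x # xs) = (-1) ^ length (filter (\<lambda>y. y < x) xs) * list_sign xs"

lemma list_sign_square: "list_sign xs * list_sign xs = 1"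
  by (induction xs) (auto simp: power_mult_distrib[symmetric] mult_ac simp flip: power_add)

lemma insort_eq_filter:
  assumes "sorted xs"
  shows "insort x xs = filter (\<lambda>y. y < x) xs @ x # filter (\<lambda>y. \<not> y < x) (xs :: nat list)"
  using assms
proof (induction xs)
  case (Cons y ys)
  show ?case
  proof (cases "x \<le> y")
    case True
    then have "filter (\<lambda>z. z < x) (y # ys) = []" "filter (\<lambda>z. \<not> z < x) (y # ys) = y # ys"
      using Cons.prems by (auto simp: filter_empty_conv filter_id_conv)
    then show ?thesis using True by simp
  qed (use Cons in auto)
qed simp

lemma alternating_sort_middle:
  assumes a: "alternating k a" and "length (ps @ map u xs @ zs) = k"
  shows "a ((!) (ps @ map u xs @ zs)) = list_sign xs * a ((!) (ps @ map u (sort xs) @ zs))"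
  using assms(2)
proof (induction xs arbitrary: ps)
  case Nil
  then show ?case by simp
next
  case (Cons x xs)
  let ?l = "filter (\<lambda>y. y < x) (sort xs)" and ?r = "filter (\<lambda>y. \<not> y < x) (sort xs)"
  have part: "sort xs = ?l @ ?r"
  proof -
    have "sorted ys \<Longrightarrow> ys = filter (\<lambda>y. y < x) ys @ filter (\<lambda>y. \<not> y < x) ys" for ys
    proof (induction ys)
      case (Cons y ys)
      then show ?case
      proof (cases "y < x")
        case False
        then have "filter (\<lambda>y. y < x) ys = []" "filter (\<lambda>y. \<not> y < x) ys = ys"
          using Cons.prems by (auto simp: filter_empty_conv filter_id_conv)
        then show ?thesis using False by simp
      qed simp
    qed simp
    then show ?thesis by simp
  qed
  have len: "length ?l = length (filter (\<lambda>y. y < x) xs)"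
    by (metis filter_sort length_sort)
  have "a ((!) (ps @ map u (x # xs) @ zs)) = list_sign xs * a ((!) (ps @ u x # map u (sort xs) @ zs))"
    using Cons.IH[of "ps @ [u x]"] Cons.prems by simp
  also have "ps @ u x # map u (sort xs) @ zs = ps @ u x # map u ?l @ (map u ?r @ zs)"
    by (metis part map_append append.assoc)
  also have "a ((!) (ps @ u x # map u ?l @ (map u ?r @ zs)))
      = (-1) ^ length (map u ?l) * a ((!) (ps @ map u ?l @ u x # map u ?r @ zs))"
    using Cons.prems sum_length_filter_compl[of "\<lambda>y. y < x" "sort xs"]
    by (intro alternating_move[OF a]) simp
  also have "map u ?l @ u x # map u ?r @ zs = map u (sort (x # xs)) @ zs"
    by (simp add: insort_eq_filter)
  finally show ?case by (simp add: len mult_ac)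
qed

lemmas alternating_sort = alternating_sort_middle[where ps = "[]" and zs = "[]", simplified]
lemmas alternating_sort_prefix = alternating_sort_middle[where ps = "[]", simplified]

text \<open>By multilinearity the arguments are replaced by frame vectors one after the other, and sorting
  the frame vectors costs a sign only.\<close>

lemma alternating_eq_0_frame:
  fixes u :: "nat \<Rightarrow> 'e::real_vector"
  assumes F: "alternating m F"
    and span: "\<And>x. x = (\<Sum>i<n. c x i *\<^sub>R u i)"
    and zero: "\<And>J. length J = m \<Longrightarrow> sorted_wrt (<) J \<Longrightarrow> set J \<subseteq> {..<n} \<Longrightarrow> F ((!) (map u J)) = 0"
  shows "F v = 0"
proof -
  have "F v = 0" if "\<And>i. j \<le> i \<Longrightarrow> i < m \<Longrightarrow> v i \<in> u ` {..<n}" "j \<le> m" for j v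
    using that
  proof (induction j arbitrary: v)
    case 0
    then have "\<exists>I. \<forall>i<m. v i = u (I i) \<and> I i < n"
      by (intro choice_iff[THEN iffD1]) force
    then obtain I where I: "\<And>i. i < m \<Longrightarrow> v i = u (I i)" "\<And>i. i < m \<Longrightarrow> I i < n"
      by blast
    let ?J = "map I [0..<m]"
    have v: "F v = F ((!) (map u ?J))"
      by (rule alternating_cong[OF F]) (simp add: I)
    show ?case
    proof (cases "distinct ?J")
      case True
      have "F ((!) (map u (sort ?J))) = 0"
        by (rule zero) (use True I in \<open>auto simp: strict_sorted_iff\<close>)
      moreover have "F ((!) (map u ?J)) = list_sign ?J * F ((!) (map u (sort ?J)))"
        by (rule alternating_sort[OF F]) simp
      ultimately show ?thesis using v by simp
    next
      case False
      then obtain i l where "i < m" "l < m" "i \<noteq> l" "I i = I l"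
        by (auto simp: distinct_conv_nth)
      then show ?thesis
        using I by (intro alternating_eq_0[OF F, of i l]) auto
    qed
  next
    case (Suc j)
    interpret linear "\<lambda>x. F (v(j := x))"
      using Suc.prems by (intro alternating_linear[OF F]) auto
    have "F (v(j := u i)) = 0" if "i < n" for i
      using that Suc.prems by (intro Suc.IH) (auto simp: not_less_eq_eq le_Suc_eq Suc_le_eq)
    then have "F (v(j := (\<Sum>i<n. c (v j) i *\<^sub>R u i))) = 0"
      by (simp add: sum scale)
    then show ?case
      by (simp flip: span)
  qed
  from this[of m] show ?thesis by simp
qed

lemma alternating_eq_frame:
  fixes u :: "nat \<Rightarrow> 'e::real_vector"
  assumes F: "alternating m F" and G: "alternating m G"
    and span: "\<And>x. x = (\<Sum>i<n. c x i *\<^sub>R u i)"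
    and eq: "\<And>J. length J = m \<Longrightarrow> sorted_wrt (<) J \<Longrightarrow> set J \<subseteq> {..<n}
      \<Longrightarrow> F ((!) (map u J)) = G ((!) (map u J))"
  shows "F = G"
proof
  fix v show "F v = G v"
    using alternating_eq_0_frame[OF alternating_diff[OF F G] span, of v] eq by simp
qed

section \<open>The Hodge star in an orthonormal frame\<close>

text \<open>Orthonormal vectors are independent, and here their number is the dimension.\<close>

lemma orthonormal_frame_expand:
  fixes g :: "'e::euclidean_space \<Rightarrow> 'e \<Rightarrow> real"
  assumes g: "bilinear g" and u: "orthonormal_frame g u"
  shows "x = (\<Sum>i<DIM('e). g x (u i) *\<^sub>R u i)"
proof -
  let ?n = "DIM('e)"
  have coeff: "g (\<Sum>i<?n. c i *\<^sub>R u i) (u j) = c j" if "j < ?n" for c j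
  proof -
    interpret linear "\<lambda>x. g x (u j)"
      using g by (simp add: bilinear_def)
    have "g (\<Sum>i<?n. c i *\<^sub>R u i) (u j) = (\<Sum>i<?n. c i * g (u i) (u j))"
      by (simp add: sum scale)
    also have "\<dots> = (\<Sum>i<?n. if i = j then c i else 0)"
      using u that by (intro sum.cong) (auto simp: orthonormal_frame_def)
    finally show ?thesis using that by simp
  qed
  have inj: "inj_on u {..<?n}"
  proof
    fix i j assume ij: "i \<in> {..<?n}" "j \<in> {..<?n}" "u i = u j"
    have "g (u i) (u i) = 1" "g (u i) (u j) = (if i = j then 1 else 0)"
      using u ij(1,2) unfolding orthonormal_frame_def by simp_all
    then show "i = j" using ij(3) by (simp split: if_splits)
  qed
  have "independent (u ` {..<?n})"
  proof (rule independent_if_scalars_zero)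
    fix f x assume sum: "(\<Sum>x\<in>u ` {..<?n}. f x *\<^sub>R x) = 0" and x: "x \<in> u ` {..<?n}"
    from x obtain j where j: "j < ?n" "x = u j" by auto
    have "(\<Sum>i<?n. f (u i) *\<^sub>R u i) = 0"
      using sum by (simp add: sum.reindex[OF inj])
    then have "f (u j) = g 0 (u j)"
      using coeff[OF j(1), of "\<lambda>i. f (u i)"] by simp
    then show "f x = 0"
      using g j by (simp add: bilinear_lzero)
  qed simp
  then have "UNIV \<subseteq> span (u ` {..<?n})"
    using inj by (intro card_ge_dim_independent) (auto simp: card_image)
  then have "x \<in> span (u ` {..<?n})" by blast
  then obtain f where "x = (\<Sum>v\<in>u ` {..<?n}. f v *\<^sub>R v)"
    by (auto simp: span_finite)
  then have x: "x = (\<Sum>i<?n. f (u i) *\<^sub>R u i)"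
    by (simp add: sum.reindex[OF inj])
  have "g x (u j) = f (u j)" if "j < ?n" for j
    unfolding x using that by (rule coeff)
  then show ?thesis
    by (subst x) (auto intro: sum.cong)
qed

text \<open>A pair of linear forms is contracted with the inverse metric, which does not see the
  orthonormal frame.\<close>

lemma sum_frame_invariant:
  fixes g :: "'e::euclidean_space \<Rightarrow> 'e \<Rightarrow> real" and F G :: "'e \<Rightarrow> real"
  assumes g: "bilinear g" and sym: "\<And>x y. g x y = g y x"
    and s: "orthonormal_frame g s" and u: "orthonormal_frame g u"
    and F: "linear F" and G: "linear G"
  shows "(\<Sum>i<DIM('e). F (s i) * G (s i)) = (\<Sum>i<DIM('e). F (u i) * G (u i))"
proof -
  let ?n = "DIM('e)"
  have expand: "H x = (\<Sum>j<?n. g x (u j) * H (u j))" if "linear H" for H :: "'e \<Rightarrow> real" and x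
    using arg_cong[OF orthonormal_frame_expand[OF g u, of x], of H] that
    by (simp add: linear_sum linear_scale)
  have delta: "(\<Sum>i<?n. g (s i) (u j) * g (s i) (u k)) = g (u j) (u k)" for j k
  proof -
    interpret linear "\<lambda>x. g x (u k)"
      using g by (simp add: bilinear_def)
    show ?thesis
      using arg_cong[OF orthonormal_frame_expand[OF g s, of "u j"], of "\<lambda>x. g x (u k)"]
      by (simp add: sum scale sym[of "u j"])
  qed
  have "(\<Sum>i<?n. F (s i) * G (s i))
      = (\<Sum>i<?n. \<Sum>j<?n. \<Sum>k<?n. (g (s i) (u j) * g (s i) (u k)) * (F (u j) * G (u k)))"
    by (subst expand[OF F], subst expand[OF G]) (simp add: sum_product mult_ac)
  also have "\<dots> = (\<Sum>j<?n. \<Sum>k<?n. (\<Sum>i<?n. g (s i) (u j) * g (s i) (u k)) * (F (u j) * G (u k)))"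
    unfolding sum_distrib_right by (subst sum.swap) (rule sum.cong[OF refl], rule sum.swap)
  also have "\<dots> = (\<Sum>j<?n. \<Sum>k<?n. if k = j then F (u j) * G (u k) else 0)"
    unfolding delta using u by (intro sum.cong) (auto simp: orthonormal_frame_def)
  finally show ?thesis by simp
qed

definition multilinear :: "nat \<Rightarrow> 'e::real_vector mform \<Rightarrow> bool" where
  "multilinear k F \<longleftrightarrow> (\<forall>v w. (\<forall>j<k. v j = w j) \<longrightarrow> F v = F w) \<and>
     (\<forall>v. \<forall>j<k. linear (\<lambda>x. F (v(j := x))))"

lemma sum_tuples_Suc:
  fixes h :: "(nat \<Rightarrow> nat) \<Rightarrow> real"
  shows "(\<Sum>I \<in> {..<Suc k} \<rightarrow>\<^sub>E {..<n}. h I) = (\<Sum>I \<in> {..<k} \<rightarrow>\<^sub>E {..<n}. \<Sum>m<n. h (I(k := m)))"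
proof -
  have "{..<Suc k} \<rightarrow>\<^sub>E {..<n} = (\<lambda>(m, I). I(k := m)) ` ({..<n} \<times> ({..<k} \<rightarrow>\<^sub>E {..<n}))"
    by (simp add: lessThan_Suc PiE_insert_eq)
  moreover have "inj_on (\<lambda>(m, I). I(k := m)) ({..<n} \<times> ({..<k} \<rightarrow>\<^sub>E {..<n}))"
    using inj_combinator[of k "{..<k}" "\<lambda>_. {..<n}"] by simp
  ultimately have "(\<Sum>I \<in> {..<Suc k} \<rightarrow>\<^sub>E {..<n}. h I)
      = (\<Sum>(m, I) \<in> {..<n} \<times> ({..<k} \<rightarrow>\<^sub>E {..<n}). h (I(k := m)))"
    by (simp add: sum.reindex case_prod_unfold)
  also have "\<dots> = (\<Sum>m<n. \<Sum>I \<in> {..<k} \<rightarrow>\<^sub>E {..<n}. h (I(k := m)))"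
    by (simp add: sum.cartesian_product)
  finally show ?thesis
    by (simp only: sum.swap[of _ "{..<n}"])
qed

text \<open>The star is defined by means of some orthonormal frame. Exchanging the frame in one slot at a
  time shows that the sum does not depend on it.\<close>

lemma sum_frame_tuples_invariant:
  fixes g :: "'e::euclidean_space \<Rightarrow> 'e \<Rightarrow> real"
  assumes g: "bilinear g" and sym: "\<And>x y. g x y = g y x"
    and s: "orthonormal_frame g s" and u: "orthonormal_frame g u"
    and "multilinear k F" and "multilinear k G"
  shows "(\<Sum>I \<in> {..<k} \<rightarrow>\<^sub>E {..<DIM('e)}. F (s \<circ> I) * G (s \<circ> I))
       = (\<Sum>I \<in> {..<k} \<rightarrow>\<^sub>E {..<DIM('e)}. F (u \<circ> I) * G (u \<circ> I))"
  using assms(5,6)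
proof (induction k arbitrary: F G)
  case 0
  then have "F (s \<circ> I) = F (u \<circ> I)" "G (s \<circ> I) = G (u \<circ> I)" for I
    unfolding multilinear_def by blast+
  then show ?case by (intro sum.cong refl) metis
next
  case (Suc k)
  let ?n = "DIM('e)"
  have upd: "w \<circ> I(k := m) = (w \<circ> I)(k := w m)" for w :: "nat \<Rightarrow> 'e" and I m
    by auto
  have fixed: "multilinear k (\<lambda>w. H (w(k := x)))" if "multilinear (Suc k) H" for H :: "'e mform" and x
    unfolding multilinear_def
  proof (intro conjI allI impI)
    fix v w :: "nat \<Rightarrow> 'e" assume "\<forall>j<k. v j = w j"
    then have "\<forall>j<Suc k. (v(k := x)) j = (w(k := x)) j"
      by (simp add: less_Suc_eq)
    then show "H (v(k := x)) = H (w(k := x))"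
      using that unfolding multilinear_def by blast
  next
    fix v :: "nat \<Rightarrow> 'e" and j assume "j < k"
    then show "linear (\<lambda>y. H (v(j := y, k := x)))"
      using that unfolding multilinear_def by (simp add: fun_upd_twist[of j k])
  qed
  have lin: "linear (\<lambda>x. H (w(k := x)))" if "multilinear (Suc k) H" for H :: "'e mform" and w
    using that unfolding multilinear_def by blast
  have "(\<Sum>I \<in> {..<Suc k} \<rightarrow>\<^sub>E {..<?n}. F (s \<circ> I) * G (s \<circ> I))
      = (\<Sum>I \<in> {..<k} \<rightarrow>\<^sub>E {..<?n}. \<Sum>m<?n. F ((s \<circ> I)(k := s m)) * G ((s \<circ> I)(k := s m)))"
    unfolding sum_tuples_Suc upd ..
  also have "\<dots> = (\<Sum>I \<in> {..<k} \<rightarrow>\<^sub>E {..<?n}. \<Sum>m<?n. F ((s \<circ> I)(k := u m)) * G ((s \<circ> I)(k := u m)))"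
    using Suc.prems by (intro sum.cong[OF refl] sum_frame_invariant[OF g sym s u] lin)
  also have "\<dots> = (\<Sum>m<?n. \<Sum>I \<in> {..<k} \<rightarrow>\<^sub>E {..<?n}. F ((s \<circ> I)(k := u m)) * G ((s \<circ> I)(k := u m)))"
    by (rule sum.swap)
  also have "\<dots> = (\<Sum>m<?n. \<Sum>I \<in> {..<k} \<rightarrow>\<^sub>E {..<?n}. F ((u \<circ> I)(k := u m)) * G ((u \<circ> I)(k := u m)))"
    by (rule sum.cong[OF refl], rule Suc.IH) (rule fixed, rule Suc.prems)+
  also have "\<dots> = (\<Sum>I \<in> {..<k} \<rightarrow>\<^sub>E {..<?n}. \<Sum>m<?n. F ((u \<circ> I)(k := u m)) * G ((u \<circ> I)(k := u m)))"
    by (rule sum.swap)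
  also have "\<dots> = (\<Sum>I \<in> {..<Suc k} \<rightarrow>\<^sub>E {..<?n}. F (u \<circ> I) * G (u \<circ> I))"
    unfolding sum_tuples_Suc upd ..
  finally show ?case .
qed

text \<open>On complementary vectors of an orthonormal frame, only the multi-indices that rearrange one
  list contribute to the sum that defines the star, and all of them contribute equally.\<close>

theorem mhodge_frame:
  fixes g :: "'e::euclidean_space \<Rightarrow> 'e \<Rightarrow> real"
  assumes g: "bilinear g" and sym: "\<And>x y. g x y = g y x" and u: "orthonormal_frame g u"
    and a: "alternating k a" and vol: "alternating (DIM('e)) vol"
    and IJ: "distinct (I @ J)" "set (I @ J) = {..<DIM('e)}" "length I = k"
  shows "mhodge g vol k a ((!) (map u J)) = a ((!) (map u I)) * vol ((!) (map u (I @ J)))"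
proof -
  let ?n = "DIM('e)"
  define s where "s = (SOME u. orthonormal_frame g u)"
  have s: "orthonormal_frame g s"
    unfolding s_def by (rule someI[of "orthonormal_frame g", OF u])
  have n: "?n = k + length J"
    using distinct_card[OF IJ(1)] IJ(2,3) by simp
  define G where "G w = vol (\<lambda>j. if j < k then w j else map u J ! (j - k))" for w
  have a_multi: "multilinear k a"
    using a by (simp add: alternating_def multilinear_def)
  have G_multi: "multilinear k G"
    unfolding multilinear_def
  proof (intro conjI allI impI)
    fix v w :: "nat \<Rightarrow> 'e" assume "\<forall>j<k. v j = w j"
    then show "G v = G w"
      unfolding G_def by (intro alternating_cong[OF vol]) auto
  next
    fix v :: "nat \<Rightarrow> 'e" and j assume j: "j < k"
    have "(\<lambda>i. if i < k then (v(j := x)) i else map u J ! (i - k))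
        = (\<lambda>i. if i < k then v i else map u J ! (i - k))(j := x)" for x
      using j by auto
    then show "linear (\<lambda>x. G (v(j := x)))"
      unfolding G_def using alternating_linear[OF vol, of j] j n by simp
  qed
  define B where "B = {L \<in> {..<k} \<rightarrow>\<^sub>E set I. inj_on L {..<k}}"
  have "{..<k} \<rightarrow>\<^sub>E set I \<subseteq> {..<k} \<rightarrow>\<^sub>E {..<?n}"
    by (rule PiE_mono) (use IJ(2) in auto)
  then have B_sub: "B \<subseteq> {..<k} \<rightarrow>\<^sub>E {..<?n}"
    by (auto simp: B_def)
  have "card (set I) = k"
    using IJ by (simp add: distinct_card)
  then have card_B: "card B = fact k"
    unfolding B_def by (subst card_inj_on_subset_funcset) (auto simp: fact_prod_rev)
  have zero: "a (u \<circ> L) * G (u \<circ> L) = 0" if L: "L \<in> ({..<k} \<rightarrow>\<^sub>E {..<?n}) - B" for L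
  proof (cases "inj_on L {..<k}")
    case False
    then obtain i j where "i < k" "j < k" "i \<noteq> j" "L i = L j"
      by (auto simp: inj_on_def)
    then have "a (u \<circ> L) = 0"
      by (intro alternating_eq_0[OF a, of i j]) auto
    then show ?thesis by simp
  next
    case True
    then have "L \<notin> {..<k} \<rightarrow>\<^sub>E set I"
      using L by (auto simp: B_def)
    then obtain i where i: "i < k" "L i \<notin> set I"
      using L by (auto simp: PiE_iff)
    then have "L i \<in> set J"
      using L IJ(2) by (auto simp: PiE_iff)
    then obtain m where m: "m < length J" "L i = J ! m"
      by (auto simp: in_set_conv_nth)
    have "G (u \<circ> L) = 0"
      unfolding G_def by (rule alternating_eq_0[OF vol, of i "k + m"]) (use i m n in auto)
    then show ?thesis by simp
  qed
  have same: "a (u \<circ> L) * G (u \<circ> L) = a ((!) (map u I)) * vol ((!) (map u (I @ J)))" if L: "L \<in> B" for L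
  proof -
    have sorted_value: "a ((!) (map u xs)) * vol ((!) (map u (xs @ J)))
        = a ((!) (map u (sort xs))) * vol ((!) (map u (sort xs @ J)))" if "length xs = k" for xs
    proof -
      have "a ((!) (map u xs)) = list_sign xs * a ((!) (map u (sort xs)))"
        "vol ((!) (map u xs @ map u J)) = list_sign xs * vol ((!) (map u (sort xs) @ map u J))"
        using that n by (auto intro!: alternating_sort[OF a] alternating_sort_prefix[OF vol])
      then have "a ((!) (map u xs)) * vol ((!) (map u (xs @ J)))
        = (list_sign xs * list_sign xs) * (a ((!) (map u (sort xs))) * vol ((!) (map u (sort xs @ J))))"
        by simp
      then show ?thesis
        by (simp only: list_sign_square mult_1)
    qed
    define xs where "xs = map L [0..<k]"
    have xs: "length xs = k" "distinct xs" "set xs \<subseteq> set I"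
      using L by (auto simp: xs_def B_def distinct_map PiE_iff lessThan_atLeast0)
    have "set xs = set I"
      using xs IJ by (intro card_subset_eq) (auto simp: distinct_card)
    then have "sort xs = sort I"
      using xs(2) IJ(1) by (intro sorted_distinct_set_unique) auto
    moreover have "a (u \<circ> L) = a ((!) (map u xs))"
      by (rule alternating_cong[OF a]) (simp add: xs_def)
    moreover have "G (u \<circ> L) = vol ((!) (map u (xs @ J)))"
      unfolding G_def
      by (rule alternating_cong[OF vol]) (auto simp: xs_def nth_append n)
    ultimately show ?thesis
      using sorted_value[OF xs(1)] sorted_value[OF IJ(3)] by simp
  qed
  have "mhodge g vol k a ((!) (map u J)) = (\<Sum>L \<in> {..<k} \<rightarrow>\<^sub>E {..<?n}. a (s \<circ> L) * G (s \<circ> L)) / fact k"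
    by (simp add: mhodge_def s_def[symmetric] G_def o_def)
  also have "(\<Sum>L \<in> {..<k} \<rightarrow>\<^sub>E {..<?n}. a (s \<circ> L) * G (s \<circ> L))
      = (\<Sum>L \<in> {..<k} \<rightarrow>\<^sub>E {..<?n}. a (u \<circ> L) * G (u \<circ> L))"
    by (rule sum_frame_tuples_invariant[OF g sym s u a_multi G_multi])
  also have "\<dots> = (\<Sum>L\<in>B. a (u \<circ> L) * G (u \<circ> L))"
    using B_sub zero by (intro sum.mono_neutral_right) (auto intro: finite_PiE)
  also have "\<dots> = fact k * (a ((!) (map u I)) * vol ((!) (map u (I @ J))))"
    using same card_B by simp
  finally show ?thesis by simp
qed

lemma alternating_mhodge:
  assumes "alternating (DIM('e)) vol"
  shows "alternating (DIM('e) - k) (mhodge g vol k (a :: 'e::euclidean_space mform))"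
proof -
  define s where "s = (SOME u. orthonormal_frame g u)"
  have "mhodge g vol k a = (\<lambda>w. 1 / fact k * (\<Sum>I \<in> {..<k} \<rightarrow>\<^sub>E {..<DIM('e)}.
          a (\<lambda>j. s (I j)) * vol (\<lambda>j. if j < k then s (I j) else w (j - k))))"
    by (simp add: mhodge_def s_def[symmetric] Let_def)
  then show ?thesis
    using alternating_prefix[OF assms] by (simp only:) (intro alternating_scale alternating_sum)
qed

lemma complementary_list:
  assumes "distinct J" "set J \<subseteq> {..<n}"
  obtains I where "distinct (I @ J)" "set (I @ J) = {..<n :: nat}" "length I = n - length J" "sorted I"
proof
  let ?I = "filter (\<lambda>i. i \<notin> set J) [0..<n]"
  show "distinct (?I @ J)" and set: "set (?I @ J) = {..<n}" and "sorted ?I"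
    using assms by (auto intro: sorted_wrt_filter)
  then have "length (?I @ J) = n"
    using distinct_card[of "?I @ J"] by simp
  then show "length ?I = n - length J" by simp
qed

section \<open>The Hodge star of a warped product with a line\<close>

text \<open>The values of \<open>pr1 a\<close> and of \<open>ds\<close> at a point of the product.\<close>

definition pull_fst :: "'e mform \<Rightarrow> ('e \<times> real) mform" where
  "pull_fst a = (\<lambda>v. a (\<lambda>j. fst (v j)))"

definition dsnd :: "('e \<times> real) mform" where
  "dsnd = (\<lambda>v. snd (v 0))"

lemma alternating_pull_fst: "alternating k a \<Longrightarrow> alternating k (pull_fst (a :: 'e::real_vector mform))"
  unfolding pull_fst_def by (rule alternating_pullback) (auto intro: linear_fst)

lemma alternating_1_iff:
  "alternating (Suc 0) a \<longleftrightarrow> (\<forall>v. a v = a (\<lambda>_. v 0)) \<and> linear (\<lambda>x. a (\<lambda>_. x))"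
proof
  assume a: "alternating (Suc 0) a"
  have "a v = a (\<lambda>_. v 0)" for v
    by (rule alternating_cong[OF a]) simp
  moreover have "a ((\<lambda>_. 0)(0 := x)) = a (\<lambda>_. x)" for x
    by (rule alternating_cong[OF a]) simp
  ultimately show "(\<forall>v. a v = a (\<lambda>_. v 0)) \<and> linear (\<lambda>x. a (\<lambda>_. x))"
    using alternating_linear[OF a, of 0 "\<lambda>_. 0"] by simp
next
  assume a: "(\<forall>v. a v = a (\<lambda>_. v 0)) \<and> linear (\<lambda>x. a (\<lambda>_. x))"
  show "alternating (Suc 0) a"
    unfolding alternating_def
  proof (intro conjI allI impI)
    fix v w :: "nat \<Rightarrow> 'a" assume "\<forall>j<Suc 0. v j = w j"
    then show "a v = a w"
      using a[THEN conjunct1, rule_format, of v] a[THEN conjunct1, rule_format, of w] by simp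
  next
    fix v :: "nat \<Rightarrow> 'a" and j assume "j < Suc 0"
    then have "a (v(j := x)) = a (\<lambda>_. x)" for x
      using a[THEN conjunct1, rule_format, of "v(j := x)"] by simp
    with a show "linear (\<lambda>x. a (v(j := x)))"
      by simp
  qed auto
qed

lemma alternating_dsnd: "alternating 1 (dsnd :: ('e::real_vector \<times> real) mform)"
  unfolding One_nat_def alternating_1_iff by (simp add: dsnd_def linear_snd)

lemma pull_fst_nth:
  assumes "alternating k a" "length xs = k"
  shows "pull_fst a ((!) xs) = a ((!) (map fst xs))"
  unfolding pull_fst_def by (rule alternating_cong[OF assms(1)]) (simp add: assms(2))

lemma dsnd_nth [simp]: "dsnd ((!) (x # xs)) = snd x"
  by (simp add: dsnd_def)

lemma warped_metric_frame:
  fixes g :: "'e::euclidean_space \<Rightarrow> 'e \<Rightarrow> real" and f :: real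
  defines "G \<equiv> \<lambda>x y. g (fst x) (fst y) + f\<^sup>2 * (snd x * snd y)"
  assumes g: "bilinear g" and u: "orthonormal_frame g u" and f: "f \<noteq> 0"
  shows bilinear_warped_metric: "bilinear G"
    and orthonormal_warped_frame: "orthonormal_frame G (\<lambda>j. if j < DIM('e) then (u j, 0) else (0, 1 / f))"
proof -
  show "bilinear G"
    unfolding bilinear_def G_def
    by (auto intro!: linearI simp: algebra_simps bilinear_ladd[OF g] bilinear_radd[OF g]
        bilinear_lmul[OF g] bilinear_rmul[OF g])
  show "orthonormal_frame G (\<lambda>j. if j < DIM('e) then (u j, 0) else (0, 1 / f))"
    using u f bilinear_lzero[OF g] bilinear_rzero[OF g]
    by (auto simp: orthonormal_frame_def G_def power2_eq_square)
qed

text \<open>The two sides are compared on the orthonormal frame that consists of a frame \<open>u\<close> of the base and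
  of the unit vector along the fibre. The latter is an argument either of the form or of its star;
  a form from the base vanishes on it, and moving it to the last place of the volume form, past the
  remaining vectors, yields the sign.\<close>

theorem mhodge_warped:
  fixes g :: "'e::euclidean_space \<Rightarrow> 'e \<Rightarrow> real" and f :: real and a vol :: "'e mform"
  defines "G \<equiv> \<lambda>x y. g (fst x) (fst y) + f\<^sup>2 * (snd x * snd y)"
    and "V \<equiv> \<lambda>v. f * mwedge (DIM('e)) 1 (pull_fst vol) dsnd v"
  assumes g: "bilinear g" and sym: "\<And>x y. g x y = g y x" and u: "orthonormal_frame g u"
    and a: "alternating k a" and vol: "alternating (DIM('e)) vol" and f: "f \<noteq> 0"
    and k: "k \<le> DIM('e)"
  shows "mhodge G V k (pull_fst a) = (\<lambda>v. f * mwedge (DIM('e) - k) 1 (pull_fst (mhodge g vol k a)) dsnd v)"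
    and "mhodge G V (k + 1) (\<lambda>v. f * mwedge k 1 (pull_fst a) dsnd v)
        = (\<lambda>v. (-1) ^ (DIM('e) - k) * pull_fst (mhodge g vol k a) v)"
proof -
  define n where "n = DIM('e)"
  define w where "w j = (if j < n then (u j, 0) else (0, 1 / f))" for j
  have dim: "DIM('e \<times> real) = Suc n"
    by (simp add: n_def)
  have G_bilinear: "bilinear G"
    unfolding G_def by (rule bilinear_warped_metric[OF g u f])
  have G_sym: "G x y = G y x" for x y
    by (simp add: G_def sym mult.commute)
  have w: "orthonormal_frame G w"
    using orthonormal_warped_frame[OF g u f] unfolding G_def w_def n_def .
  have vol': "alternating n vol"
    using vol by (simp add: n_def)
  have V: "alternating (Suc n) V"
    using alternating_mwedge[OF alternating_pull_fst[OF vol] alternating_dsnd]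
    unfolding V_def n_def by (intro alternating_scale) simp
  have span: "x = (\<Sum>i<Suc n. G x (w i) *\<^sub>R w i)" for x
    using orthonormal_frame_expand[OF G_bilinear w, of x] unfolding dim .
  have map_fst: "map fst (map w L) = map u L" and map_snd: "x \<in> set (map w L) \<Longrightarrow> dsnd ((!) [x]) = 0"
    if "set L \<subseteq> {..<n}" for L x
    using that by (auto simp: w_def)
  have w_n: "fst (w n) = 0" "snd (w n) = 1 / f"
    by (simp_all add: w_def)
  have pull_w: "pull_fst b ((!) (map w L)) = b ((!) (map u L))"
    if "alternating m b" "length L = m" "set L \<subseteq> {..<n}" for b m L
    using pull_fst_nth[OF that(1), of "map w L"] map_fst[OF that(3)] that(2) by (simp del: map_map)
  have pull_zero: "pull_fst b ((!) (map w (L @ [n]))) = 0" if "alternating m b" "length L < m" for b m L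
    unfolding pull_fst_def
    by (rule alternating_zero_arg[OF that]) (simp add: w_n nth_append)
  have wedge_w: "f * mwedge m 1 (pull_fst b) dsnd ((!) (map w (L @ [n]))) = b ((!) (map u L))"
    if b: "alternating m b" "length L = m" "set L \<subseteq> {..<n}" for b m L
    using mwedge_snoc[OF alternating_pull_fst[OF b(1)] alternating_dsnd, of "map w L" "w n"]
      map_snd[OF b(3)] b(2) pull_w[OF b] f by (simp add: w_n)
  have wedge_zero: "mwedge m 1 (pull_fst b) dsnd ((!) (map w L)) = 0"
    if b: "alternating m b" "length L = Suc m" "set L \<subseteq> {..<n}" for b m L
    using mwedge_snoc_zero[OF alternating_pull_fst[OF b(1)] alternating_dsnd, of "map w L"]
      map_snd[OF b(3)] b(2) by simp
  have V_w: "V ((!) (map w (I @ n # J))) = (-1) ^ length J * vol ((!) (map u (I @ J)))"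
    if "length (I @ J) = n" "set (I @ J) \<subseteq> {..<n}" for I J
  proof -
    have "V ((!) (map w (I @ n # J))) = (-1) ^ length J * V ((!) (map w ((I @ J) @ [n])))"
      using alternating_move[OF V, of "map w I" "w n" "map w J" "[]"] that by simp
    also have "V ((!) (map w ((I @ J) @ [n]))) = vol ((!) (map u (I @ J)))"
      unfolding V_def n_def[symmetric] by (rule wedge_w[OF vol' that])
    finally show ?thesis .
  qed
  have star: "alternating (n - k) (mhodge g vol k a)"
    using alternating_mhodge[OF vol] by (simp add: n_def)
  have star_u: "mhodge g vol k a ((!) (map u J)) = a ((!) (map u I)) * vol ((!) (map u (I @ J)))"
    if "distinct (I @ J)" "set (I @ J) = {..<n}" "length I = k" for I J
    using that by (intro mhodge_frame[OF g sym u a vol]) (auto simp: n_def)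
  have star_w: "mhodge G V m b ((!) (map w J)) = b ((!) (map w I)) * V ((!) (map w (I @ J)))"
    if "alternating m b" "distinct (I @ J)" "set (I @ J) = {..<Suc n}" "length I = m" for b m I J
    using that V by (intro mhodge_frame[OF G_bilinear G_sym w]) (auto simp: dim n_def)
  have last: "\<exists>J'. J = J' @ [n] \<and> set J' \<subseteq> {..<n} \<and> distinct J'"
    if J: "sorted_wrt (<) J" "set J \<subseteq> {..<Suc n}" "n \<in> set J" for J
  proof (cases J rule: rev_cases)
    case (snoc J' y)
    then have "\<forall>x\<in>set J'. x < y" "distinct J'" "y \<le> n"
      using J by (auto simp: sorted_wrt_append strict_sorted_iff)
    moreover from this have "y = n"
      using J snoc by force
    ultimately show ?thesis using snoc by auto
  qed (use J in simp)
  have below: "set J \<subseteq> {..<n}" if "set J \<subseteq> {..<Suc n}" "n \<notin> set J" for J :: "nat list"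
    using that by (auto simp: less_Suc_eq)
  show "mhodge G V k (pull_fst a) = (\<lambda>v. f * mwedge (DIM('e) - k) 1 (pull_fst (mhodge g vol k a)) dsnd v)"
  proof (rule alternating_eq_frame[OF _ _ span])
    show "alternating (Suc n - k) (mhodge G V k (pull_fst a))"
      using alternating_mhodge[of V k G "pull_fst a"] V unfolding dim by blast
    have "n - k + 1 = Suc n - k"
      using k by (simp add: n_def)
    then show "alternating (Suc n - k) (\<lambda>v. f * mwedge (DIM('e) - k) 1 (pull_fst (mhodge g vol k a)) dsnd v)"
      using alternating_scale[OF alternating_mwedge[OF alternating_pull_fst[OF star] alternating_dsnd], of f]
      by (simp add: n_def)
  next
    fix J assume J: "length J = Suc n - k" "sorted_wrt (<) J" "set J \<subseteq> {..<Suc n}"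
    show "mhodge G V k (pull_fst a) ((!) (map w J))
      = f * mwedge (DIM('e) - k) 1 (pull_fst (mhodge g vol k a)) dsnd ((!) (map w J))"
    proof (cases "n \<in> set J")
      case True
      then obtain J' where J': "J = J' @ [n]" "set J' \<subseteq> {..<n}" "distinct J'"
        using last[OF J(2,3)] by blast
      from complementary_list[OF J'(3,2)] obtain I
        where I: "distinct (I @ J')" "set (I @ J') = {..<n}" "length I = n - length J'" by blast
      have len: "length J' = n - k" "length I = k"
        using J(1) J'(1) I(3) k by (simp_all add: n_def)
      have sI: "set I \<subseteq> {..<n}" using I(2) by auto
      have "mhodge G V k (pull_fst a) ((!) (map w J)) = pull_fst a ((!) (map w I)) * V ((!) (map w (I @ J)))"
        using I len J' by (intro star_w alternating_pull_fst a) (auto simp: lessThan_Suc)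
      also have "V ((!) (map w (I @ J))) = vol ((!) (map u (I @ J')))"
        using V_w[of "I @ J'" "[]"] equalityD1[OF I(2)] len J'(1) k by (simp add: n_def)
      also have "pull_fst a ((!) (map w I)) = a ((!) (map u I))"
        by (rule pull_w[OF a len(2) sI])
      also have "a ((!) (map u I)) * vol ((!) (map u (I @ J'))) = mhodge g vol k a ((!) (map u J'))"
        using star_u[OF I(1,2) len(2)] by simp
      also have "\<dots> = f * mwedge (DIM('e) - k) 1 (pull_fst (mhodge g vol k a)) dsnd ((!) (map w J))"
        unfolding J'(1) n_def[symmetric] by (rule wedge_w[OF star len(1) J'(2), symmetric])
      finally show ?thesis .
    next
      case False
      have sJ: "set J \<subseteq> {..<n}" "distinct J"
        using below[OF J(3) False] J(2) by (auto simp: strict_sorted_iff)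
      from complementary_list[OF sJ(2,1)] obtain I
        where I: "distinct (I @ J)" "set (I @ J) = {..<n}" "length I = n - length J" by blast
      have "length I + length J = n"
        using distinct_card[OF I(1)] I(2) by simp
      then have len: "length I < k" "length (I @ [n]) = k" "length J = Suc (n - k)"
        using J(1) k by (auto simp: n_def)
      have "mhodge G V k (pull_fst a) ((!) (map w J))
          = pull_fst a ((!) (map w (I @ [n]))) * V ((!) (map w ((I @ [n]) @ J)))"
        using I len False sJ by (intro star_w alternating_pull_fst a) (auto simp: lessThan_Suc)
      then show ?thesis
        using pull_zero[OF a len(1)] wedge_zero[OF star len(3) sJ(1)] by (simp add: n_def)
    qed
  qed
  show "mhodge G V (k + 1) (\<lambda>v. f * mwedge k 1 (pull_fst a) dsnd v)
      = (\<lambda>v. (-1) ^ (DIM('e) - k) * pull_fst (mhodge g vol k a) v)"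
  proof (rule alternating_eq_frame[OF _ _ span])
    let ?b = "\<lambda>v. f * mwedge k 1 (pull_fst a) dsnd v"
    have b: "alternating (k + 1) ?b"
      by (intro alternating_scale alternating_mwedge alternating_pull_fst a alternating_dsnd)
    show "alternating (n - k) (mhodge G V (k + 1) ?b)"
      using alternating_mhodge[of V "k + 1" G ?b] V unfolding dim by simp
    show "alternating (n - k) (\<lambda>v. (-1) ^ (DIM('e) - k) * pull_fst (mhodge g vol k a) v)"
      by (intro alternating_scale alternating_pull_fst star)
    fix J assume J: "length J = n - k" "sorted_wrt (<) J" "set J \<subseteq> {..<Suc n}"
    show "mhodge G V (k + 1) ?b ((!) (map w J))
      = (-1) ^ (DIM('e) - k) * pull_fst (mhodge g vol k a) ((!) (map w J))"
    proof (cases "n \<in> set J")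
      case True
      then obtain J' where J': "J = J' @ [n]" "set J' \<subseteq> {..<n}" "distinct J'"
        using last[OF J(2,3)] by blast
      from complementary_list[OF J'(3,2)] obtain I
        where I: "distinct (I @ J')" "set (I @ J') = {..<n}" "length I = n - length J'" by blast
      have len: "length J' < n - k" "length I = Suc k"
        using J(1) J'(1) I(3) by auto
      have sI: "set I \<subseteq> {..<n}" using I(2) by auto
      have "mhodge G V (k + 1) ?b ((!) (map w J)) = ?b ((!) (map w I)) * V ((!) (map w (I @ J)))"
        using I len J' by (intro star_w[OF b]) (auto simp: lessThan_Suc)
      then show ?thesis
        using wedge_zero[OF a len(2) sI] pull_zero[OF star len(1)] J'(1) by simp
    next
      case False
      have sJ: "set J \<subseteq> {..<n}" "distinct J"
        using below[OF J(3) False] J(2) by (auto simp: strict_sorted_iff)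
      from complementary_list[OF sJ(2,1)] obtain I
        where I: "distinct (I @ J)" "set (I @ J) = {..<n}" "length I = n - length J" by blast
      have len2: "length I + length J = n"
        using distinct_card[OF I(1)] I(2) by simp
      have len: "length I = k"
        using J(1) len2 k by (simp add: n_def)
      have sI: "set I \<subseteq> {..<n}" using I(2) by auto
      have "mhodge G V (k + 1) ?b ((!) (map w J)) = ?b ((!) (map w (I @ [n]))) * V ((!) (map w ((I @ [n]) @ J)))"
        using I len False sJ by (intro star_w[OF b]) (auto simp: lessThan_Suc)
      also have "?b ((!) (map w (I @ [n]))) = a ((!) (map u I))"
        by (rule wedge_w[OF a len sI])
      also have "V ((!) (map w ((I @ [n]) @ J))) = (-1) ^ length J * vol ((!) (map u (I @ J)))"
        using V_w[of I J] len2 equalityD1[OF I(2)] by simp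
      also have "a ((!) (map u I)) * ((-1) ^ length J * vol ((!) (map u (I @ J))))
          = (-1) ^ length J * mhodge g vol k a ((!) (map u J))"
        using star_u[OF I(1,2) len] by simp
      also have "mhodge g vol k a ((!) (map u J)) = pull_fst (mhodge g vol k a) ((!) (map w J))"
        by (rule pull_w[OF star J(1) sJ(1), symmetric])
      finally show ?thesis
        unfolding J(1) n_def .
    qed
  qed
qed

lemma mwedge_4_2:
  assumes "alternating 4 a" "alternating 2 b"
  shows "mwedge 4 2 a b ((!) [x1, x2, x3, x4, x5, x6])
    = a ((!) [x1, x2, x3, x4]) * b ((!) [x5, x6]) - a ((!) [x1, x2, x3, x5]) * b ((!) [x4, x6])
      + a ((!) [x1, x2, x3, x6]) * b ((!) [x4, x5]) + a ((!) [x1, x2, x4, x5]) * b ((!) [x3, x6])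
      - a ((!) [x1, x2, x4, x6]) * b ((!) [x3, x5]) + a ((!) [x1, x2, x5, x6]) * b ((!) [x3, x4])
      - a ((!) [x1, x3, x4, x5]) * b ((!) [x2, x6]) + a ((!) [x1, x3, x4, x6]) * b ((!) [x2, x5])
      - a ((!) [x1, x3, x5, x6]) * b ((!) [x2, x4]) + a ((!) [x1, x4, x5, x6]) * b ((!) [x2, x3])
      + a ((!) [x2, x3, x4, x5]) * b ((!) [x1, x6]) - a ((!) [x2, x3, x4, x6]) * b ((!) [x1, x5])
      + a ((!) [x2, x3, x5, x6]) * b ((!) [x1, x4]) - a ((!) [x2, x4, x5, x6]) * b ((!) [x1, x3])
      + a ((!) [x3, x4, x5, x6]) * b ((!) [x1, x2])"
  using assms by (simp add: mwedge_expand)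

lemma mwedge_3_3:
  assumes "alternating 3 a" "alternating 3 b"
  shows "mwedge 3 3 a b ((!) [x1, x2, x3, x4, x5, x6])
    = a ((!) [x1, x2, x3]) * b ((!) [x4, x5, x6]) - a ((!) [x1, x2, x4]) * b ((!) [x3, x5, x6])
      + a ((!) [x1, x2, x5]) * b ((!) [x3, x4, x6]) - a ((!) [x1, x2, x6]) * b ((!) [x3, x4, x5])
      + a ((!) [x1, x3, x4]) * b ((!) [x2, x5, x6]) - a ((!) [x1, x3, x5]) * b ((!) [x2, x4, x6])
      + a ((!) [x1, x3, x6]) * b ((!) [x2, x4, x5]) + a ((!) [x1, x4, x5]) * b ((!) [x2, x3, x6])
      - a ((!) [x1, x4, x6]) * b ((!) [x2, x3, x5]) + a ((!) [x1, x5, x6]) * b ((!) [x2, x3, x4])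
      - a ((!) [x2, x3, x4]) * b ((!) [x1, x5, x6]) + a ((!) [x2, x3, x5]) * b ((!) [x1, x4, x6])
      - a ((!) [x2, x3, x6]) * b ((!) [x1, x4, x5]) - a ((!) [x2, x4, x5]) * b ((!) [x1, x3, x6])
      + a ((!) [x2, x4, x6]) * b ((!) [x1, x3, x5]) - a ((!) [x2, x5, x6]) * b ((!) [x1, x3, x4])
      + a ((!) [x3, x4, x5]) * b ((!) [x1, x2, x6]) - a ((!) [x3, x4, x6]) * b ((!) [x1, x2, x5])
      + a ((!) [x3, x5, x6]) * b ((!) [x1, x2, x4]) - a ((!) [x4, x5, x6]) * b ((!) [x1, x2, x3])"
  using assms by (simp add: mwedge_expand)

section \<open>SU(3)-coframes on a vector space\<close>

text \<open>The value of \<open>emon\<close> at a point.\<close>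

primrec cmon :: "(nat \<Rightarrow> 'e mform) \<Rightarrow> nat list \<Rightarrow> 'e mform" where
  "cmon \<theta> [] = (\<lambda>_. 1)"
| "cmon \<theta> (k # ks) = mwedge 1 (length ks) (\<theta> k) (cmon \<theta> ks)"

declare cmon.simps(2) [simp del]

lemma emon_pointwise: "emon e ks i p = cmon (\<lambda>k. e k i p) ks"
  by (induction ks) (simp_all add: wedge_def cmon.simps(2))

lemma alternating_cmon:
  "(\<And>k. k \<in> set ks \<Longrightarrow> alternating 1 (\<theta> k)) \<Longrightarrow> alternating (length ks) (cmon \<theta> ks)"
proof (induction ks)
  case Nil
  then show ?case by (simp add: alternating_def)
next
  case (Cons k ks)
  then show ?case
    using alternating_mwedge[of 1 "\<theta> k" "length ks" "cmon \<theta> ks"] by (simp add: cmon.simps(2))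
qed

lemma alternating_uminus: "alternating k a \<Longrightarrow> alternating k (\<lambda>v. - a v)"
  using alternating_scale[of k a "-1"] by simp

lemma alternating_ext:
  assumes "alternating k a" "alternating k b"
    and "\<And>xs. length xs = k \<Longrightarrow> a ((!) xs) = b ((!) xs)"
  shows "a = b"
proof
  fix v show "a v = b v"
    using assms(3)[of "map v [0..<k]"] alternating_as_list[OF assms(1), of v]
      alternating_as_list[OF assms(2), of v] by simp
qed

lemma length_lists:
  "length xs = 1 \<longleftrightarrow> (\<exists>x. xs = [x])"
  "length xs = 2 \<longleftrightarrow> (\<exists>x y. xs = [x, y])"
  "length xs = 3 \<longleftrightarrow> (\<exists>x y z. xs = [x, y, z])"
  "length xs = 4 \<longleftrightarrow> (\<exists>x y z w. xs = [x, y, z, w])"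
  "length xs = 5 \<longleftrightarrow> (\<exists>x y z w t. xs = [x, y, z, w, t])"
  by (auto simp: numeral_eq_Suc length_Suc_conv)

context
  fixes \<theta> :: "nat \<Rightarrow> 'e::real_vector mform" and K :: "nat set"
  assumes \<theta>: "\<And>k. k \<in> K \<Longrightarrow> alternating 1 (\<theta> k)"
begin

lemma alternating_cmon_2: "a \<in> K \<Longrightarrow> b \<in> K \<Longrightarrow> alternating 2 (cmon \<theta> [a, b])"
  using alternating_cmon[of "[a, b]" \<theta>] \<theta> by (auto simp: numeral_2_eq_2)

lemma alternating_cmon_3:
  "a \<in> K \<Longrightarrow> b \<in> K \<Longrightarrow> c \<in> K \<Longrightarrow> alternating 3 (cmon \<theta> [a, b, c])"
  using alternating_cmon[of "[a, b, c]" \<theta>] \<theta> by (auto simp: numeral_3_eq_3)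

lemma cmon_1: "a \<in> K \<Longrightarrow> cmon \<theta> [a] = \<theta> a"
  using mwedge_0_right[OF \<theta>, of a "\<lambda>_. 1"] by (auto simp: alternating_def cmon.simps(2))

lemma cmon_2:
  assumes "a \<in> K" "b \<in> K"
  shows "cmon \<theta> [a, b] ((!) [x, y]) = \<theta> a ((!) [x]) * \<theta> b ((!) [y]) - \<theta> a ((!) [y]) * \<theta> b ((!) [x])"
proof -
  have "cmon \<theta> [a, b] = mwedge 1 1 (\<theta> a) (\<theta> b)"
    using cmon_1[OF assms(2)] by (simp add: cmon.simps(2)[of _ a])
  then show ?thesis
    using mwedge_1_1[OF \<theta> \<theta>] assms by simp
qed

lemma cmon_3:
  assumes "a \<in> K" "b \<in> K" "c \<in> K"
  shows "cmon \<theta> [a, b, c] ((!) [x, y, z])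
    = \<theta> a ((!) [x]) * (\<theta> b ((!) [y]) * \<theta> c ((!) [z]) - \<theta> b ((!) [z]) * \<theta> c ((!) [y]))
    - \<theta> a ((!) [y]) * (\<theta> b ((!) [x]) * \<theta> c ((!) [z]) - \<theta> b ((!) [z]) * \<theta> c ((!) [x]))
    + \<theta> a ((!) [z]) * (\<theta> b ((!) [x]) * \<theta> c ((!) [y]) - \<theta> b ((!) [y]) * \<theta> c ((!) [x]))"
proof -
  have "cmon \<theta> [a, b, c] = mwedge 1 2 (\<theta> a) (cmon \<theta> [b, c])"
    by (simp add: cmon.simps(2)[of _ a] numeral_2_eq_2)
  then show ?thesis
    using mwedge_1_2[OF \<theta> alternating_cmon_2] assms by (simp only: cmon_2)
qed

end

definition su3_omega :: "(nat \<Rightarrow> 'e mform) \<Rightarrow> 'e mform" where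
  "su3_omega \<theta> = cmon \<theta> [1,2] + cmon \<theta> [3,4] + cmon \<theta> [5,6]"

definition su3_psip :: "(nat \<Rightarrow> 'e mform) \<Rightarrow> 'e mform" where
  "su3_psip \<theta> = cmon \<theta> [1,3,5] - cmon \<theta> [1,4,6] - cmon \<theta> [2,3,6] - cmon \<theta> [2,4,5]"

definition su3_psim :: "(nat \<Rightarrow> 'e mform) \<Rightarrow> 'e mform" where
  "su3_psim \<theta> = - cmon \<theta> [2,4,6] + cmon \<theta> [2,3,5] + cmon \<theta> [1,4,5] + cmon \<theta> [1,3,6]"

definition coframe_metric :: "(nat \<Rightarrow> 'e::euclidean_space mform) \<Rightarrow> 'e \<Rightarrow> 'e \<Rightarrow> real" where
  "coframe_metric \<theta> x y = (\<Sum>k = 1..DIM('e). \<theta> k (\<lambda>_. x) * \<theta> k (\<lambda>_. y))"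

definition su3_vol :: "(nat \<Rightarrow> 'e mform) \<Rightarrow> 'e mform" where
  "su3_vol \<theta> = (\<lambda>v. 1 / fact 3 * mwedge 4 2 (mwedge 2 2 (su3_omega \<theta>) (su3_omega \<theta>)) (su3_omega \<theta>) v)"

lemma const_nth: "alternating (Suc 0) a \<Longrightarrow> a (\<lambda>_. x) = a ((!) [x])"
  by (rule alternating_cong[of "Suc 0"]) simp_all

text \<open>A coframe \<open>\<theta>\<^sub>1, \<dots>, \<theta>\<^sub>6\<close> with its dual basis \<open>u\<^sub>0, \<dots>, u\<^sub>5\<close>; note the shift of the index.\<close>

locale su3_frame =
  fixes \<theta> :: "nat \<Rightarrow> 'e::euclidean_space mform" and u :: "nat \<Rightarrow> 'e"
  assumes dim: "DIM('e) = 6"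
    and \<theta>: "\<And>k. k \<in> {1..6} \<Longrightarrow> alternating 1 (\<theta> k)"
    and dual: "\<And>k j. k \<in> {1..6} \<Longrightarrow> j < 6 \<Longrightarrow> \<theta> k ((!) [u j]) = (if k = Suc j then 1 else 0)"
begin

abbreviation "\<omega> \<equiv> su3_omega \<theta>"
abbreviation "\<psi>p \<equiv> su3_psip \<theta>"
abbreviation "\<psi>m \<equiv> su3_psim \<theta>"
abbreviation "g \<equiv> coframe_metric \<theta>"
abbreviation "vol \<equiv> su3_vol \<theta>"

lemma alternating_omega: "alternating 2 \<omega>"
  unfolding su3_omega_def plus_fun_def
  by (intro alternating_add alternating_cmon_2[where K = "{1..6}"] \<theta>) auto

lemma alternating_psip: "alternating 3 \<psi>p"
  unfolding su3_psip_def fun_diff_def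
  by (intro alternating_diff alternating_cmon_3[where K = "{1..6}"] \<theta>) auto

lemma alternating_psim: "alternating 3 \<psi>m"
  unfolding su3_psim_def plus_fun_def fun_Compl_def
  by (intro alternating_add alternating_uminus alternating_cmon_3[where K = "{1..6}"] \<theta>) auto

lemma alternating_vol: "alternating 6 vol"
  using alternating_mwedge[OF alternating_mwedge[OF alternating_omega alternating_omega] alternating_omega]
  unfolding su3_vol_def by (intro alternating_scale) simp

lemma cmon_2':
  "a \<in> {1..6} \<Longrightarrow> b \<in> {1..6} \<Longrightarrow> cmon \<theta> [a, b] ((!) [x, y])
    = \<theta> a ((!) [x]) * \<theta> b ((!) [y]) - \<theta> a ((!) [y]) * \<theta> b ((!) [x])"
  by (rule cmon_2) (rule \<theta>)

lemma cmon_3':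
  "a \<in> {1..6} \<Longrightarrow> b \<in> {1..6} \<Longrightarrow> c \<in> {1..6} \<Longrightarrow> cmon \<theta> [a, b, c] ((!) [x, y, z])
    = \<theta> a ((!) [x]) * (\<theta> b ((!) [y]) * \<theta> c ((!) [z]) - \<theta> b ((!) [z]) * \<theta> c ((!) [y]))
    - \<theta> a ((!) [y]) * (\<theta> b ((!) [x]) * \<theta> c ((!) [z]) - \<theta> b ((!) [z]) * \<theta> c ((!) [x]))
    + \<theta> a ((!) [z]) * (\<theta> b ((!) [x]) * \<theta> c ((!) [y]) - \<theta> b ((!) [y]) * \<theta> c ((!) [x]))"
  by (rule cmon_3) (rule \<theta>)

lemma omega_nth:
  "\<omega> ((!) [x, y]) = cmon \<theta> [1,2] ((!) [x, y]) + cmon \<theta> [3,4] ((!) [x, y]) + cmon \<theta> [5,6] ((!) [x, y])"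
  by (simp only: su3_omega_def plus_fun_def)

lemma psip_nth:
  "\<psi>p ((!) [x, y, z]) = cmon \<theta> [1,3,5] ((!) [x, y, z]) - cmon \<theta> [1,4,6] ((!) [x, y, z])
    - cmon \<theta> [2,3,6] ((!) [x, y, z]) - cmon \<theta> [2,4,5] ((!) [x, y, z])"
  by (simp only: su3_psip_def fun_diff_def)

lemma psim_nth:
  "\<psi>m ((!) [x, y, z]) = - cmon \<theta> [2,4,6] ((!) [x, y, z]) + cmon \<theta> [2,3,5] ((!) [x, y, z])
    + cmon \<theta> [1,4,5] ((!) [x, y, z]) + cmon \<theta> [1,3,6] ((!) [x, y, z])"
  by (simp only: su3_psim_def plus_fun_def fun_Compl_def)

lemmas omega_frame = omega_nth cmon_2' dual
lemmas psi_frame = psip_nth psim_nth cmon_3' dual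

lemma vol_frame: "vol ((!) [u 0, u 1, u 2, u 3, u 4, u 5]) = 1"
  using mwedge_4_2[OF alternating_mwedge[OF alternating_omega alternating_omega, simplified] alternating_omega]
  by (simp add: su3_vol_def mwedge_2_2[OF alternating_omega alternating_omega] omega_frame fact_numeral)

lemma metric_sym: "g x y = g y x"
  by (simp add: coframe_metric_def mult.commute)

lemma metric_bilinear: "bilinear g"
proof -
  have "linear (\<lambda>y. \<theta> k (\<lambda>_. x) * \<theta> k (\<lambda>_. y))" if "k \<in> {1..6}" for k x
    using \<theta>[OF that] linear_compose_scale_right[of "\<lambda>y. \<theta> k (\<lambda>_. y)" "\<theta> k (\<lambda>_. x)"]
    by (simp add: alternating_1_iff)
  then have "linear (\<lambda>y. g x y)" for x
    unfolding coframe_metric_def dim by (intro linear_compose_sum) auto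
  then show ?thesis
    unfolding bilinear_def using metric_sym by presburger
qed

lemma dual_const: "k \<in> {1..6} \<Longrightarrow> j < 6 \<Longrightarrow> \<theta> k (\<lambda>_. u j) = (if k = Suc j then 1 else 0)"
  using const_nth[of "\<theta> k" "u j"] \<theta>[of k] dual[of k j] by simp

lemma frame: "orthonormal_frame g u"
  unfolding orthonormal_frame_def dim
proof (intro allI impI)
  fix i j :: nat assume ij: "i < 6" "j < 6"
  have "g (u i) (u j) = (\<Sum>k = 1..6. if k = Suc i then (if i = j then 1 else 0) else 0)"
    unfolding coframe_metric_def dim using ij by (intro sum.cong) (auto simp: dual_const)
  then show "g (u i) (u j) = (if i = j then 1 else 0)"
    using ij by simp
qed

lemma span: "x = (\<Sum>i<6. g x (u i) *\<^sub>R u i)"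
  using orthonormal_frame_expand[OF metric_bilinear frame, of x] unfolding dim .

lemma vol_permuted:
  assumes "distinct L" "set L = {..<6}"
  shows "vol ((!) (map u L)) = list_sign L"
proof -
  have "length L = 6"
    using distinct_card[OF assms(1)] assms(2) by simp
  moreover have "sort L = [0..<6]"
    by (rule sorted_distinct_set_unique) (simp_all add: assms lessThan_atLeast0)
  ultimately have "vol ((!) (map u L)) = list_sign L * vol ((!) (map u [0..<6]))"
    using alternating_sort[OF alternating_vol, where u = u and xs = L] by simp
  also have "map u [0..<6] = [u 0, u 1, u 2, u 3, u 4, u 5]"
    by (simp add: upt_rec numeral_eq_Suc)
  finally show ?thesis
    by (simp only: vol_frame)
qed

lemma star_frame:
  assumes "alternating k a" "distinct (I @ J)" "set (I @ J) = {..<6}" "length I = k"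
  shows "mhodge g vol k a ((!) (map u J)) = a ((!) (map u I)) * list_sign (I @ J)"
  using mhodge_frame[OF metric_bilinear metric_sym frame assms(1), of vol I J] assms
    alternating_vol vol_permuted[OF assms(2,3)] by (simp add: dim)

end

lemma filter_in_subseqs: "filter P xs \<in> set (subseqs xs)"
  by (induction xs) (auto simp: Let_def)

lemma sorted_in_subseqs:
  assumes "sorted_wrt (<) J" "set J \<subseteq> {..<n :: nat}"
  shows "J \<in> set (subseqs [0..<n])"
proof -
  have "J = filter (\<lambda>i. i \<in> set J) [0..<n]"
    using assms by (intro sorted_distinct_set_unique)
      (auto simp: strict_sorted_iff sorted_wrt_filter)
  then show ?thesis
    by (metis filter_in_subseqs)
qed

lemma sorted_lists_3:
  assumes "length J = 3" "sorted_wrt (<) J" "set J \<subseteq> {..<6 :: nat}"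
  shows "J \<in> set [[0,1,2], [0,1,3], [0,1,4], [0,1,5], [0,2,3], [0,2,4], [0,2,5], [0,3,4], [0,3,5], [0,4,5],
    [1,2,3], [1,2,4], [1,2,5], [1,3,4], [1,3,5], [1,4,5], [2,3,4], [2,3,5], [2,4,5], [3,4,5]]"
proof -
  have "J \<in> set (filter (\<lambda>J. length J = 3) (subseqs [0..<6]))"
    using sorted_in_subseqs[OF assms(2,3)] assms(1) by simp
  then show ?thesis
    by (simp add: upt_rec Let_def numeral_eq_Suc)
qed

lemma sorted_lists_4:
  assumes "length J = 4" "sorted_wrt (<) J" "set J \<subseteq> {..<6 :: nat}"
  shows "J \<in> set [[0,1,2,3], [0,1,2,4], [0,1,2,5], [0,1,3,4], [0,1,3,5], [0,1,4,5], [0,2,3,4], [0,2,3,5],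
    [0,2,4,5], [0,3,4,5], [1,2,3,4], [1,2,3,5], [1,2,4,5], [1,3,4,5], [2,3,4,5]]"
proof -
  have "J \<in> set (filter (\<lambda>J. length J = 4) (subseqs [0..<6]))"
    using sorted_in_subseqs[OF assms(2,3)] assms(1) by simp
  then show ?thesis
    by (simp add: upt_rec Let_def numeral_eq_Suc)
qed

context su3_frame
begin

lemma star_frame_sorted:
  fixes J :: "nat list"
  defines "I \<equiv> filter (\<lambda>i. i \<notin> set J) [0,1,2,3,4,5]"
  assumes a: "alternating k a" and J: "k + length J = 6" "sorted_wrt (<) J" "set J \<subseteq> {..<6}"
  shows "mhodge g vol k a ((!) (map u J)) = a ((!) (map u I)) * list_sign (I @ J)"
proof (rule star_frame[OF a])
  have I: "I = filter (\<lambda>i. i \<notin> set J) [0..<6]"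
    by (simp add: I_def upt_rec numeral_eq_Suc)
  show dist: "distinct (I @ J)" and set: "set (I @ J) = {..<6}"
    using J(2,3) by (auto simp: I strict_sorted_iff)
  show "length I = k"
    using distinct_card[OF dist] J(1) unfolding set by simp
qed

lemma star_omega: "mhodge g vol 2 \<omega> = (\<lambda>v. 1 / 2 * mwedge 2 2 \<omega> \<omega> v)"
proof (rule alternating_eq_frame[OF _ _ span])
  show "alternating 4 (mhodge g vol 2 \<omega>)"
    using alternating_mhodge[of vol 2 g \<omega>] alternating_vol by (simp add: dim)
  show "alternating 4 (\<lambda>v. 1 / 2 * mwedge 2 2 \<omega> \<omega> v)"
    using alternating_mwedge[OF alternating_omega alternating_omega] by (intro alternating_scale) simp
  fix J :: "nat list" assume J: "length J = 4" "sorted_wrt (<) J" "set J \<subseteq> {..<6}"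
  have eval: "\<forall>J \<in> set [[0,1,2,3], [0,1,2,4], [0,1,2,5], [0,1,3,4], [0,1,3,5], [0,1,4,5], [0,2,3,4], [0,2,3,5],
    [0,2,4,5], [0,3,4,5], [1,2,3,4], [1,2,3,5], [1,2,4,5], [1,3,4,5], [2,3,4,5]].
      \<omega> ((!) (map u (filter (\<lambda>i. i \<notin> set J) [0,1,2,3,4,5])))
        * list_sign (filter (\<lambda>i. i \<notin> set J) [0,1,2,3,4,5] @ J)
      = 1 / 2 * mwedge 2 2 \<omega> \<omega> ((!) (map u J))"
    by (simp add: mwedge_2_2[OF alternating_omega alternating_omega] omega_frame)
  have "2 + length J = 6"
    using J(1) by simp
  from star_frame_sorted[OF alternating_omega this J(2,3)]
  show "mhodge g vol 2 \<omega> ((!) (map u J)) = 1 / 2 * mwedge 2 2 \<omega> \<omega> ((!) (map u J))"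
    using bspec[OF eval sorted_lists_4[OF J]] by (rule trans)
qed

lemma star_psip: "mhodge g vol 3 \<psi>p = \<psi>m"
proof (rule alternating_eq_frame[OF _ alternating_psim span])
  show "alternating 3 (mhodge g vol 3 \<psi>p)"
    using alternating_mhodge[of vol 3 g \<psi>p] alternating_vol by (simp add: dim)
  fix J :: "nat list" assume J: "length J = 3" "sorted_wrt (<) J" "set J \<subseteq> {..<6}"
  have eval: "\<forall>J \<in> set [[0,1,2], [0,1,3], [0,1,4], [0,1,5], [0,2,3], [0,2,4], [0,2,5], [0,3,4], [0,3,5], [0,4,5],
    [1,2,3], [1,2,4], [1,2,5], [1,3,4], [1,3,5], [1,4,5], [2,3,4], [2,3,5], [2,4,5], [3,4,5]].
      \<psi>p ((!) (map u (filter (\<lambda>i. i \<notin> set J) [0,1,2,3,4,5])))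
        * list_sign (filter (\<lambda>i. i \<notin> set J) [0,1,2,3,4,5] @ J)
      = \<psi>m ((!) (map u J))"
    by (simp add: psi_frame)
  have "3 + length J = 6"
    using J(1) by simp
  from star_frame_sorted[OF alternating_psip this J(2,3)]
  show "mhodge g vol 3 \<psi>p ((!) (map u J)) = \<psi>m ((!) (map u J))"
    using bspec[OF eval sorted_lists_3[OF J]] by (rule trans)
qed

text \<open>The wedge products of \<open>\<nu>1 \<and> \<omega>\<close> and \<open>\<nu>3\<close> with \<open>\<psi>\<^sub>+\<close> and \<open>\<psi>\<^sub>-\<close> vanish, whereas \<open>\<psi>\<^sub>+ \<and> \<psi>\<^sub>-\<close> is four
  times the volume form. In components: on the index triples of \<open>\<psi>\<^sub>+\<close> and \<open>\<psi>\<^sub>-\<close> the form \<open>\<nu>1 \<and> \<omega>\<close> is zero.\<close>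

lemma torsion_functions_vanish:
  fixes s q :: real
  assumes \<nu>: "alternating 1 \<nu>1" "alternating 3 \<nu>3"
    and eq: "\<And>v. (- 3/2) * (s * \<psi>p v) + (3/2) * (q * \<psi>m v) + mwedge 1 2 \<nu>1 \<omega> v + \<nu>3 v = 0"
    and \<nu>3: "mwedge 3 3 \<nu>3 \<psi>p ((!) [u 0, u 1, u 2, u 3, u 4, u 5]) = 0"
      "mwedge 3 3 \<nu>3 \<psi>m ((!) [u 0, u 1, u 2, u 3, u 4, u 5]) = 0"
  shows "s = 0" "q = 0"
proof -
  have val: "\<nu>3 v = (3/2) * (s * \<psi>p v) - (3/2) * (q * \<psi>m v) - mwedge 1 2 \<nu>1 \<omega> v" for v
    using eq[of v] by simp
  have "\<nu>3 ((!) [u 0, u 2, u 4]) = 3/2 * s" "\<nu>3 ((!) [u 0, u 3, u 5]) = - (3/2 * s)"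
    "\<nu>3 ((!) [u 1, u 2, u 5]) = - (3/2 * s)" "\<nu>3 ((!) [u 1, u 3, u 4]) = - (3/2 * s)"
    "\<nu>3 ((!) [u 1, u 3, u 5]) = 3/2 * q" "\<nu>3 ((!) [u 1, u 2, u 4]) = - (3/2 * q)"
    "\<nu>3 ((!) [u 0, u 3, u 4]) = - (3/2 * q)" "\<nu>3 ((!) [u 0, u 2, u 5]) = - (3/2 * q)"
    unfolding val mwedge_1_2[OF \<nu>(1) alternating_omega] by (simp_all add: omega_frame psi_frame)
  then show "s = 0" "q = 0"
    using \<nu>3 unfolding mwedge_3_3[OF \<nu>(2) alternating_psip] mwedge_3_3[OF \<nu>(2) alternating_psim]
    by (simp_all add: psi_frame)
qed

end

context su3_frame
begin

text \<open>The equation \<open>\<star>\<tau> = - \<tau> \<and> \<omega>\<close> makes \<open>\<tau>\<close> a form of type \<open>(1,1)\<close>, which is invariant under the complex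
  structure. Contracted with a complex line, \<open>p \<and> \<psi>p\<close> changes its sign under the complex structure
  acting on the other two lines. So both sides vanish there, which yields \<open>p = 0\<close> and then \<open>\<star>\<tau> = 0\<close>.\<close>

lemma torsion_forms_vanish:
  assumes p: "alternating 1 p" and \<tau>: "alternating 2 \<tau>"
    and eq: "\<And>v. mwedge 1 3 p \<psi>p v = mwedge 2 2 \<tau> \<omega> v"
    and star: "\<And>v. mhodge g vol 2 \<tau> v = - mwedge 2 2 \<tau> \<omega> v"
  shows "p v = 0" "\<tau> v = 0"
proof -
  have star': "\<tau> ((!) (map u (filter (\<lambda>i. i \<notin> set J) [0,1,2,3,4,5])))
        * list_sign (filter (\<lambda>i. i \<notin> set J) [0,1,2,3,4,5] @ J) = - mwedge 2 2 \<tau> \<omega> ((!) (map u J))"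
    if "length J = 4" "sorted_wrt (<) J" "set J \<subseteq> {..<6}" for J
    using star_frame_sorted[OF \<tau> _ that(2,3)] that(1) star[of "(!) (map u J)"] by simp
  note expand = mwedge_1_3[OF p alternating_psip, unfolded One_nat_def] mwedge_2_2[OF \<tau> alternating_omega] omega_frame psi_frame
  \<comment> \<open>Each index list consists of a complex line and one vector from each of the other two.\<close>
  have p0: "p ((!) [u 0]) = 0" and p1: "p ((!) [u 1]) = 0"
    using eq[of "(!) [u 0, u 1, u 2, u 4]"] eq[of "(!) [u 0, u 1, u 2, u 5]"] eq[of "(!) [u 0, u 1, u 3, u 4]"] eq[of "(!) [u 0, u 1, u 3, u 5]"]
      star'[of "[0,1,2,4]"] star'[of "[0,1,2,5]"] star'[of "[0,1,3,4]"] star'[of "[0,1,3,5]"]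
    by (simp_all add: expand)
  have p2: "p ((!) [u 2]) = 0" and p3: "p ((!) [u 3]) = 0"
    using eq[of "(!) [u 0, u 2, u 3, u 4]"] eq[of "(!) [u 0, u 2, u 3, u 5]"] eq[of "(!) [u 1, u 2, u 3, u 4]"] eq[of "(!) [u 1, u 2, u 3, u 5]"]
      star'[of "[0,2,3,4]"] star'[of "[0,2,3,5]"] star'[of "[1,2,3,4]"] star'[of "[1,2,3,5]"]
    by (simp_all add: expand)
  have p4: "p ((!) [u 4]) = 0" and p5: "p ((!) [u 5]) = 0"
    using eq[of "(!) [u 0, u 2, u 4, u 5]"] eq[of "(!) [u 0, u 3, u 4, u 5]"] eq[of "(!) [u 1, u 2, u 4, u 5]"] eq[of "(!) [u 1, u 3, u 4, u 5]"]
      star'[of "[0,2,4,5]"] star'[of "[0,3,4,5]"] star'[of "[1,2,4,5]"] star'[of "[1,3,4,5]"]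
    by (simp_all add: expand)
  have p_zero: "p = (\<lambda>_. 0)"
  proof
    fix v show "p v = 0"
    proof (rule alternating_eq_0_frame[OF p span])
      fix J :: "nat list" assume J: "length J = 1" "set J \<subseteq> {..<6}"
      then obtain j where j: "J = [j]" "j < 6"
        using length_lists(1)[of J] by auto
      then have "j = 0 \<or> j = 1 \<or> j = 2 \<or> j = 3 \<or> j = 4 \<or> j = 5"
        by linarith
      with j show "p ((!) (map u J)) = 0"
        using p0 p1 p2 p3 p4 p5 by auto
    qed
  qed
  then show "p v = 0" by simp
  have "mwedge 1 3 p \<psi>p v = 0" for v
    by (simp add: p_zero mwedge_def)
  then have star_zero: "mhodge g vol 2 \<tau> v = 0" for v
    by (simp add: star flip: eq)
  show "\<tau> v = 0"
  proof (rule alternating_eq_0_frame[OF \<tau> span])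
    fix I :: "nat list" assume I: "length I = 2" "sorted_wrt (<) I" "set I \<subseteq> {..<6}"
    then have "distinct I"
      by (simp add: strict_sorted_iff)
    from complementary_list[OF this I(3)] obtain J where J: "distinct (J @ I)" "set (J @ I) = {..<6}" by blast
    then have "\<tau> ((!) (map u I)) * list_sign (I @ J) = 0"
      using star_frame[OF \<tau>, of I J] I(1) star_zero by (simp add: Un_commute Int_commute)
    moreover have "list_sign (I @ J) \<noteq> 0"
      using list_sign_square[of "I @ J"] by auto
    ultimately show "\<tau> ((!) (map u I)) = 0" by simp
  qed
qed

end

text \<open>The rotation by the angle with cosine \<open>\<alpha>\<close> and sine \<open>\<beta>\<close> in the first complex line
  multiplies the complex volume form by a phase and fixes the rest of the structure.\<close>

definition rotate_coframe :: "real \<Rightarrow> real \<Rightarrow> (nat \<Rightarrow> 'e mform) \<Rightarrow> nat \<Rightarrow> 'e mform" where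
  "rotate_coframe \<alpha> \<beta> \<theta> = \<theta>(1 := \<lambda>v. \<alpha> * \<theta> 1 v - \<beta> * \<theta> 2 v, 2 := \<lambda>v. \<beta> * \<theta> 1 v + \<alpha> * \<theta> 2 v)"

lemma su3_frame_rotate:
  assumes "su3_frame \<theta> u" and ab: "\<alpha>\<^sup>2 + \<beta>\<^sup>2 = 1"
  defines "\<eta> \<equiv> rotate_coframe \<alpha> \<beta> \<theta>"
  shows "su3_frame \<eta> (u(0 := \<alpha> *\<^sub>R u 0 - \<beta> *\<^sub>R u 1, 1 := \<beta> *\<^sub>R u 0 + \<alpha> *\<^sub>R u 1))"
    and "su3_omega \<eta> = su3_omega \<theta>"
    and "su3_psip \<eta> = (\<lambda>v. \<alpha> * su3_psip \<theta> v - \<beta> * su3_psim \<theta> v)"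
    and "su3_psim \<eta> = (\<lambda>v. \<alpha> * su3_psim \<theta> v + \<beta> * su3_psip \<theta> v)"
    and "coframe_metric \<eta> = coframe_metric \<theta>"
proof -
  interpret su3_frame \<theta> u by fact
  have \<eta>: "alternating 1 (\<eta> k)" if "k \<in> {1..6}" for k
    using \<theta>[OF that] \<theta>[of 1] \<theta>[of 2]
    by (auto simp: \<eta>_def rotate_coframe_def intro!: alternating_diff alternating_add alternating_scale)
  have lin: "linear (\<lambda>x. \<theta> k ((!) [x]))" if "k \<in> {1..6}" for k
  proof -
    have alt: "alternating (Suc 0) (\<theta> k)"
      using \<theta>[OF that] by simp
    then have "linear (\<lambda>x. \<theta> k (\<lambda>_. x))"
      unfolding alternating_1_iff by blast
    then show ?thesis
      by (simp only: const_nth[OF alt])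
  qed
  have at_u0: "\<theta> k ((!) [\<alpha> *\<^sub>R u 0 - \<beta> *\<^sub>R u 1]) = \<alpha> * \<theta> k ((!) [u 0]) - \<beta> * \<theta> k ((!) [u 1])"
    and at_u1: "\<theta> k ((!) [\<beta> *\<^sub>R u 0 + \<alpha> *\<^sub>R u 1]) = \<beta> * \<theta> k ((!) [u 0]) + \<alpha> * \<theta> k ((!) [u 1])"
    if "k \<in> {1..6}" for k
    using linear_diff[OF lin[OF that]] linear_add[OF lin[OF that]] linear_scale[OF lin[OF that]] by simp_all
  have ab': "\<alpha> * \<alpha> + \<beta> * \<beta> = 1"
    using ab by (simp add: power2_eq_square)
  show rot: "su3_frame \<eta> (u(0 := \<alpha> *\<^sub>R u 0 - \<beta> *\<^sub>R u 1, 1 := \<beta> *\<^sub>R u 0 + \<alpha> *\<^sub>R u 1))"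
  proof
    fix k j :: nat assume kj: "k \<in> {1..6}" "j < 6"
    consider "j = 0" | "j = 1" | "j \<noteq> 0" "j \<noteq> 1" by blast
    then show "\<eta> k ((!) [(u(0 := \<alpha> *\<^sub>R u 0 - \<beta> *\<^sub>R u 1, 1 := \<beta> *\<^sub>R u 0 + \<alpha> *\<^sub>R u 1)) j])
        = (if k = Suc j then 1 else 0)"
      by cases (use kj ab' in \<open>auto simp: \<eta>_def rotate_coframe_def at_u0[simplified] at_u1[simplified] dual algebra_simps\<close>)
  qed (use dim \<eta> in auto)
  interpret rot: su3_frame \<eta> "u(0 := \<alpha> *\<^sub>R u 0 - \<beta> *\<^sub>R u 1, 1 := \<beta> *\<^sub>R u 0 + \<alpha> *\<^sub>R u 1)"
    by fact
  have \<eta>_simps: "\<eta> 1 = (\<lambda>v. \<alpha> * \<theta> 1 v - \<beta> * \<theta> 2 v)" "\<eta> 2 = (\<lambda>v. \<beta> * \<theta> 1 v + \<alpha> * \<theta> 2 v)"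
    "\<eta> 3 = \<theta> 3" "\<eta> 4 = \<theta> 4" "\<eta> 5 = \<theta> 5" "\<eta> 6 = \<theta> 6"
    by (simp_all add: \<eta>_def rotate_coframe_def)
  show "su3_omega \<eta> = su3_omega \<theta>"
  proof (rule alternating_ext[OF rot.alternating_omega alternating_omega])
    fix xs :: "'a list" assume "length xs = 2"
    then obtain x y where "xs = [x, y]" by (auto simp: length_lists)
    moreover have "(\<alpha> * a - \<beta> * b) * (\<beta> * c + \<alpha> * d) - (\<alpha> * c - \<beta> * d) * (\<beta> * a + \<alpha> * b)
        = (\<alpha> * \<alpha> + \<beta> * \<beta>) * (a * d - c * b)" for a b c d :: real
      by (simp add: algebra_simps)
    ultimately show "su3_omega \<eta> ((!) xs) = su3_omega \<theta> ((!) xs)"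
      by (simp add: omega_nth rot.omega_nth cmon_2' rot.cmon_2' \<eta>_simps[simplified] ab')
  qed
  show "su3_psip \<eta> = (\<lambda>v. \<alpha> * su3_psip \<theta> v - \<beta> * su3_psim \<theta> v)"
  proof (rule alternating_ext[OF rot.alternating_psip])
    show "alternating 3 (\<lambda>v. \<alpha> * su3_psip \<theta> v - \<beta> * su3_psim \<theta> v)"
      by (intro alternating_diff alternating_scale alternating_psip alternating_psim)
    fix xs :: "'a list" assume "length xs = 3"
    then obtain x y z where "xs = [x, y, z]" by (auto simp: length_lists)
    then show "su3_psip \<eta> ((!) xs) = \<alpha> * su3_psip \<theta> ((!) xs) - \<beta> * su3_psim \<theta> ((!) xs)"
      by (simp add: psip_nth psim_nth rot.psip_nth cmon_3' rot.cmon_3' \<eta>_simps[simplified])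
        (simp add: algebra_simps)
  qed
  show "su3_psim \<eta> = (\<lambda>v. \<alpha> * su3_psim \<theta> v + \<beta> * su3_psip \<theta> v)"
  proof (rule alternating_ext[OF rot.alternating_psim])
    show "alternating 3 (\<lambda>v. \<alpha> * su3_psim \<theta> v + \<beta> * su3_psip \<theta> v)"
      by (intro alternating_add alternating_scale alternating_psip alternating_psim)
    fix xs :: "'a list" assume "length xs = 3"
    then obtain x y z where "xs = [x, y, z]" by (auto simp: length_lists)
    then show "su3_psim \<eta> ((!) xs) = \<alpha> * su3_psim \<theta> ((!) xs) + \<beta> * su3_psip \<theta> ((!) xs)"
      by (simp add: psip_nth psim_nth rot.psim_nth cmon_3' rot.cmon_3' \<eta>_simps[simplified])
        (simp add: algebra_simps)
  qed
  show "coframe_metric \<eta> = coframe_metric \<theta>"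
  proof (intro ext)
    fix x y
    have "(\<alpha> * a - \<beta> * b) * (\<alpha> * c - \<beta> * d) + (\<beta> * a + \<alpha> * b) * (\<beta> * c + \<alpha> * d)
        = (\<alpha> * \<alpha> + \<beta> * \<beta>) * (a * c + b * d)" for a b c d :: real
      by (simp add: algebra_simps)
    moreover have "{1..6} = {1, 2, 3, 4, 5, 6 :: nat}" by auto
    ultimately show "coframe_metric \<eta> x y = coframe_metric \<theta> x y"
      by (simp add: coframe_metric_def dim \<eta>_simps[simplified] ab' flip: add.assoc)
  qed
qed

section \<open>Smooth functions\<close>

lemma differentiable_has_derivative:
  "f differentiable at x \<Longrightarrow> (f has_derivative frechet_derivative f (at x)) (at x)"
  by (simp add: frechet_derivative_works)

lemma Ck_on_cong:
  assumes "open S" and "\<And>x. x \<in> S \<Longrightarrow> f x = g x" and "Ck_on k S f"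
  shows "Ck_on k S g"
  using assms(2,3)
proof (induction k arbitrary: f g)
  case 0
  then show ?case using continuous_on_cong[of S S f g] by simp
next
  case (Suc k)
  have diff: "f differentiable at x" if "x \<in> S" for x
    using Suc.prems(2) that by simp
  have "g differentiable at x" if x: "x \<in> S" for x
  proof -
    from diff[OF x] obtain D where "(f has_derivative D) (at x)"
      by (auto simp: differentiable_def)
    then have "(g has_derivative D) (at x)"
      using has_derivative_transform_within_open[OF _ assms(1) x, of f D UNIV g] Suc.prems(1) by simp
    then show ?thesis by (auto simp: differentiable_def)
  qed
  moreover have "Ck_on k S (\<lambda>x. frechet_derivative g (at x) u)" for u
  proof (rule Suc.IH)
    show "Ck_on k S (\<lambda>x. frechet_derivative f (at x) u)"
      using Suc.prems(2) by simp
    fix x assume "x \<in> S"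
    then show "frechet_derivative f (at x) u = frechet_derivative g (at x) u"
      using frechet_derivative_transform_within_open[OF diff assms(1) _ Suc.prems(1), of x] by simp
  qed
  ultimately show ?case by simp
qed

lemma Ck_on_SucD: "Ck_on (Suc k) S f \<Longrightarrow> Ck_on k S f"
proof (induction k arbitrary: f)
  case 0
  then show ?case
    by (auto intro!: continuous_at_imp_continuous_on differentiable_imp_continuous_within)
next
  case (Suc k)
  then show ?case by (simp only: Ck_on.simps(2)) blast
qed

lemma Ck_on_const: "Ck_on k S (\<lambda>_. c)"
  by (induction k arbitrary: c) (auto simp: frechet_derivative_const)

lemma Ck_on_add:
  assumes "open S" shows "Ck_on k S f \<Longrightarrow> Ck_on k S g \<Longrightarrow> Ck_on k S (\<lambda>x. f x + g x)"
proof (induction k arbitrary: f g)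
  case 0
  then show ?case by (auto intro: continuous_intros)
next
  case (Suc k)
  have "Ck_on k S (\<lambda>x. frechet_derivative (\<lambda>x. f x + g x) (at x) u)" for u
  proof (rule Ck_on_cong[OF assms])
    show "Ck_on k S (\<lambda>x. frechet_derivative f (at x) u + frechet_derivative g (at x) u)"
      using Suc by simp
    fix x assume x: "x \<in> S"
    have "((\<lambda>x. f x + g x) has_derivative
        (\<lambda>u. frechet_derivative f (at x) u + frechet_derivative g (at x) u)) (at x)"
      using Suc.prems x by (intro has_derivative_add) (auto intro: differentiable_has_derivative)
    then show "frechet_derivative f (at x) u + frechet_derivative g (at x) u
        = frechet_derivative (\<lambda>x. f x + g x) (at x) u"
      by (simp add: frechet_derivative_at[symmetric])
  qed
  then show ?case using Suc.prems by simp
qed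

lemma Ck_on_mult:
  fixes f g :: "'a::euclidean_space \<Rightarrow> real"
  assumes "open S" shows "Ck_on k S f \<Longrightarrow> Ck_on k S g \<Longrightarrow> Ck_on k S (\<lambda>x. f x * g x)"
proof (induction k arbitrary: f g)
  case 0
  then show ?case by (auto intro: continuous_intros)
next
  case (Suc k)
  have "Ck_on k S (\<lambda>x. frechet_derivative (\<lambda>x. f x * g x) (at x) u)" for u
  proof (rule Ck_on_cong[OF assms])
    show "Ck_on k S (\<lambda>x. f x * frechet_derivative g (at x) u + frechet_derivative f (at x) u * g x)"
      using Suc.prems by (intro Ck_on_add[OF assms] Suc.IH) (auto dest: Ck_on_SucD simp del: Ck_on.simps(2), simp_all)
    fix x assume x: "x \<in> S"
    have "((\<lambda>x. f x * g x) has_derivative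
        (\<lambda>u. f x * frechet_derivative g (at x) u + frechet_derivative f (at x) u * g x)) (at x)"
      using Suc.prems x by (intro has_derivative_mult) (auto intro: differentiable_has_derivative)
    then show "f x * frechet_derivative g (at x) u + frechet_derivative f (at x) u * g x
        = frechet_derivative (\<lambda>x. f x * g x) (at x) u"
      by (simp add: frechet_derivative_at[symmetric])
  qed
  then show ?case using Suc.prems by simp
qed

lemma Ck_on_fst:
  assumes "open S" "open B" shows "Ck_on k S h \<Longrightarrow> Ck_on k (S \<times> B) (\<lambda>x. h (fst x))"
proof (induction k arbitrary: h)
  case 0
  then show ?case
    by (auto intro!: continuous_on_compose2[of S h] continuous_intros)
next
  case (Suc k)
  have d: "((\<lambda>x. h (fst x)) has_derivative (\<lambda>u. frechet_derivative h (at (fst x)) (fst u))) (at x)"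
    if "x \<in> S \<times> B" for x
  proof -
    have "(h has_derivative frechet_derivative h (at (fst x))) (at (fst x))"
      using Suc.prems that by (auto intro: differentiable_has_derivative)
    from has_derivative_compose[OF has_derivative_fst[OF has_derivative_ident] this]
    show ?thesis by simp
  qed
  have "Ck_on k (S \<times> B) (\<lambda>x. frechet_derivative (\<lambda>x. h (fst x)) (at x) u)" for u
  proof (rule Ck_on_cong[OF open_Times[OF assms]])
    show "Ck_on k (S \<times> B) (\<lambda>x. frechet_derivative h (at (fst x)) (fst u))"
      using Suc.IH[of "\<lambda>y. frechet_derivative h (at y) (fst u)"] Suc.prems by simp
    show "frechet_derivative h (at (fst x)) (fst u) = frechet_derivative (\<lambda>x. h (fst x)) (at x) u"
      if "x \<in> S \<times> B" for x
      using d[OF that] by (simp add: frechet_derivative_at[symmetric])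
  qed
  moreover have "(\<lambda>x. h (fst x)) differentiable at x" if "x \<in> S \<times> B" for x
    using d[OF that] unfolding differentiable_def by blast
  ultimately show ?case by simp
qed

lemma smooth_on_const: "smooth_on S (\<lambda>_. c)"
  by (simp add: smooth_on_def Ck_on_const)

lemma smooth_on_cong: "open S \<Longrightarrow> smooth_on S f \<Longrightarrow> (\<And>x. x \<in> S \<Longrightarrow> f x = g x) \<Longrightarrow> smooth_on S g"
  unfolding smooth_on_def by (blast intro: Ck_on_cong)

lemma smooth_on_add: "open S \<Longrightarrow> smooth_on S f \<Longrightarrow> smooth_on S g \<Longrightarrow> smooth_on S (\<lambda>x. f x + g x)"
  by (simp add: smooth_on_def Ck_on_add)

lemma smooth_on_mult:
  fixes f g :: "'a::euclidean_space \<Rightarrow> real"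
  shows "open S \<Longrightarrow> smooth_on S f \<Longrightarrow> smooth_on S g \<Longrightarrow> smooth_on S (\<lambda>x. f x * g x)"
  by (simp add: smooth_on_def Ck_on_mult)

lemma smooth_on_sum:
  assumes "open S" "\<And>i. i \<in> A \<Longrightarrow> smooth_on S (f i)"
  shows "smooth_on S (\<lambda>x. \<Sum>i\<in>A. f i x)"
  using assms(2)
  by (induction A rule: infinite_finite_induct) (auto intro: smooth_on_const smooth_on_add[OF assms(1)])

lemma smooth_on_fst:
  "open S \<Longrightarrow> open B \<Longrightarrow> smooth_on S h \<Longrightarrow> smooth_on (S \<times> B) (\<lambda>x. h (fst x))"
  by (simp add: smooth_on_def Ck_on_fst)

lemma smooth_on_differentiable: "smooth_on S f \<Longrightarrow> x \<in> S \<Longrightarrow> f differentiable at x"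
  unfolding smooth_on_def by (metis Ck_on.simps(2))

section \<open>Charts of a manifold and of its product with the circle\<close>

lemma chart:
  assumes "smooth_manifold M"
  shows chart_inj: "inj_on (coord M i) (cdom M i)"
    and open_cdom: "openin (mtop M) (cdom M i)"
    and cdom_subset: "cdom M i \<subseteq> topspace (mtop M)"
    and open_chart_image: "openin (mtop M) U \<Longrightarrow> open (coord M i ` (cdom M i \<inter> U))"
proof -
  have op: "openin (mtop M) (cdom M i)" and "open (coord M i ` cdom M i)"
    and hom: "homeomorphic_map (subtopology (mtop M) (cdom M i)) (top_of_set (coord M i ` cdom M i)) (coord M i)"
    using assms by (auto simp: smooth_manifold_def)
  show "openin (mtop M) (cdom M i)" by fact
  show sub: "cdom M i \<subseteq> topspace (mtop M)"
    using op by (rule openin_subset)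
  show "inj_on (coord M i) (cdom M i)"
    using homeomorphic_imp_injective_map[OF hom] sub by (simp add: Int_absorb1)
  show "open (coord M i ` (cdom M i \<inter> U))" if "openin (mtop M) U"
  proof -
    have "openin (subtopology (mtop M) (cdom M i)) (cdom M i \<inter> U)"
      using that by (auto simp: openin_subtopology)
    then have "openin (top_of_set (coord M i ` cdom M i)) (coord M i ` (cdom M i \<inter> U))"
      using homeomorphic_imp_open_map[OF hom] by (auto simp: open_map_def)
    then show ?thesis
      using \<open>open (coord M i ` cdom M i)\<close> by (rule openin_open_trans)
  qed
qed

lemma cinv_coord: "smooth_manifold M \<Longrightarrow> p \<in> cdom M i \<Longrightarrow> cinv M i (coord M i p) = p"
  by (simp add: cinv_def chart_inj inv_into_f_f)

lemma transition_differentiable: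
  assumes "smooth_manifold M" "p \<in> cdom M i" "p \<in> cdom M j"
  shows "(coord M j \<circ> cinv M i) differentiable at (coord M i p)"
proof (rule smooth_on_differentiable)
  show "smooth_on (coord M i ` (cdom M i \<inter> cdom M j)) (coord M j \<circ> cinv M i)"
    using assms(1) unfolding smooth_manifold_def by blast
qed (use assms in blast)

lemma cis_inj:
  assumes "cis x = cis y" "\<bar>x - y\<bar> < 2 * pi"
  shows "x = y"
proof -
  have "sin x = sin y" "cos x = cos y"
    using assms(1) by (auto simp: complex_eq_iff)
  then obtain n :: int where n: "x = y + 2 * pi * n"
    using sin_cos_eq_iff[of x y] by auto
  then have "2 * pi * \<bar>real_of_int n\<bar> < 2 * pi * 1"
    using assms(2) by (simp add: abs_mult)
  then have "\<bar>real_of_int n\<bar> < 1"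
    by (subst (asm) mult_less_cancel_left_pos) auto
  then have "n = 0" by linarith
  then show ?thesis using n by simp
qed

abbreviation times_circle ::
  "('i, 'm, 'e) manifold \<Rightarrow> ('i \<times> real, 'm \<times> complex, 'e \<times> real) manifold" where
  "times_circle M \<equiv> prod_manifold M circle"

lemma inj_on_cis: "inj_on cis {a<..<a + 2 * pi}"
  by (rule inj_onI, rule cis_inj) auto

lemma cdom_times_circle: "cdom (times_circle M) (i, a) = cdom M i \<times> cis ` {a<..<a + 2 * pi}"
  by (simp add: prod_manifold_def circle_def)

lemma topspace_times_circle: "topspace (mtop (times_circle M)) = topspace (mtop M) \<times> sphere 0 1"
  by (simp add: prod_manifold_def circle_def)

lemma coord_times_circle:
  assumes "s \<in> {a<..<a + 2 * pi}"
  shows "coord (times_circle M) (i, a) (p, cis s) = (coord M i p, s)"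
  using inv_into_f_f[OF inj_on_cis assms] by (simp add: prod_manifold_def circle_def)

lemma cinv_times_circle:
  assumes M: "smooth_manifold M" and x: "x \<in> coord M i ` cdom M i" and s: "s \<in> {a<..<a + 2 * pi}"
  shows "cinv (times_circle M) (i, a) (x, s) = (cinv M i x, cis s)"
proof -
  let ?P = "times_circle M"
  have "inj_on (coord ?P (i, a)) (cdom ?P (i, a))"
    unfolding cdom_times_circle
    using chart_inj[OF M] by (auto simp: inj_on_def coord_times_circle)
  moreover have "cinv M i x \<in> cdom M i" "coord M i (cinv M i x) = x"
    using x by (auto simp: cinv_coord[OF M])
  ultimately show ?thesis
    unfolding cinv_def[of ?P] using s
    by (intro inv_into_f_eq) (auto simp: cdom_times_circle coord_times_circle)
qed

lemma coord_image_times_circle: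
  "coord (times_circle M) (i, a) ` (cdom (times_circle M) (i, a) \<inter> (U \<times> sphere 0 1))
    = coord M i ` (cdom M i \<inter> U) \<times> {a<..<a + 2 * pi}"
proof -
  have "cdom (times_circle M) (i, a) \<inter> (U \<times> sphere 0 1) = (cdom M i \<inter> U) \<times> cis ` {a<..<a + 2 * pi}"
    by (auto simp: cdom_times_circle)
  then show ?thesis
    by (force simp: coord_times_circle image_iff)
qed

text \<open>A transition map of the circle is locally a translation.\<close>

lemma transition_times_circle:
  assumes M: "smooth_manifold M"
    and p: "p \<in> cdom (times_circle M) (i, a) \<inter> cdom (times_circle M) (j, b)"
  shows "frechet_derivative (coord (times_circle M) (j, b) \<circ> cinv (times_circle M) (i, a))
      (at (coord (times_circle M) (i, a) p)) v
    = (frechet_derivative (coord M j \<circ> cinv M i) (at (coord M i (fst p))) (fst v), snd v)"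
proof -
  let ?P = "times_circle M"
  obtain q z where qz: "p = (q, z)" "q \<in> cdom M i" "q \<in> cdom M j"
      "z \<in> cis ` {a<..<a + 2 * pi}" "z \<in> cis ` {b<..<b + 2 * pi}"
    using p by (cases p) (simp add: cdom_times_circle)
  then obtain s where q: "p = (q, cis s)" "q \<in> cdom M i" "q \<in> cdom M j" "s \<in> {a<..<a + 2 * pi}"
    and "cis s \<in> cis ` {b<..<b + 2 * pi}"
    by blast
  then obtain s' where s': "cis s' = cis s" "s' \<in> {b<..<b + 2 * pi}" by auto
  \<comment> \<open>The translation is by a multiple of \<open>2\<pi>\<close>, which is constant near \<open>s\<close>.\<close>
  define c where "c = s' - s"
  have "cis s * cis c = cis s"
    using s'(1) by (simp add: c_def cis_mult)
  then have "cis c = 1"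
    by (metis cis_neq_zero mult_cancel_left2)
  then have cis_c: "cis (r + c) = cis r" for r
    by (simp flip: cis_mult)
  define F where "F = coord M j \<circ> cinv M i"
  define W where "W = coord M i ` (cdom M i \<inter> cdom M j) \<times> ({a<..<a + 2 * pi} \<inter> {b - c<..<b + 2 * pi - c})"
  have "open W"
    unfolding W_def by (intro open_Times open_chart_image[OF M] open_cdom[OF M]) auto
  have x0: "coord ?P (i, a) p = (coord M i q, s)"
    using q by (simp add: coord_times_circle)
  have "(coord M i q, s) \<in> W"
    using q s' by (auto simp: W_def c_def)
  have eq: "(coord ?P (j, b) \<circ> cinv ?P (i, a)) x = (F (fst x), snd x + c)" if "x \<in> W" for x
  proof -
    obtain y r where x: "x = (y, r)" by (cases x)
    have y: "y \<in> coord M i ` cdom M i" and r: "r \<in> {a<..<a + 2 * pi}" "r + c \<in> {b<..<b + 2 * pi}"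
      using that by (auto simp: W_def x)
    show ?thesis
      using coord_times_circle[OF r(2), of M j "cinv M i y"]
      by (simp add: x cinv_times_circle[OF M y r(1)] cis_c F_def)
  qed
  have "(F has_derivative frechet_derivative F (at (coord M i q))) (at (coord M i q))"
    unfolding F_def using transition_differentiable[OF M q(2,3)] by (intro differentiable_has_derivative)
  then have "(F has_derivative frechet_derivative F (at (coord M i q))) (at (fst (coord M i q, s)))"
    by simp
  from has_derivative_compose[OF has_derivative_fst[OF has_derivative_ident] this]
  have "((\<lambda>x. F (fst x)) has_derivative (\<lambda>v. frechet_derivative F (at (coord M i q)) (fst v)))
      (at (coord M i q, s))"
    by simp
  then have "((\<lambda>x. (F (fst x), snd x + c)) has_derivative
      (\<lambda>v. (frechet_derivative F (at (coord M i q)) (fst v), snd v))) (at (coord M i q, s))"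
    by (auto intro!: derivative_eq_intros)
  then have "((coord ?P (j, b) \<circ> cinv ?P (i, a)) has_derivative
      (\<lambda>v. (frechet_derivative F (at (coord M i q)) (fst v), snd v))) (at (coord M i q, s))"
    by (rule has_derivative_transform_within_open[OF _ \<open>open W\<close> \<open>_ \<in> W\<close>]) (simp only: eq)
  from fun_cong[OF frechet_derivative_at[OF this], of v] show ?thesis
    unfolding x0[folded q(1)] by (simp add: q(1) F_def)
qed

section \<open>Smooth forms\<close>

context
  fixes M :: "('i, 'm, 'e::euclidean_space) manifold" and U :: "'m set"
  assumes open_image: "\<And>i. open (coord M i ` (cdom M i \<inter> U))"
begin

lemma Omega_on_add:
  assumes "\<eta> \<in> Omega_on M U k" "\<theta> \<in> Omega_on M U k"
  shows "\<eta> + \<theta> \<in> Omega_on M U k"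
  unfolding Omega_on_def plus_fun_def
proof (intro CollectI conjI allI ballI)
  show "alternating k (\<lambda>v. \<eta> i p v + \<theta> i p v)" if "p \<in> cdom M i \<inter> U" for i p
    using assms that by (intro alternating_add) (auto simp: Omega_on_def)
  show "smooth_on (coord M i ` (cdom M i \<inter> U)) (\<lambda>x. \<eta> i (cinv M i x) v + \<theta> i (cinv M i x) v)" for i v
    using assms by (intro smooth_on_add open_image) (auto simp: Omega_on_def)
  show "\<eta> i p v + \<theta> i p v
      = \<eta> j p (\<lambda>l. frechet_derivative (coord M j \<circ> cinv M i) (at (coord M i p)) (v l))
      + \<theta> j p (\<lambda>l. frechet_derivative (coord M j \<circ> cinv M i) (at (coord M i p)) (v l))"
    if "p \<in> cdom M i \<inter> cdom M j \<inter> U" for i j p v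
    using assms that unfolding Omega_on_def by (intro arg_cong2[where f = "(+)"]) blast+
qed

lemma Omega_on_fscale:
  assumes "\<eta> \<in> Omega_on M U k"
  shows "r *\<^sub>F \<eta> \<in> Omega_on M U k"
  unfolding Omega_on_def fscale_def
proof (intro CollectI conjI allI ballI)
  show "alternating k (\<lambda>v. r * \<eta> i p v)" if "p \<in> cdom M i \<inter> U" for i p
    using assms that by (intro alternating_scale) (auto simp: Omega_on_def)
  show "smooth_on (coord M i ` (cdom M i \<inter> U)) (\<lambda>x. r * \<eta> i (cinv M i x) v)" for i v
    using assms by (intro smooth_on_mult smooth_on_const open_image) (auto simp: Omega_on_def)
  show "r * \<eta> i p v = r * \<eta> j p (\<lambda>l. frechet_derivative (coord M j \<circ> cinv M i) (at (coord M i p)) (v l))"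
    if "p \<in> cdom M i \<inter> cdom M j \<inter> U" for i j p v
    using assms that unfolding Omega_on_def by (intro arg_cong2[where f = "(*)"]) blast+
qed

lemma Omega_on_wedge:
  assumes "\<eta> \<in> Omega_on M U k" "\<theta> \<in> Omega_on M U l"
  shows "\<eta> \<and>\<^bsub>k,l\<^esub> \<theta> \<in> Omega_on M U (k + l)"
  unfolding Omega_on_def wedge_def
proof (intro CollectI conjI allI ballI)
  show "alternating (k + l) (mwedge k l (\<eta> i p) (\<theta> i p))" if "p \<in> cdom M i \<inter> U" for i p
    using assms that by (intro alternating_mwedge) (auto simp: Omega_on_def)
  show "smooth_on (coord M i ` (cdom M i \<inter> U)) (\<lambda>x. mwedge k l (\<eta> i (cinv M i x)) (\<theta> i (cinv M i x)) v)" for i v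
  proof (rule smooth_on_cong[OF open_image])
    show "smooth_on (coord M i ` (cdom M i \<inter> U)) (\<lambda>x. 1 / (fact k * fact l) *
        (\<Sum>p | p permutes {..<k + l}. of_int (sign p) *
          (\<eta> i (cinv M i x) (\<lambda>j. v (p j)) * \<theta> i (cinv M i x) (\<lambda>j. v (p (k + j))))))"
      using assms by (intro smooth_on_mult smooth_on_sum smooth_on_const open_image) (auto simp: Omega_on_def)
  qed (simp add: mwedge_def mult.assoc)
  show "mwedge k l (\<eta> i p) (\<theta> i p) v
      = mwedge k l (\<eta> j p) (\<theta> j p) (\<lambda>l. frechet_derivative (coord M j \<circ> cinv M i) (at (coord M i p)) (v l))"
    if "p \<in> cdom M i \<inter> cdom M j \<inter> U" for i j p v
  proof -
    let ?L = "frechet_derivative (coord M j \<circ> cinv M i) (at (coord M i p))"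
    have "\<eta> i p w = \<eta> j p (\<lambda>l. ?L (w l))" "\<theta> i p w = \<theta> j p (\<lambda>l. ?L (w l))" for w
      using assms that unfolding Omega_on_def by blast+
    then show ?thesis
      unfolding mwedge_def by simp
  qed
qed

end

lemma Omega_on_diff:
  assumes "\<And>i. open (coord M i ` (cdom M i \<inter> U))" "\<eta> \<in> Omega_on M U k" "\<theta> \<in> Omega_on M U k"
  shows "\<eta> - \<theta> \<in> Omega_on M U k"
proof -
  have "\<eta> - \<theta> = \<eta> + (-1) *\<^sub>F \<theta>"
    by (intro ext) (simp add: fscale_def)
  then show ?thesis
    using Omega_on_add[OF assms(1,2) Omega_on_fscale[OF assms(1,3)]] by metis
qed

lemma pr1_pointwise: "pr1 \<eta> (i, a) (q, z) = pull_fst (\<eta> i q)"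
  by (simp add: pr1_def pull_fst_def)

lemma ds_pointwise: "ds = (\<lambda>_ _. dsnd)"
  by (simp add: ds_def dsnd_def)

lemma Omega_on_pr1:
  assumes M: "smooth_manifold M" and U: "openin (mtop M) U" and \<eta>: "\<eta> \<in> Omega_on M U k"
  shows "pr1 \<eta> \<in> Omega_on (times_circle M) (U \<times> sphere 0 1) k"
  unfolding Omega_on_def
proof (intro CollectI conjI allI ballI)
  let ?P = "times_circle M"
  fix ia p assume p: "p \<in> cdom ?P ia \<inter> (U \<times> sphere 0 1)"
  obtain i a q z where eqs: "ia = (i, a)" "p = (q, z)"
    by (cases ia; cases p) blast
  have "alternating k (\<eta> i q)"
    using p \<eta> by (auto simp: eqs cdom_times_circle Omega_on_def)
  then show "alternating k (pr1 \<eta> ia p :: ('c \<times> real) mform)"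
    unfolding eqs pr1_pointwise by (rule alternating_pull_fst)
next
  let ?P = "times_circle M"
  fix ia :: "'a \<times> real" and v :: "nat \<Rightarrow> 'c \<times> real"
  obtain i a where ia: "ia = (i, a)" by (cases ia)
  let ?S = "coord M i ` (cdom M i \<inter> U)"
  have "smooth_on ?S (\<lambda>x. \<eta> i (cinv M i x) (\<lambda>l. fst (v l)))"
    using \<eta> by (auto simp: Omega_on_def)
  then have "smooth_on (?S \<times> {a<..<a + 2 * pi}) (\<lambda>x. \<eta> i (cinv M i (fst x)) (\<lambda>l. fst (v l)))"
    by (intro smooth_on_fst open_chart_image[OF M U]) auto
  then show "smooth_on (coord ?P ia ` (cdom ?P ia \<inter> (U \<times> sphere 0 1))) (\<lambda>x. pr1 \<eta> ia (cinv ?P ia x) v)"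
    unfolding ia coord_image_times_circle
  proof (rule smooth_on_cong[rotated])
    show "open (?S \<times> {a<..<a + 2 * pi})"
      by (intro open_Times open_chart_image[OF M U]) auto
    fix x assume "x \<in> ?S \<times> {a<..<a + 2 * pi}"
    then show "\<eta> i (cinv M i (fst x)) (\<lambda>l. fst (v l)) = pr1 \<eta> (i, a) (cinv ?P (i, a) x) v"
      using cinv_times_circle[OF M, of "fst x" i "snd x" a] by (auto simp: pr1_def)
  qed
next
  let ?P = "times_circle M"
  fix ia jb p v assume p: "p \<in> cdom ?P ia \<inter> cdom ?P jb \<inter> (U \<times> sphere 0 1)"
  obtain i a j b q z where eqs: "ia = (i, a)" "jb = (j, b)" "p = (q, z)"
    by (cases ia; cases jb; cases p) blast
  have "q \<in> cdom M i \<inter> cdom M j \<inter> U"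
    using p by (auto simp: eqs cdom_times_circle)
  then have "\<eta> i q w = \<eta> j q (\<lambda>l. frechet_derivative (coord M j \<circ> cinv M i) (at (coord M i q)) (w l))" for w
    using \<eta> unfolding Omega_on_def by blast
  moreover have "p \<in> cdom ?P (i, a) \<inter> cdom ?P (j, b)"
    using p eqs by simp
  ultimately show "pr1 \<eta> ia p v
      = pr1 \<eta> jb p (\<lambda>l. frechet_derivative (coord ?P jb \<circ> cinv ?P ia) (at (coord ?P ia p)) (v l))"
    by (simp add: transition_times_circle[OF M] eqs pr1_def)
qed

lemma Omega_on_ds:
  assumes M: "smooth_manifold M"
  shows "ds \<in> Omega_on (times_circle M) V 1"
  unfolding Omega_on_def
proof (intro CollectI conjI allI ballI)
  let ?P = "times_circle M"
  show "alternating 1 (ds ia p)" for ia :: "'a \<times> real" and p :: "'b \<times> complex"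
    by (simp only: ds_pointwise alternating_dsnd)
  show "smooth_on (coord ?P ia ` (cdom ?P ia \<inter> V)) (\<lambda>x. ds ia (cinv ?P ia x) v)"
    for ia :: "'a \<times> real" and v :: "nat \<Rightarrow> 'c \<times> real"
    by (simp add: ds_def smooth_on_const)
  fix ia jb p and v :: "nat \<Rightarrow> 'c \<times> real" assume p: "p \<in> cdom ?P ia \<inter> cdom ?P jb \<inter> V"
  then show "ds ia p v = ds jb p (\<lambda>l. frechet_derivative (coord ?P jb \<circ> cinv ?P ia) (at (coord ?P ia p)) (v l))"
    using transition_times_circle[OF M, of p "fst ia" "snd ia" "fst jb" "snd jb"] by (simp add: ds_def)
qed

lemma open_image_times_circle:
  assumes "smooth_manifold M" "openin (mtop M) U"
  shows "open (coord (times_circle M) ia ` (cdom (times_circle M) ia \<inter> (U \<times> sphere 0 1)))"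
  using open_chart_image[OF assms] by (cases ia) (simp add: coord_image_times_circle open_Times)

section \<open>The exterior derivative in a chart\<close>

lemma frechet_derivative_local:
  assumes "open W" "x \<in> W" "\<And>y. y \<in> W \<Longrightarrow> f y = g y"
  shows "frechet_derivative f (at x) = frechet_derivative g (at x)"
proof -
  have "(f has_derivative D) (at x) \<longleftrightarrow> (g has_derivative D) (at x)" for D
    using has_derivative_transform_within_open[OF _ assms(1,2), of f D UNIV g]
      has_derivative_transform_within_open[OF _ assms(1,2), of g D UNIV f] assms(3) by auto
  then show ?thesis
    by (simp add: frechet_derivative_def)
qed

lemma ext_deriv_cong:
  assumes "open (coord N i ` cdom N i)" "p \<in> cdom N i" "\<And>p. p \<in> cdom N i \<Longrightarrow> \<eta> i p = \<theta> i p"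
  shows "ext_deriv N k \<eta> i p = ext_deriv N k \<theta> i p"
proof -
  have "\<eta> i (cinv N i x) = \<theta> i (cinv N i x)" if "x \<in> coord N i ` cdom N i" for x
    using assms(3) inv_into_into[OF that] by (simp add: cinv_def)
  then have "frechet_derivative (\<lambda>x. \<eta> i (cinv N i x) w) (at (coord N i p))
      = frechet_derivative (\<lambda>x. \<theta> i (cinv N i x) w) (at (coord N i p))" for w
    using assms(2) by (intro frechet_derivative_local[OF assms(1)]) auto
  then show ?thesis
    by (simp add: ext_deriv_def)
qed

text \<open>Differentiation of the components of a field in the coordinates of the chart \<open>i\<close>. The exterior
  derivative antisymmetrises \<open>comp_deriv N i p \<eta> x v\<close> in the direction \<open>x\<close> and the arguments \<open>v\<close>.\<close>

definition comp_diff :: "('i, 'm, 'e::euclidean_space) manifold \<Rightarrow> 'i \<Rightarrow> 'm \<Rightarrow> ('i, 'm, 'e) field \<Rightarrow> bool" where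
  "comp_diff N i p \<eta> \<longleftrightarrow> (\<forall>v. (\<lambda>x. \<eta> i (cinv N i x) v) differentiable at (coord N i p))"

definition comp_deriv :: "('i, 'm, 'e::euclidean_space) manifold \<Rightarrow> 'i \<Rightarrow> 'm \<Rightarrow> ('i, 'm, 'e) field \<Rightarrow> 'e \<Rightarrow> 'e mform" where
  "comp_deriv N i p \<eta> x v = frechet_derivative (\<lambda>x. \<eta> i (cinv N i x) v) (at (coord N i p)) x"

lemma ext_deriv_comp_deriv:
  "ext_deriv N k \<eta> i p v = (\<Sum>l\<le>k. (-1) ^ l * comp_deriv N i p \<eta> (v l) (\<lambda>j. if j < l then v j else v (Suc j)))"
  by (simp add: ext_deriv_def comp_deriv_def)

lemma comp_deriv_works:
  "comp_diff N i p \<eta> \<Longrightarrow> ((\<lambda>x. \<eta> i (cinv N i x) v) has_derivative (\<lambda>x. comp_deriv N i p \<eta> x v)) (at (coord N i p))"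
  unfolding comp_diff_def comp_deriv_def by (intro differentiable_has_derivative) blast

lemma comp_deriv_eq:
  assumes "\<And>v. ((\<lambda>x. \<eta> i (cinv N i x) v) has_derivative (\<lambda>x. D x v)) (at (coord N i p))"
  shows "comp_deriv N i p \<eta> = D"
  by (intro ext) (simp add: comp_deriv_def frechet_derivative_at[OF assms, symmetric])

lemma comp_diff_Omega:
  assumes "\<eta> \<in> Omega_on N U k" "p \<in> cdom N i \<inter> U"
  shows "comp_diff N i p \<eta>"
  unfolding comp_diff_def
proof
  fix v
  have "smooth_on (coord N i ` (cdom N i \<inter> U)) (\<lambda>x. \<eta> i (cinv N i x) v)"
    using assms(1) by (auto simp: Omega_on_def)
  then show "(\<lambda>x. \<eta> i (cinv N i x) v) differentiable at (coord N i p)"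
    using assms(2) by (intro smooth_on_differentiable) auto
qed

lemma comp_deriv_add:
  assumes "comp_diff N i p \<eta>" "comp_diff N i p \<theta>"
  shows comp_diff_add: "comp_diff N i p (\<eta> + \<theta>)"
    and "comp_deriv N i p (\<eta> + \<theta>) = (\<lambda>x v. comp_deriv N i p \<eta> x v + comp_deriv N i p \<theta> x v)"
proof -
  have *: "((\<lambda>x. (\<eta> + \<theta>) i (cinv N i x) v) has_derivative
      (\<lambda>x. comp_deriv N i p \<eta> x v + comp_deriv N i p \<theta> x v)) (at (coord N i p))" for v
    unfolding plus_fun_def by (intro has_derivative_add comp_deriv_works assms)
  show "comp_diff N i p (\<eta> + \<theta>)" unfolding comp_diff_def differentiable_def using * by blast
  show "comp_deriv N i p (\<eta> + \<theta>) = (\<lambda>x v. comp_deriv N i p \<eta> x v + comp_deriv N i p \<theta> x v)"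
    by (rule comp_deriv_eq) (rule *)
qed

lemma comp_deriv_fscale:
  assumes "comp_diff N i p \<eta>"
  shows comp_diff_fscale: "comp_diff N i p (r *\<^sub>F \<eta>)"
    and "comp_deriv N i p (r *\<^sub>F \<eta>) = (\<lambda>x v. r * comp_deriv N i p \<eta> x v)"
proof -
  have *: "((\<lambda>x. (r *\<^sub>F \<eta>) i (cinv N i x) v) has_derivative
      (\<lambda>x. r * comp_deriv N i p \<eta> x v)) (at (coord N i p))" for v
    unfolding fscale_def by (intro has_derivative_mult_right comp_deriv_works assms)
  show "comp_diff N i p (r *\<^sub>F \<eta>)" unfolding comp_diff_def differentiable_def using * by blast
  show "comp_deriv N i p (r *\<^sub>F \<eta>) = (\<lambda>x v. r * comp_deriv N i p \<eta> x v)"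
    by (rule comp_deriv_eq) (rule *)
qed

lemma ext_deriv_add:
  assumes "comp_diff N i p \<eta>" "comp_diff N i p \<theta>"
  shows "ext_deriv N k (\<eta> + \<theta>) i p v = ext_deriv N k \<eta> i p v + ext_deriv N k \<theta> i p v"
  by (simp add: ext_deriv_comp_deriv comp_deriv_add(2)[OF assms] sum.distrib distrib_left)

lemma ext_deriv_fscale:
  assumes "comp_diff N i p \<eta>"
  shows "ext_deriv N k (r *\<^sub>F \<eta>) i p v = r * ext_deriv N k \<eta> i p v"
  by (simp add: ext_deriv_comp_deriv comp_deriv_fscale(2)[OF assms] sum_distrib_left mult_ac)

lemma fdiff_eq: "\<eta> - \<theta> = \<eta> + (-1) *\<^sub>F (\<theta> :: ('i, 'm, 'e) field)"
  by (intro ext) (simp add: fscale_def)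

lemma ext_deriv_diff:
  assumes "comp_diff N i p \<eta>" "comp_diff N i p \<theta>"
  shows "ext_deriv N k (\<eta> - \<theta>) i p v = ext_deriv N k \<eta> i p v - ext_deriv N k \<theta> i p v"
  using ext_deriv_add[OF assms(1) comp_diff_fscale[OF assms(2)], of k "-1" v]
    ext_deriv_fscale[OF assms(2), of k "-1" v] by (simp add: fdiff_eq)

lemma comp_diff_diff:
  "comp_diff N i p \<eta> \<Longrightarrow> comp_diff N i p \<theta> \<Longrightarrow> comp_diff N i p (\<eta> - \<theta>)"
  unfolding fdiff_eq by (intro comp_diff_add comp_diff_fscale)

lemma comp_deriv_wedge:
  assumes \<eta>: "comp_diff N i p \<eta>" and \<theta>: "comp_diff N i p \<theta>" and p: "cinv N i (coord N i p) = p"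
  shows comp_diff_wedge: "comp_diff N i p (\<eta> \<and>\<^bsub>k,l\<^esub> \<theta>)"
    and "comp_deriv N i p (\<eta> \<and>\<^bsub>k,l\<^esub> \<theta>) =
      (\<lambda>x v. mwedge k l (comp_deriv N i p \<eta> x) (\<theta> i p) v + mwedge k l (\<eta> i p) (comp_deriv N i p \<theta> x) v)"
proof -
  have *: "((\<lambda>x. (\<eta> \<and>\<^bsub>k,l\<^esub> \<theta>) i (cinv N i x) v) has_derivative
      (\<lambda>x. mwedge k l (comp_deriv N i p \<eta> x) (\<theta> i p) v + mwedge k l (\<eta> i p) (comp_deriv N i p \<theta> x) v))
      (at (coord N i p))" for v
  proof -
    let ?P = "{\<pi>. \<pi> permutes {..<k + l}}"
    let ?t = "\<lambda>\<pi> a b. (of_int (sign \<pi>) / (fact k * fact l)) * (a (\<lambda>j. v (\<pi> j)) * b (\<lambda>j. v (\<pi> (k + j)))) :: real"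
    have eq: "mwedge k l a b v = (\<Sum>\<pi>\<in>?P. ?t \<pi> a b)" for a b :: "'c mform"
      by (simp add: mwedge_def sum_divide_distrib mult.assoc)
    have "((\<lambda>x. \<Sum>\<pi>\<in>?P. ?t \<pi> (\<eta> i (cinv N i x)) (\<theta> i (cinv N i x))) has_derivative
      (\<lambda>x. \<Sum>\<pi>\<in>?P. (of_int (sign \<pi>) / (fact k * fact l)) *
          (\<eta> i (cinv N i (coord N i p)) (\<lambda>j. v (\<pi> j)) * comp_deriv N i p \<theta> x (\<lambda>j. v (\<pi> (k + j)))
          + comp_deriv N i p \<eta> x (\<lambda>j. v (\<pi> j)) * \<theta> i (cinv N i (coord N i p)) (\<lambda>j. v (\<pi> (k + j))))))
      (at (coord N i p))"
      by (intro has_derivative_sum has_derivative_mult_right has_derivative_mult comp_deriv_works \<eta> \<theta>)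
    then show ?thesis
      unfolding wedge_def eq p by (simp add: sum.distrib distrib_left add.commute)
  qed
  show "comp_diff N i p (\<eta> \<and>\<^bsub>k,l\<^esub> \<theta>)" unfolding comp_diff_def differentiable_def using * by blast
  show "comp_deriv N i p (\<eta> \<and>\<^bsub>k,l\<^esub> \<theta>) =
      (\<lambda>x v. mwedge k l (comp_deriv N i p \<eta> x) (\<theta> i p) v + mwedge k l (\<eta> i p) (comp_deriv N i p \<theta> x) v)"
    by (rule comp_deriv_eq) (rule *)
qed

text \<open>The defining equations of an alternating form hold on the whole chart domain, so that they can be
  differentiated.\<close>

lemma alternating_comp_deriv:
  fixes M :: "('i, 'm, 'e::euclidean_space) manifold"
  assumes W: "open (coord M i ` cdom M i)" and p: "p \<in> cdom M i"
    and alt: "\<And>q. q \<in> cdom M i \<Longrightarrow> alternating k (\<eta> i q)" and diff: "comp_diff M i p \<eta>"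
  shows "alternating k (comp_deriv M i p \<eta> x)"
proof -
  let ?W = "coord M i ` cdom M i"
  have x0: "coord M i p \<in> ?W" using p by simp
  have alt': "alternating k (\<eta> i (cinv M i y))" if "y \<in> ?W" for y
    using alt inv_into_into[OF that] by (simp add: cinv_def)
  have local: "comp_deriv M i p \<eta> x v = frechet_derivative h (at (coord M i p)) x"
    if "\<And>y. y \<in> ?W \<Longrightarrow> \<eta> i (cinv M i y) v = h y" for v h
    unfolding comp_deriv_def using frechet_derivative_local[OF W x0 that] by simp
  show ?thesis
    unfolding alternating_def
  proof (intro conjI allI impI)
    fix v w :: "nat \<Rightarrow> 'e" assume "\<forall>j<k. v j = w j"
    then show "comp_deriv M i p \<eta> x v = comp_deriv M i p \<eta> x w"
      unfolding comp_deriv_def[of _ _ _ _ _ w] by (intro local alternating_cong[OF alt']) auto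
  next
    fix v :: "nat \<Rightarrow> 'e" and j assume j: "j < k"
    show "linear (\<lambda>y. comp_deriv M i p \<eta> x (v(j := y)))"
    proof (rule linearI)
      fix a b
      have "comp_deriv M i p \<eta> x (v(j := a + b)) = frechet_derivative
          (\<lambda>y. \<eta> i (cinv M i y) (v(j := a)) + \<eta> i (cinv M i y) (v(j := b))) (at (coord M i p)) x"
        by (rule local) (rule linear_add[OF alternating_linear[OF alt' j]])
      also have "\<dots> = comp_deriv M i p \<eta> x (v(j := a)) + comp_deriv M i p \<eta> x (v(j := b))"
        using frechet_derivative_at[OF has_derivative_add[OF comp_deriv_works[OF diff] comp_deriv_works[OF diff]]]
        by (simp add: fun_eq_iff)
      finally show "comp_deriv M i p \<eta> x (v(j := a + b))
          = comp_deriv M i p \<eta> x (v(j := a)) + comp_deriv M i p \<eta> x (v(j := b))" .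
    next
      fix r b
      have "comp_deriv M i p \<eta> x (v(j := r *\<^sub>R b)) = frechet_derivative
          (\<lambda>y. r * \<eta> i (cinv M i y) (v(j := b))) (at (coord M i p)) x"
        using linear_scale[OF alternating_linear[OF alt' j]] by (intro local) simp
      also have "\<dots> = r * comp_deriv M i p \<eta> x (v(j := b))"
        using frechet_derivative_at[OF has_derivative_mult_right[OF comp_deriv_works[OF diff]]]
        by (simp add: fun_eq_iff)
      finally show "comp_deriv M i p \<eta> x (v(j := r *\<^sub>R b)) = r *\<^sub>R comp_deriv M i p \<eta> x (v(j := b))"
        by simp
    qed
  next
    fix v :: "nat \<Rightarrow> 'e" and j l assume jl: "j < k" "l < k" "j \<noteq> l \<and> v j = v l"
    have "comp_deriv M i p \<eta> x v = frechet_derivative (\<lambda>_. 0) (at (coord M i p)) x"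
      using jl by (intro local) (auto intro: alternating_eq_0[OF alt'])
    then show "comp_deriv M i p \<eta> x v = 0"
      by (simp add: frechet_derivative_const)
  qed
qed

lemma ext_deriv_as_list:
  assumes "\<And>x. alternating k (comp_deriv N i p \<eta> x)"
  shows "ext_deriv N k \<eta> i p v = ext_deriv N k \<eta> i p ((!) (map v [0..<Suc k]))"
  unfolding ext_deriv_comp_deriv
proof (intro sum.cong refl arg_cong2[where f = "(*)"])
  fix l assume "l \<in> {..k}"
  then have "map v [0..<Suc k] ! l = v l"
    using nth_map[of l "[0..<Suc k]" v] by (simp del: upt_Suc)
  moreover have "comp_deriv N i p \<eta> (v l) (\<lambda>j. if j < l then v j else v (Suc j))
    = comp_deriv N i p \<eta> (v l) (\<lambda>j. if j < l then map v [0..<Suc k] ! j else map v [0..<Suc k] ! Suc j)"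
    by (rule alternating_cong[OF assms]) (simp del: upt_Suc)
  ultimately show "comp_deriv N i p \<eta> (v l) (\<lambda>j. if j < l then v j else v (Suc j))
    = comp_deriv N i p \<eta> (map v [0..<Suc k] ! l)
        (\<lambda>j. if j < l then map v [0..<Suc k] ! j else map v [0..<Suc k] ! Suc j)"
    by simp
qed

lemma ext_deriv_nth:
  assumes "\<And>x. alternating k (comp_deriv N i p \<eta> x)" and "length xs = Suc k"
  shows "ext_deriv N k \<eta> i p ((!) xs)
    = (\<Sum>l\<le>k. (-1) ^ l * comp_deriv N i p \<eta> (xs ! l) ((!) (take l xs @ drop (Suc l) xs)))"
  unfolding ext_deriv_comp_deriv
proof (intro sum.cong refl arg_cong2[where f = "(*)"])
  fix l assume "l \<in> {..k}"
  then show "comp_deriv N i p \<eta> (xs ! l) (\<lambda>j. if j < l then xs ! j else xs ! Suc j)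
      = comp_deriv N i p \<eta> (xs ! l) ((!) (take l xs @ drop (Suc l) xs))"
    using assms(2) by (intro alternating_cong[OF assms(1)]) (auto simp: nth_append min_def)
qed

lemma mwedge_zero: "mwedge k l (\<lambda>_. 0) b = (\<lambda>_. 0)" "mwedge k l a (\<lambda>_. 0) = (\<lambda>_. 0)"
  by (simp_all add: mwedge_def)

lemma comp_deriv_pr1:
  assumes M: "smooth_manifold M" and \<eta>: "comp_diff M i q \<eta>" and p: "(q, z) \<in> cdom (times_circle M) (i, a)"
  shows comp_diff_pr1: "comp_diff (times_circle M) (i, a) (q, z) (pr1 \<eta>)"
    and "comp_deriv (times_circle M) (i, a) (q, z) (pr1 \<eta>) = (\<lambda>x. pull_fst (comp_deriv M i q \<eta> (fst x)))"
proof -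
  let ?P = "times_circle M"
  obtain s where s: "z = cis s" "s \<in> {a<..<a + 2 * pi}" and q: "q \<in> cdom M i"
    using p by (auto simp: cdom_times_circle)
  let ?W = "coord M i ` cdom M i \<times> {a<..<a + 2 * pi}"
  have W: "open ?W"
    using open_chart_image[OF M openin_topspace, of i] cdom_subset[OF M, of i]
    by (intro open_Times) (simp_all add: Int_absorb2)
  have x0: "coord ?P (i, a) (q, z) = (coord M i q, s)"
    by (simp add: s(1) coord_times_circle[OF s(2)])
  have *: "((\<lambda>x. pr1 \<eta> (i, a) (cinv ?P (i, a) x) v) has_derivative
      (\<lambda>x. pull_fst (comp_deriv M i q \<eta> (fst x)) v)) (at (coord ?P (i, a) (q, z)))" for v
  proof (rule has_derivative_transform_within_open[OF _ W])
    have "((\<lambda>y. \<eta> i (cinv M i y) (\<lambda>j. fst (v j))) has_derivative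
        (\<lambda>y. comp_deriv M i q \<eta> y (\<lambda>j. fst (v j)))) (at (fst (coord M i q, s)))"
      using comp_deriv_works[OF \<eta>] by simp
    from has_derivative_compose[OF has_derivative_fst[OF has_derivative_ident] this]
    show "((\<lambda>x. \<eta> i (cinv M i (fst x)) (\<lambda>j. fst (v j))) has_derivative
        (\<lambda>x. pull_fst (comp_deriv M i q \<eta> (fst x)) v)) (at (coord ?P (i, a) (q, z)))"
      by (simp add: x0 pull_fst_def)
    show "coord ?P (i, a) (q, z) \<in> ?W"
      unfolding x0 using q s by simp
    fix x assume "x \<in> ?W"
    then show "\<eta> i (cinv M i (fst x)) (\<lambda>j. fst (v j)) = pr1 \<eta> (i, a) (cinv ?P (i, a) x) v"
      using cinv_times_circle[OF M, of "fst x" i "snd x" a] by (auto simp: pr1_def)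
  qed
  show "comp_diff ?P (i, a) (q, z) (pr1 \<eta>)"
    unfolding comp_diff_def differentiable_def using * by blast
  show "comp_deriv ?P (i, a) (q, z) (pr1 \<eta>) = (\<lambda>x. pull_fst (comp_deriv M i q \<eta> (fst x)))"
    by (rule comp_deriv_eq) (rule *)
qed

lemma ext_deriv_pr1:
  assumes M: "smooth_manifold M" and \<eta>: "comp_diff M i q \<eta>" and p: "(q, z) \<in> cdom (times_circle M) (i, a)"
  shows "ext_deriv (times_circle M) k (pr1 \<eta>) (i, a) (q, z) = pull_fst (ext_deriv M k \<eta> i q)"
  by (intro ext) (simp add: ext_deriv_comp_deriv comp_deriv_pr1(2)[OF assms] pull_fst_def if_distrib)

lemma comp_diff_ds: "comp_diff N ia p ds" and comp_deriv_ds: "comp_deriv N ia p ds = (\<lambda>_ _. 0)"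
  by (simp_all add: comp_diff_def comp_deriv_def ds_def frechet_derivative_const fun_eq_iff)

lemma comp_deriv_wedge_ds:
  assumes M: "smooth_manifold M" and \<eta>: "comp_diff M i q \<eta>" and p: "(q, z) \<in> cdom (times_circle M) (i, a)"
  shows comp_diff_wedge_ds: "comp_diff (times_circle M) (i, a) (q, z) (pr1 \<eta> \<and>\<^bsub>k,1\<^esub> ds)"
    and "comp_deriv (times_circle M) (i, a) (q, z) (pr1 \<eta> \<and>\<^bsub>k,1\<^esub> ds)
      = (\<lambda>x. mwedge k 1 (pull_fst (comp_deriv M i q \<eta> (fst x))) dsnd)"
proof -
  let ?P = "times_circle M"
  have inv: "cinv ?P (i, a) (coord ?P (i, a) (q, z)) = (q, z)"
    using p cinv_times_circle[OF M, of "coord M i q" i _ a]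
    by (auto simp: cdom_times_circle coord_times_circle cinv_coord[OF M])
  show "comp_diff ?P (i, a) (q, z) (pr1 \<eta> \<and>\<^bsub>k,1\<^esub> ds)"
    by (rule comp_diff_wedge[OF comp_diff_pr1[OF assms] comp_diff_ds inv])
  show "comp_deriv ?P (i, a) (q, z) (pr1 \<eta> \<and>\<^bsub>k,1\<^esub> ds)
      = (\<lambda>x. mwedge k 1 (pull_fst (comp_deriv M i q \<eta> (fst x))) dsnd)"
    unfolding comp_deriv_wedge(2)[OF comp_diff_pr1[OF assms] comp_diff_ds inv]
    by (simp add: comp_deriv_ds comp_deriv_pr1(2)[OF assms] mwedge_zero) (simp add: ds_pointwise)
qed

lemma sum_atMost_numerals:
  fixes h :: "nat \<Rightarrow> real"
  shows "(\<Sum>l\<le>2. h l) = h 0 + h 1 + h 2" "(\<Sum>l\<le>3. h l) = h 0 + h 1 + h 2 + h 3"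
    "(\<Sum>l\<le>4. h l) = h 0 + h 1 + h 2 + h 3 + h 4"
  by (simp_all add: numeral_eq_Suc)

context
  fixes M :: "('i, 'm, 'e::euclidean_space) manifold" and i q \<eta> k
  assumes M: "smooth_manifold M" and q: "q \<in> cdom M i" and \<eta>: "\<eta> \<in> Omega M k"
begin

lemma Omega_alternating: "alternating k (\<eta> i q)"
  using q \<eta> cdom_subset[OF M, of i] by (auto simp: Omega_on_def)

lemma Omega_comp_diff: "comp_diff M i q \<eta>"
  using q cdom_subset[OF M, of i] by (intro comp_diff_Omega[OF \<eta>]) auto

lemma Omega_alternating_comp_deriv: "alternating k (comp_deriv M i q \<eta> x)"
proof (rule alternating_comp_deriv[OF _ q _ Omega_comp_diff])
  show "open (coord M i ` cdom M i)"
    using open_chart_image[OF M openin_topspace, of i] cdom_subset[OF M, of i] by (simp add: Int_absorb2)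
  show "alternating k (\<eta> i r)" if "r \<in> cdom M i" for r
    using that \<eta> cdom_subset[OF M, of i] by (auto simp: Omega_on_def)
qed

lemma alternating_comp_deriv_wedge_ds:
  "alternating (k + 1) (mwedge k 1 (pull_fst (comp_deriv M i q \<eta> x)) dsnd)"
  by (intro alternating_mwedge alternating_pull_fst Omega_alternating_comp_deriv alternating_dsnd)

end

lemma ext_deriv_2_nth:
  assumes "smooth_manifold M" "q \<in> cdom M i" "\<eta> \<in> Omega M 2"
  shows "ext_deriv M 2 \<eta> i q ((!) [x, y, z])
    = comp_deriv M i q \<eta> x ((!) [y, z]) - comp_deriv M i q \<eta> y ((!) [x, z]) + comp_deriv M i q \<eta> z ((!) [x, y])"
  using ext_deriv_nth[OF Omega_alternating_comp_deriv[OF assms], of "[x, y, z]"]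
  by (simp add: sum_atMost_numerals numeral_eq_Suc)

lemma ext_deriv_3_nth:
  assumes "smooth_manifold M" "q \<in> cdom M i" "\<eta> \<in> Omega M 3"
  shows "ext_deriv M 3 \<eta> i q ((!) [x, y, z, w])
    = comp_deriv M i q \<eta> x ((!) [y, z, w]) - comp_deriv M i q \<eta> y ((!) [x, z, w])
      + comp_deriv M i q \<eta> z ((!) [x, y, w]) - comp_deriv M i q \<eta> w ((!) [x, y, z])"
  using ext_deriv_nth[OF Omega_alternating_comp_deriv[OF assms], of "[x, y, z, w]"]
  by (simp add: sum_atMost_numerals numeral_eq_Suc)

text \<open>The components of \<open>ds\<close> are constant, hence \<open>d(\<eta> \<and> ds) = d\<eta> \<and> ds\<close>. In the degrees that occur, two and
  three, both sides are expanded.\<close>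

lemma ext_deriv_wedge_ds_2:
  fixes M :: "('i, 'm, 'e::euclidean_space) manifold"
  assumes M: "smooth_manifold M" and \<eta>: "\<eta> \<in> Omega M 2" and p: "(q, z) \<in> cdom (times_circle M) (i, a)"
    and alt: "alternating 3 (ext_deriv M 2 \<eta> i q)"
  shows "ext_deriv (times_circle M) 3 (pr1 \<eta> \<and>\<^bsub>2,1\<^esub> ds) (i, a) (q, z)
    = mwedge 3 1 (pull_fst (ext_deriv M 2 \<eta> i q)) dsnd"
proof
  fix v :: "nat \<Rightarrow> 'e \<times> real"
  let ?P = "times_circle M"
  have q: "q \<in> cdom M i" using p by (simp add: cdom_times_circle)
  note D = comp_deriv_wedge_ds(2)[OF M Omega_comp_diff[OF M q \<eta>] p, of 2]
  have alt3: "alternating 3 (comp_deriv ?P (i, a) (q, z) (pr1 \<eta> \<and>\<^bsub>2,1\<^esub> ds) x)" for x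
    unfolding D using alternating_comp_deriv_wedge_ds[OF M q \<eta>, of "fst x"] by simp
  have altD: "alternating 2 (pull_fst (comp_deriv M i q \<eta> x))" for x
    by (intro alternating_pull_fst Omega_alternating_comp_deriv[OF M q \<eta>])
  have alt_right: "alternating 4 (mwedge 3 1 (pull_fst (ext_deriv M 2 \<eta> i q)) dsnd)"
    using alternating_mwedge[OF alternating_pull_fst[OF alt] alternating_dsnd] by simp
  have "map v [0..<4] = [v 0, v 1, v 2, v 3]"
    by (simp add: upt_rec numeral_eq_Suc)
  moreover have "ext_deriv ?P 3 (pr1 \<eta> \<and>\<^bsub>2,1\<^esub> ds) (i, a) (q, z) ((!) [x, y, z', w])
      = mwedge 3 1 (pull_fst (ext_deriv M 2 \<eta> i q)) dsnd ((!) [x, y, z', w])" for x y z' w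
  proof -
    have "ext_deriv ?P 3 (pr1 \<eta> \<and>\<^bsub>2,1\<^esub> ds) (i, a) (q, z) ((!) [x, y, z', w])
      = mwedge 2 1 (pull_fst (comp_deriv M i q \<eta> (fst x))) dsnd ((!) [y, z', w])
      - mwedge 2 1 (pull_fst (comp_deriv M i q \<eta> (fst y))) dsnd ((!) [x, z', w])
      + mwedge 2 1 (pull_fst (comp_deriv M i q \<eta> (fst z'))) dsnd ((!) [x, y, w])
      - mwedge 2 1 (pull_fst (comp_deriv M i q \<eta> (fst w))) dsnd ((!) [x, y, z'])"
      using ext_deriv_nth[OF alt3, of "[x, y, z', w]"] unfolding D
      by (simp add: sum_atMost_numerals numeral_eq_Suc)
    then show ?thesis
      unfolding mwedge_2_1[OF altD alternating_dsnd]
        mwedge_3_1[OF alternating_pull_fst[OF alt] alternating_dsnd]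
      by (simp add: pull_fst_nth[OF Omega_alternating_comp_deriv[OF M q \<eta>]] pull_fst_nth[OF alt]
          ext_deriv_2_nth[OF M q \<eta>] algebra_simps)
  qed
  ultimately show "ext_deriv ?P 3 (pr1 \<eta> \<and>\<^bsub>2,1\<^esub> ds) (i, a) (q, z) v
      = mwedge 3 1 (pull_fst (ext_deriv M 2 \<eta> i q)) dsnd v"
    using ext_deriv_as_list[OF alt3, of v] alternating_as_list[OF alt_right, of v] by simp
qed

lemma ext_deriv_wedge_ds_3:
  fixes M :: "('i, 'm, 'e::euclidean_space) manifold"
  assumes M: "smooth_manifold M" and \<eta>: "\<eta> \<in> Omega M 3" and p: "(q, z) \<in> cdom (times_circle M) (i, a)"
    and alt: "alternating 4 (ext_deriv M 3 \<eta> i q)"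
  shows "ext_deriv (times_circle M) 4 (pr1 \<eta> \<and>\<^bsub>3,1\<^esub> ds) (i, a) (q, z)
    = mwedge 4 1 (pull_fst (ext_deriv M 3 \<eta> i q)) dsnd"
proof
  fix v :: "nat \<Rightarrow> 'e \<times> real"
  let ?P = "times_circle M"
  have q: "q \<in> cdom M i" using p by (simp add: cdom_times_circle)
  note D = comp_deriv_wedge_ds(2)[OF M Omega_comp_diff[OF M q \<eta>] p, of 3]
  have alt4: "alternating 4 (comp_deriv ?P (i, a) (q, z) (pr1 \<eta> \<and>\<^bsub>3,1\<^esub> ds) x)" for x
    unfolding D using alternating_comp_deriv_wedge_ds[OF M q \<eta>, of "fst x"] by simp
  have altD: "alternating 3 (pull_fst (comp_deriv M i q \<eta> x))" for x
    by (intro alternating_pull_fst Omega_alternating_comp_deriv[OF M q \<eta>])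
  have alt_right: "alternating 5 (mwedge 4 1 (pull_fst (ext_deriv M 3 \<eta> i q)) dsnd)"
    using alternating_mwedge[OF alternating_pull_fst[OF alt] alternating_dsnd] by simp
  have "map v [0..<5] = [v 0, v 1, v 2, v 3, v 4]"
    by (simp add: upt_rec numeral_eq_Suc)
  moreover have "ext_deriv ?P 4 (pr1 \<eta> \<and>\<^bsub>3,1\<^esub> ds) (i, a) (q, z) ((!) [x, y, z', w, t])
      = mwedge 4 1 (pull_fst (ext_deriv M 3 \<eta> i q)) dsnd ((!) [x, y, z', w, t])" for x y z' w t
  proof -
    have "ext_deriv ?P 4 (pr1 \<eta> \<and>\<^bsub>3,1\<^esub> ds) (i, a) (q, z) ((!) [x, y, z', w, t])
      = mwedge 3 1 (pull_fst (comp_deriv M i q \<eta> (fst x))) dsnd ((!) [y, z', w, t])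
      - mwedge 3 1 (pull_fst (comp_deriv M i q \<eta> (fst y))) dsnd ((!) [x, z', w, t])
      + mwedge 3 1 (pull_fst (comp_deriv M i q \<eta> (fst z'))) dsnd ((!) [x, y, w, t])
      - mwedge 3 1 (pull_fst (comp_deriv M i q \<eta> (fst w))) dsnd ((!) [x, y, z', t])
      + mwedge 3 1 (pull_fst (comp_deriv M i q \<eta> (fst t))) dsnd ((!) [x, y, z', w])"
      using ext_deriv_nth[OF alt4, of "[x, y, z', w, t]"] unfolding D
      by (simp add: sum_atMost_numerals numeral_eq_Suc)
    then show ?thesis
      unfolding mwedge_3_1[OF altD alternating_dsnd]
        mwedge_4_1[OF alternating_pull_fst[OF alt] alternating_dsnd]
      by (simp add: pull_fst_nth[OF Omega_alternating_comp_deriv[OF M q \<eta>]] pull_fst_nth[OF alt]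
          ext_deriv_3_nth[OF M q \<eta>] algebra_simps)
  qed
  ultimately show "ext_deriv ?P 4 (pr1 \<eta> \<and>\<^bsub>3,1\<^esub> ds) (i, a) (q, z) v
      = mwedge 4 1 (pull_fst (ext_deriv M 3 \<eta> i q)) dsnd v"
    using ext_deriv_as_list[OF alt4, of v] alternating_as_list[OF alt_right, of v] by simp
qed

text \<open>This is \<open>d(\<eta> \<and> \<eta>) = 2 d\<eta> \<and> \<eta>\<close> in components: closedness eliminates the derivatives in the direction
  of the first vector of every triple, and then all terms cancel.\<close>

lemma ext_deriv_square_closed:
  assumes M: "smooth_manifold M" and \<eta>: "\<eta> \<in> Omega M 2" and q: "q \<in> cdom M i"
    and closed: "\<And>v. ext_deriv M 2 \<eta> i q v = 0"
  shows "ext_deriv M 4 (\<eta> \<and>\<^bsub>2,2\<^esub> \<eta>) i q v = 0"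
proof -
  note diff = Omega_comp_diff[OF M q \<eta>] and alt = Omega_alternating[OF M q \<eta>]
    and altD = Omega_alternating_comp_deriv[OF M q \<eta>]
  note D = comp_deriv_wedge(2)[OF diff diff cinv_coord[OF M q], of 2 2]
  have alt4: "alternating 4 (comp_deriv M i q (\<eta> \<and>\<^bsub>2,2\<^esub> \<eta>) x)" for x
    using alternating_add[OF alternating_mwedge[OF altD alt] alternating_mwedge[OF alt altD]]
    unfolding D by simp
  have closed': "comp_deriv M i q \<eta> x ((!) [y, z])
      = comp_deriv M i q \<eta> y ((!) [x, z]) - comp_deriv M i q \<eta> z ((!) [x, y])" for x y z
    using closed[of "(!) [x, y, z]"] unfolding ext_deriv_2_nth[OF M q \<eta>] by simp
  have "ext_deriv M 4 (\<eta> \<and>\<^bsub>2,2\<^esub> \<eta>) i q ((!) [x, y, z, w, t]) = 0" for x y z w t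
  proof -
    have "ext_deriv M 4 (\<eta> \<and>\<^bsub>2,2\<^esub> \<eta>) i q ((!) [x, y, z, w, t])
      = comp_deriv M i q (\<eta> \<and>\<^bsub>2,2\<^esub> \<eta>) x ((!) [y, z, w, t])
      - comp_deriv M i q (\<eta> \<and>\<^bsub>2,2\<^esub> \<eta>) y ((!) [x, z, w, t])
      + comp_deriv M i q (\<eta> \<and>\<^bsub>2,2\<^esub> \<eta>) z ((!) [x, y, w, t])
      - comp_deriv M i q (\<eta> \<and>\<^bsub>2,2\<^esub> \<eta>) w ((!) [x, y, z, t])
      + comp_deriv M i q (\<eta> \<and>\<^bsub>2,2\<^esub> \<eta>) t ((!) [x, y, z, w])"
      using ext_deriv_nth[OF alt4, of "[x, y, z, w, t]"]
      by (simp add: sum_atMost_numerals numeral_eq_Suc)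
    also have "\<dots> = 0"
      unfolding D mwedge_2_2[OF altD alt] mwedge_2_2[OF alt altD]
      unfolding closed'[of x y z] closed'[of x y w] closed'[of x y t] closed'[of x z w] closed'[of x z t]
        closed'[of x w t] closed'[of y z w] closed'[of y z t] closed'[of y w t] closed'[of z w t]
      by (simp add: algebra_simps)
    finally show ?thesis .
  qed
  moreover have "map v [0..<5] = [v 0, v 1, v 2, v 3, v 4]"
    by (simp add: upt_rec numeral_eq_Suc)
  ultimately show ?thesis
    using ext_deriv_as_list[OF alt4, of v] by simp
qed

section \<open>Pointwise consequences of closedness\<close>

lemma mhodge_add: "mhodge g vol k (\<lambda>v. a v + b v) = (\<lambda>v. mhodge g vol k a v + mhodge g vol k b v)"
  by (simp add: mhodge_def Let_def sum.distrib add_divide_distrib distrib_right)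

lemma mhodge_scale: "mhodge g vol k (\<lambda>v. r * a v) = (\<lambda>v. r * mhodge g vol k a v)"
  by (simp add: mhodge_def Let_def sum_distrib_left mult.assoc)

lemma mhodge_zero: "mhodge g vol k (\<lambda>v. 0) = (\<lambda>v. 0)"
  by (simp add: mhodge_def Let_def)

lemma mwedge_add_left: "mwedge k l (\<lambda>v. a v + a' v) b v = mwedge k l a b v + mwedge k l a' b v"
  by (simp add: mwedge_def sum.distrib add_divide_distrib distrib_right distrib_left)

lemma mwedge_add_right: "mwedge k l a (\<lambda>v. b v + b' v) v = mwedge k l a b v + mwedge k l a b' v"
  by (simp add: mwedge_def sum.distrib add_divide_distrib distrib_left)

lemma mwedge_scale_left: "mwedge k l (\<lambda>v. r * a v) b v = r * mwedge k l a b v"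
  by (simp add: mwedge_def sum_distrib_left mult_ac)

lemma mwedge_scale_right: "mwedge k l a (\<lambda>v. r * b v) v = r * mwedge k l a b v"
  by (simp add: mwedge_def sum_distrib_left mult_ac)

lemma mwedge_diff_left: "mwedge k l (\<lambda>v. a v - a' v) b v = mwedge k l a b v - mwedge k l a' b v"
  using mwedge_add_left[of k l a "\<lambda>v. - 1 * a' v" b v] mwedge_scale_left[of k l "-1" a' b v] by simp

lemma mwedge_diff_right: "mwedge k l a (\<lambda>v. b v - b' v) v = mwedge k l a b v - mwedge k l a b' v"
  using mwedge_add_right[of k l a b "\<lambda>v. - 1 * b' v" v] mwedge_scale_right[of k l a "-1" b' v] by simp

lemma su3_vol_omega: "su3_omega \<eta> = su3_omega \<theta> \<Longrightarrow> su3_vol \<eta> = su3_vol \<theta>"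
  by (simp add: su3_vol_def)

context su3_frame
begin

text \<open>Exchanging two vectors with the four complementary ones is an even permutation.\<close>

lemma star_star_2:
  assumes \<sigma>: "alternating 2 \<sigma>"
  shows "mhodge g vol 4 (mhodge g vol 2 \<sigma>) = \<sigma>"
proof (rule alternating_eq_frame[OF _ \<sigma> span])
  have star: "alternating 4 (mhodge g vol 2 \<sigma>)"
    using alternating_mhodge[of vol 2 g \<sigma>] alternating_vol by (simp add: dim)
  show "alternating 2 (mhodge g vol 4 (mhodge g vol 2 \<sigma>))"
    using alternating_mhodge[of vol 4 g "mhodge g vol 2 \<sigma>"] alternating_vol by (simp add: dim)
  fix I :: "nat list" assume I: "length I = 2" "sorted_wrt (<) I" "set I \<subseteq> {..<6}"
  then have "distinct I"
    by (simp add: strict_sorted_iff)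
  from complementary_list[OF this I(3)] obtain J
    where J: "distinct (J @ I)" "set (J @ I) = {..<6}" "length J = 6 - length I" by blast
  have J4: "length J = 4"
    using J(3) I(1) by simp
  have IJ: "distinct (I @ J)" "set (I @ J) = {..<6}"
    using J(1,2) by (simp_all add: Un_commute Int_commute)
  obtain a b where ab: "I = [a, b]"
    using I(1) by (auto simp: length_lists)
  have "vol ((!) (map u (I @ J))) = vol ((!) (map u (J @ I)))"
  proof -
    have "vol ((!) (u a # u b # map u J)) = - vol ((!) (u b # map u J @ [u a]))"
      using alternating_move[OF alternating_vol, of "[]" "u a" "u b # map u J" "[]"] J4 by simp
    also have "vol ((!) (u b # map u J @ [u a])) = vol ((!) (map u J @ [u b, u a]))"
      using alternating_move[OF alternating_vol, of "[]" "u b" "map u J" "[u a]"] J4 by simp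
    also have "vol ((!) (map u J @ [u b, u a])) = - vol ((!) (map u J @ [u a, u b]))"
      using alternating_move[OF alternating_vol, of "map u J" "u b" "[u a]" "[]"] J4 by simp
    finally show ?thesis by (simp add: ab)
  qed
  then have "list_sign (I @ J) = list_sign (J @ I)"
    unfolding vol_permuted[OF IJ] vol_permuted[OF J(1,2)] .
  then show "mhodge g vol 4 (mhodge g vol 2 \<sigma>) ((!) (map u I)) = \<sigma> ((!) (map u I))"
    using star_frame[OF star J(1,2) J4] star_frame[OF \<sigma> IJ I(1)] list_sign_square[of "J @ I"] by simp
qed

text \<open>Closedness at a point. The vanishing of \<open>d\<omega>\<close> kills the torsion functions. Then \<open>d\<rho> = 0\<close> equates
  \<open>\<pi>\<^sub>1 \<and> \<rho>\<close> with \<open>\<tau> \<and> \<omega>\<close>, which lie in different irreducible components.\<close>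

lemma closed_torsion:
  fixes s0 q0 :: real
  assumes ab: "\<alpha>\<^sup>2 + \<beta>\<^sup>2 = 1"
    and alt: "alternating 1 p1" "alternating 1 n1" "alternating 3 n3" "alternating 2 p2" "alternating 2 s2"
    and d\<omega>: "\<And>v. d\<omega> v = (- 3/2) * (s0 * \<psi>p v) + (3/2) * (q0 * \<psi>m v) + mwedge 1 2 n1 \<omega> v + n3 v"
    and d\<psi>p: "\<And>v. d\<psi>p v = q0 * mwedge 2 2 \<omega> \<omega> v + mwedge 1 3 p1 \<psi>p v - mwedge 2 2 p2 \<omega> v"
    and d\<psi>m: "\<And>v. d\<psi>m v = s0 * mwedge 2 2 \<omega> \<omega> v + mwedge 1 3 p1 \<psi>m v - mwedge 2 2 s2 \<omega> v"
    and n3: "\<And>v. mwedge 3 3 n3 \<psi>p v = 0" "\<And>v. mwedge 3 3 n3 \<psi>m v = 0"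
    and star: "\<And>v. mhodge g vol 2 p2 v = - mwedge 2 2 p2 \<omega> v" "\<And>v. mhodge g vol 2 s2 v = - mwedge 2 2 s2 \<omega> v"
    and closed: "\<And>v. d\<omega> v = 0" "\<And>v. \<alpha> * d\<psi>p v - \<beta> * d\<psi>m v = 0"
  shows "\<alpha> * p2 v - \<beta> * s2 v = 0"
    and "\<alpha> * d\<psi>m v + \<beta> * d\<psi>p v = mhodge g vol 2 (\<lambda>v. \<alpha> * s2 v + \<beta> * p2 v) v"
proof -
  have s0: "s0 = 0" and q0: "q0 = 0"
    using torsion_functions_vanish[OF alt(2,3), of s0 q0] d\<omega> closed(1) n3 by simp_all
  define \<eta> where "\<eta> = rotate_coframe \<alpha> \<beta> \<theta>"
  define \<tau> where "\<tau> = (\<lambda>v. \<alpha> * p2 v - \<beta> * s2 v)"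
  note rotate = su3_frame_rotate[OF su3_frame_axioms ab, folded \<eta>_def]
  interpret rot: su3_frame \<eta> "u(0 := \<alpha> *\<^sub>R u 0 - \<beta> *\<^sub>R u 1, 1 := \<beta> *\<^sub>R u 0 + \<alpha> *\<^sub>R u 1)"
    by (rule rotate(1))
  have "mwedge 1 3 p1 rot.\<psi>p v = mwedge 2 2 \<tau> rot.\<omega> v" for v
    using closed(2)[of v] unfolding d\<psi>p d\<psi>m s0 q0 rotate(2,3) \<tau>_def
    by (simp only: mwedge_diff_left mwedge_diff_right mwedge_scale_left mwedge_scale_right)
      (simp add: algebra_simps)
  moreover have "mhodge rot.g rot.vol 2 \<tau> v = - mwedge 2 2 \<tau> rot.\<omega> v" for v
  proof -
    have "\<tau> = (\<lambda>v. \<alpha> * p2 v + (- \<beta>) * s2 v)"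
      by (simp add: \<tau>_def)
    then show ?thesis
      unfolding rotate(2,5) su3_vol_omega[OF rotate(2)]
      by (simp only: mhodge_add mhodge_scale mwedge_add_left mwedge_scale_left star)
  qed
  moreover have "alternating 2 \<tau>"
    unfolding \<tau>_def by (intro alternating_diff alternating_scale alt)
  ultimately have p1: "p1 v = 0" and \<tau>: "\<tau> v = 0" for v
    using rot.torsion_forms_vanish[OF alt(1)] by blast+
  show "\<alpha> * p2 v - \<beta> * s2 v = 0"
    using \<tau>[of v] by (simp add: \<tau>_def)
  have "p1 = (\<lambda>_. 0)"
    using p1 by blast
  then show "\<alpha> * d\<psi>m v + \<beta> * d\<psi>p v = mhodge g vol 2 (\<lambda>v. \<alpha> * s2 v + \<beta> * p2 v) v"
    by (simp add: d\<psi>p d\<psi>m s0 q0 mwedge_zero mhodge_add mhodge_scale star)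
qed

text \<open>The star of the form \<open>f \<omega> \<and> ds + \<rho>\<close> is computed in the rotated coframe, in which \<open>\<rho>\<close> is the real part of
  the complex volume form.\<close>

lemma star_warped:
  fixes f :: real
  defines "G \<equiv> \<lambda>x y. g (fst x) (fst y) + f\<^sup>2 * (snd x * snd y)"
    and "V \<equiv> \<lambda>v. f * mwedge 6 1 (pull_fst vol) dsnd v"
  assumes ab: "\<alpha>\<^sup>2 + \<beta>\<^sup>2 = 1" and f: "f \<noteq> 0"
  shows star_warped_form: "mhodge G V 3 (\<lambda>v. f * mwedge 2 1 (pull_fst \<omega>) dsnd v
        + pull_fst (\<lambda>v. \<alpha> * \<psi>p v - \<beta> * \<psi>m v) v)
      = (\<lambda>v. 1 / 2 * pull_fst (mwedge 2 2 \<omega> \<omega>) v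
        + f * mwedge 3 1 (pull_fst (\<lambda>v. \<alpha> * \<psi>m v + \<beta> * \<psi>p v)) dsnd v)"
    and star_warped_4: "alternating 2 \<sigma> \<Longrightarrow>
      mhodge G V 5 (\<lambda>v. f * mwedge 4 1 (pull_fst (mhodge g vol 2 \<sigma>)) dsnd v) = pull_fst \<sigma>"
proof -
  define \<eta> where "\<eta> = rotate_coframe \<alpha> \<beta> \<theta>"
  note rotate = su3_frame_rotate[OF su3_frame_axioms ab, folded \<eta>_def]
  interpret rot: su3_frame \<eta> "u(0 := \<alpha> *\<^sub>R u 0 - \<beta> *\<^sub>R u 1, 1 := \<beta> *\<^sub>R u 0 + \<alpha> *\<^sub>R u 1)"
    by (rule rotate(1))
  have vol6: "alternating (DIM('e)) vol"
    using alternating_vol by (simp add: dim)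
  note warped = mhodge_warped[OF metric_bilinear metric_sym frame _ vol6 f, unfolded dim, folded G_def V_def]
  have "mhodge g vol 3 rot.\<psi>p = rot.\<psi>m"
    using rot.star_psip unfolding rotate(5) su3_vol_omega[OF rotate(2)] .
  then have base: "mhodge G V 3 (pull_fst rot.\<psi>p) = (\<lambda>v. f * mwedge 3 1 (pull_fst rot.\<psi>m) dsnd v)"
    using warped(1)[OF rot.alternating_psip] by simp
  have fibre: "mhodge G V 3 (\<lambda>v. f * mwedge 2 1 (pull_fst \<omega>) dsnd v) = pull_fst (\<lambda>v. 1 / 2 * mwedge 2 2 \<omega> \<omega> v)"
    using warped(2)[OF alternating_omega] by (simp add: star_omega)
  show "mhodge G V 3 (\<lambda>v. f * mwedge 2 1 (pull_fst \<omega>) dsnd v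
        + pull_fst (\<lambda>v. \<alpha> * \<psi>p v - \<beta> * \<psi>m v) v)
      = (\<lambda>v. 1 / 2 * pull_fst (mwedge 2 2 \<omega> \<omega>) v
        + f * mwedge 3 1 (pull_fst (\<lambda>v. \<alpha> * \<psi>m v + \<beta> * \<psi>p v)) dsnd v)"
    unfolding mhodge_add rotate(3,4)[symmetric] base fibre by (simp add: pull_fst_def)
  show "mhodge G V 5 (\<lambda>v. f * mwedge 4 1 (pull_fst (mhodge g vol 2 \<sigma>)) dsnd v) = pull_fst \<sigma>"
    if \<sigma>: "alternating 2 \<sigma>"
  proof -
    have "alternating 4 (mhodge g vol 2 \<sigma>)"
      using alternating_mhodge[OF vol6, of 2] by (simp add: dim)
    from warped(2)[OF this] show ?thesis
      by (simp add: star_star_2[OF \<sigma>])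
  qed
qed

end

section \<open>The warped G2-coframe\<close>

lemma mwedge_pull_fst: "mwedge k l (pull_fst a) (pull_fst b) = pull_fst (mwedge k l a b)"
  by (simp add: mwedge_def pull_fst_def)

lemma cmon_pull_fst: "cmon (\<lambda>k. pull_fst (\<theta> k)) ks = pull_fst (cmon \<theta> ks)"
  by (induction ks) (simp_all add: cmon.simps(2) mwedge_pull_fst, simp add: pull_fst_def)

lemma cmon_cong: "(\<And>k. k \<in> set ks \<Longrightarrow> \<theta> k = \<eta> k) \<Longrightarrow> cmon \<theta> ks = cmon \<eta> ks"
  by (induction ks) (simp_all add: cmon.simps(2))

lemma contract_cmon_zero:
  assumes "\<And>k. k \<in> set ks \<Longrightarrow> alternating 1 (\<theta> k)" "\<And>k. k \<in> set ks \<Longrightarrow> \<theta> k ((!) [x]) = 0" "ks \<noteq> []"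
  shows "contract x (cmon \<theta> ks) = (\<lambda>_. 0)"
  using assms
proof (induction ks)
  case (Cons k ks)
  note IH = Cons.IH and prems = Cons.prems
  have k: "alternating (Suc 0) (\<theta> k)" "\<theta> k ((!) [x]) = 0"
    using prems by auto
  have "contract x (\<theta> k) v = 0" for v
    using alternating_cong[OF k(1), of "case_nat x v" "(!) [x]"] k(2) by (simp add: contract_def)
  then have zero: "contract x (\<theta> k) = (\<lambda>_. 0)"
    by blast
  have alt: "alternating (length ks) (cmon \<theta> ks)"
    using prems by (intro alternating_cmon) auto
  show ?case
  proof (cases ks)
    case Nil
    have "cmon \<theta> [k] = \<theta> k"
      using cmon_1[of "{k}" \<theta> k] prems by simp
    then show ?thesis using zero by (simp add: Nil)
  next
    case (Cons j js)
    then have n: "length ks = Suc (length js)" by simp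
    have "contract x (cmon \<theta> ks) = (\<lambda>_. 0)"
      using IH prems Cons by simp
    then have "contract x (cmon \<theta> (k # ks)) v = 0" for v
    proof -
      have "contract x (cmon \<theta> (k # ks)) v
          = mwedge (Suc 0) (Suc (length js)) (\<theta> k) (cmon \<theta> ks) (case_nat x v)"
        by (simp add: contract_def cmon.simps(2) n)
      also have "\<dots> = 0"
        using mwedge_Suc_Suc[OF k(1) alt[unfolded n], of x v] \<open>contract x (cmon \<theta> ks) = _\<close>
        by (simp add: zero mwedge_zero)
      finally show ?thesis .
    qed
    then show ?thesis by blast
  qed
qed simp

lemma cmon_dual_frame:
  assumes "\<And>k. k \<in> set ks \<Longrightarrow> alternating 1 (\<theta> k)" "distinct ks"
    and "\<And>k l. k \<in> set ks \<Longrightarrow> l \<in> set ks \<Longrightarrow> \<theta> k ((!) [w l]) = (if k = l then 1 else 0)"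
  shows "cmon \<theta> ks ((!) (map w ks)) = 1"
  using assms
proof (induction ks)
  case Nil
  then show ?case by simp
next
  case (Cons k ks)
  note IH = Cons.IH and prems = Cons.prems
  have k: "alternating (Suc 0) (\<theta> k)"
    using prems(1)[of k] by simp
  have alt: "alternating (length ks) (cmon \<theta> ks)"
    using prems by (intro alternating_cmon) auto
  show ?case
  proof (cases ks)
    case Nil
    have "cmon \<theta> [k] = \<theta> k"
      using cmon_1[of "{k}" \<theta> k] prems by simp
    then show ?thesis using prems by (simp add: Nil)
  next
    case (Cons j js)
    then have n: "length ks = Suc (length js)" by simp
    have "contract (w k) (cmon \<theta> ks) = (\<lambda>_. 0)"
      using prems Cons by (intro contract_cmon_zero) auto
    then show ?thesis
      using mwedge_Cons[OF k alt[unfolded n], of "w k" "map w ks"] IH prems n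
        mwedge_0_left_nth[OF alternating_contract[OF k] alt, of "w k" "map w ks"]
      by (simp add: cmon.simps(2) mwedge_zero contract_nth)
  qed
qed

text \<open>The \<open>G2\<close>-coframe of the warped form: the rotated \<open>SU(3)\<close>-coframe, completed by \<open>f ds\<close>.\<close>

definition warped_coframe :: "real \<Rightarrow> (nat \<Rightarrow> 'e mform) \<Rightarrow> nat \<Rightarrow> ('e \<times> real) mform" where
  "warped_coframe f \<eta> k = (if k = 7 then (\<lambda>v. f * dsnd v) else pull_fst (\<eta> k))"

context su3_frame
begin

lemma alternating_warped_coframe: "k \<in> {1..7} \<Longrightarrow> alternating 1 (warped_coframe f \<theta> k)"
  using \<theta>[of k] alternating_scale[OF alternating_dsnd, of f]
  by (auto simp: warped_coframe_def intro!: alternating_pull_fst)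

lemma cmon_warped_coframe_base:
  "set ks \<subseteq> {1..6} \<Longrightarrow> cmon (warped_coframe f \<theta>) ks = pull_fst (cmon \<theta> ks)"
  unfolding cmon_pull_fst[symmetric] by (rule cmon_cong) (auto simp: warped_coframe_def)

lemma cmon_warped_coframe_fibre:
  assumes "a \<in> {1..6}" "b \<in> {1..6}"
  shows "cmon (warped_coframe f \<theta>) [a, b, 7] = (\<lambda>v. f * mwedge 2 1 (pull_fst (cmon \<theta> [a, b])) dsnd v)"
proof (rule alternating_ext)
  have ab: "alternating 2 (cmon \<theta> [a, b])"
    using assms \<theta> by (intro alternating_cmon_2[where K = "{1..6}"])
  show "alternating 3 (cmon (warped_coframe f \<theta>) [a, b, 7])"
    by (rule alternating_cmon_3[where K = "{1..7}"], rule alternating_warped_coframe) (use assms in auto)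
  show "alternating 3 (\<lambda>v. f * mwedge 2 1 (pull_fst (cmon \<theta> [a, b])) dsnd v)"
    using alternating_mwedge[OF alternating_pull_fst[OF ab] alternating_dsnd]
    by (intro alternating_scale) simp
  fix xs :: "('e \<times> real) list" assume "length xs = 3"
  then obtain x y z where xs: "xs = [x, y, z]" by (auto simp: length_lists)
  have neq: "a \<noteq> 7" "b \<noteq> 7" using assms by auto
  have expand: "cmon (warped_coframe f \<theta>) [a, b, 7] ((!) [x, y, z])
    = warped_coframe f \<theta> a ((!) [x]) * (warped_coframe f \<theta> b ((!) [y]) * warped_coframe f \<theta> 7 ((!) [z])
        - warped_coframe f \<theta> b ((!) [z]) * warped_coframe f \<theta> 7 ((!) [y]))
    - warped_coframe f \<theta> a ((!) [y]) * (warped_coframe f \<theta> b ((!) [x]) * warped_coframe f \<theta> 7 ((!) [z])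
        - warped_coframe f \<theta> b ((!) [z]) * warped_coframe f \<theta> 7 ((!) [x]))
    + warped_coframe f \<theta> a ((!) [z]) * (warped_coframe f \<theta> b ((!) [x]) * warped_coframe f \<theta> 7 ((!) [y])
        - warped_coframe f \<theta> b ((!) [y]) * warped_coframe f \<theta> 7 ((!) [x]))"
    by (rule cmon_3[where K = "{1..7}"], rule alternating_warped_coframe) (use assms in auto)
  have seven: "warped_coframe f \<theta> 7 ((!) [x]) = f * snd x" for x
    by (simp add: warped_coframe_def)
  have six: "warped_coframe f \<theta> a ((!) [x]) = \<theta> a ((!) [fst x])"
    "warped_coframe f \<theta> b ((!) [x]) = \<theta> b ((!) [fst x])" for x
    using neq pull_fst_nth[OF \<theta>[OF assms(1)], of "[x]"] pull_fst_nth[OF \<theta>[OF assms(2)], of "[x]"]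
    by (simp_all add: warped_coframe_def)
  have pull: "pull_fst (cmon \<theta> [a, b]) ((!) [x, y])
      = \<theta> a ((!) [fst x]) * \<theta> b ((!) [fst y]) - \<theta> a ((!) [fst y]) * \<theta> b ((!) [fst x])" for x y
    using pull_fst_nth[OF ab, of "[x, y]"] cmon_2'[OF assms] by simp
  show "cmon (warped_coframe f \<theta>) [a, b, 7] ((!) xs)
      = f * mwedge 2 1 (pull_fst (cmon \<theta> [a, b])) dsnd ((!) xs)"
    unfolding xs expand seven six mwedge_2_1[OF alternating_pull_fst[OF ab] alternating_dsnd] pull dsnd_nth
    by (simp add: algebra_simps)
qed

lemma warped_coframe_form:
  "f * mwedge 2 1 (pull_fst \<omega>) dsnd v + pull_fst \<psi>p v
    = (cmon (warped_coframe f \<theta>) [1,2,7] + cmon (warped_coframe f \<theta>) [3,4,7]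
      + cmon (warped_coframe f \<theta>) [5,6,7] + cmon (warped_coframe f \<theta>) [1,3,5]
      - cmon (warped_coframe f \<theta>) [1,4,6] - cmon (warped_coframe f \<theta>) [2,3,6]
      - cmon (warped_coframe f \<theta>) [2,4,5]) v"
proof -
  have "pull_fst \<omega> = (\<lambda>v. (pull_fst (cmon \<theta> [1,2]) v + pull_fst (cmon \<theta> [3,4]) v) + pull_fst (cmon \<theta> [5,6]) v)"
    by (intro ext) (simp add: pull_fst_def su3_omega_def)
  then have "f * mwedge 2 1 (pull_fst \<omega>) dsnd v = cmon (warped_coframe f \<theta>) [1,2,7] v
      + cmon (warped_coframe f \<theta>) [3,4,7] v + cmon (warped_coframe f \<theta>) [5,6,7] v"
    by (simp only: mwedge_add_left) (simp add: cmon_warped_coframe_fibre distrib_left)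
  moreover have "pull_fst \<psi>p v = cmon (warped_coframe f \<theta>) [1,3,5] v - cmon (warped_coframe f \<theta>) [1,4,6] v
      - cmon (warped_coframe f \<theta>) [2,3,6] v - cmon (warped_coframe f \<theta>) [2,4,5] v"
    by (simp add: cmon_warped_coframe_base) (simp add: pull_fst_def su3_psip_def)
  ultimately show ?thesis by simp
qed

text \<open>Two forms of top degree agree as soon as they agree on one frame.\<close>

lemma warped_coframe_vol:
  assumes f: "f \<noteq> 0"
  shows "(\<lambda>v. f * mwedge 6 1 (pull_fst vol) dsnd v) = cmon (warped_coframe f \<theta>) [1,2,3,4,5,6,7]"
proof -
  let ?G = "\<lambda>x y. g (fst x) (fst y) + f\<^sup>2 * (snd x * snd y)"
  define w :: "nat \<Rightarrow> 'e \<times> real" where "w j = (if j < 6 then (u j, 0) else (0, 1 / f))" for j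
  have "orthonormal_frame ?G w"
    using orthonormal_warped_frame[OF metric_bilinear frame f] unfolding dim w_def[abs_def] .
  from orthonormal_frame_expand[OF bilinear_warped_metric[OF metric_bilinear frame f] this]
  have span: "x = (\<Sum>i<7. ?G x (w i) *\<^sub>R w i)" for x
    by (simp add: dim)
  have map_w: "map w [0..<7] = map w [0,1,2,3,4,5] @ [w 6]"
    by (simp add: upt_rec numeral_eq_Suc)
  show ?thesis
  proof (rule alternating_eq_frame[OF _ _ span])
    show "alternating 7 (\<lambda>v. f * mwedge 6 1 (pull_fst vol) dsnd v)"
      using alternating_mwedge[OF alternating_pull_fst[OF alternating_vol] alternating_dsnd]
      by (intro alternating_scale) simp
    show "alternating 7 (cmon (warped_coframe f \<theta>) [1,2,3,4,5,6,7])"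
    proof -
      have "alternating (length [1,2,3,4,5,6,7 :: nat]) (cmon (warped_coframe f \<theta>) [1,2,3,4,5,6,7])"
        by (rule alternating_cmon, rule alternating_warped_coframe) auto
      then show ?thesis by (simp add: numeral_eq_Suc)
    qed
    fix J :: "nat list" assume J: "length J = 7" "sorted_wrt (<) J" "set J \<subseteq> {..<7}"
    have "set J = {..<7}"
      using J by (intro card_subset_eq) (auto simp: strict_sorted_iff distinct_card)
    then have J: "J = [0..<7]"
      using J(2) by (intro sorted_distinct_set_unique) (auto simp: strict_sorted_iff lessThan_atLeast0)
    have "f * mwedge 6 1 (pull_fst vol) dsnd ((!) (map w J)) = 1"
    proof -
      have "mwedge 6 1 (pull_fst vol) dsnd ((!) (map w [0,1,2,3,4,5] @ [w 6]))
          = pull_fst vol ((!) (map w [0,1,2,3,4,5])) * dsnd ((!) [w 6])"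
        by (rule mwedge_snoc[OF alternating_pull_fst[OF alternating_vol] alternating_dsnd])
          (auto simp: w_def)
      also have "pull_fst vol ((!) (map w [0,1,2,3,4,5])) = 1"
        using pull_fst_nth[OF alternating_vol, of "map w [0,1,2,3,4,5]"] vol_frame by (simp add: w_def)
      finally show ?thesis
        using f by (simp add: J map_w w_def)
    qed
    moreover have "cmon (warped_coframe f \<theta>) [1,2,3,4,5,6,7] ((!) (map w J)) = 1"
    proof -
      have "cmon (warped_coframe f \<theta>) [1,2,3,4,5,6,7] ((!) (map (\<lambda>k. w (k - 1)) [1,2,3,4,5,6,7])) = 1"
      proof (rule cmon_dual_frame)
        fix k l :: nat assume "k \<in> set [1,2,3,4,5,6,7]" "l \<in> set [1,2,3,4,5,6,7]"
        then have kl: "k \<in> {1..7}" "l \<in> {1..7}" by auto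
        show "warped_coframe f \<theta> k ((!) [w (l - 1)]) = (if k = l then 1 else 0)"
        proof (cases "k = 7")
          case True
          then show ?thesis
            using kl f by (auto simp: warped_coframe_def w_def)
        next
          case False
          then have k: "k \<in> {1..6}" using kl by auto
          have "warped_coframe f \<theta> k ((!) [w (l - 1)]) = \<theta> k ((!) [fst (w (l - 1))])"
            using False pull_fst_nth[OF \<theta>[OF k], of "[w (l - 1)]"] by (simp add: warped_coframe_def)
          moreover have "\<theta> k ((!) [0]) = 0"
            by (rule alternating_zero_arg[OF \<theta>[OF k], of 0]) simp_all
          ultimately show ?thesis
            using dual[OF k, of "l - 1"] kl False by (auto simp: w_def)
        qed
      next
        fix k :: nat assume "k \<in> set [1,2,3,4,5,6,7]"
        then show "alternating 1 (warped_coframe f \<theta> k)"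
          by (intro alternating_warped_coframe) auto
      qed simp
      then show ?thesis
        by (simp add: J map_w)
    qed
    ultimately show "f * mwedge 6 1 (pull_fst vol) dsnd ((!) (map w J))
        = cmon (warped_coframe f \<theta>) [1,2,3,4,5,6,7] ((!) (map w J))" by simp
  qed
qed

lemma warped_coframe_metric:
  "(\<Sum>k = 1..7. warped_coframe f \<theta> k (\<lambda>_. x) * warped_coframe f \<theta> k (\<lambda>_. y))
    = g (fst x) (fst y) + f\<^sup>2 * (snd x * snd y)"
proof -
  have "(\<Sum>k = 1..7. warped_coframe f \<theta> k (\<lambda>_. x) * warped_coframe f \<theta> k (\<lambda>_. y))
      = (\<Sum>k = 1..6. warped_coframe f \<theta> k (\<lambda>_. x) * warped_coframe f \<theta> k (\<lambda>_. y))
        + warped_coframe f \<theta> 7 (\<lambda>_. x) * warped_coframe f \<theta> 7 (\<lambda>_. y)"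
    using sum.nat_ivl_Suc'[of 1 6 "\<lambda>k. warped_coframe f \<theta> k (\<lambda>_. x) * warped_coframe f \<theta> k (\<lambda>_. y)"]
    by (simp add: add.commute)
  also have "(\<Sum>k = 1..6. warped_coframe f \<theta> k (\<lambda>_. x) * warped_coframe f \<theta> k (\<lambda>_. y)) = g (fst x) (fst y)"
    unfolding coframe_metric_def dim by (intro sum.cong) (auto simp: warped_coframe_def pull_fst_def)
  finally show ?thesis
    by (simp add: warped_coframe_def dsnd_def power2_eq_square mult_ac)
qed

end

section \<open>SU(3)-structures in adapted coframes\<close>

text \<open>The covectors are the coordinates of an injective, hence bijective linear map; the dual basis is
  the preimage of the standard basis.\<close>

lemma coframe_dual_frame:
  fixes M :: "('i, 'm, real^6) manifold"
  assumes e: "coframe M U e" and q: "q \<in> cdom M i \<inter> U"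
  shows "\<exists>u. su3_frame (\<lambda>k. e k i q) u"
proof -
  have alt: "alternating 1 (e k i q)" if "k \<in> {1..6}" for k
    using e q that by (auto simp: coframe_def Omega_on_def)
  obtain b where b: "bij_betw b {0..<card (Basis :: (real^6) set)} (Basis :: (real^6) set)"
    using ex_bij_betw_nat_finite[OF finite_Basis] by blast
  then have b: "bij_betw b {..<6} (Basis :: (real^6) set)"
    by (simp add: lessThan_atLeast0)
  have b_inner: "b l \<bullet> b j = (if l = j then 1 else 0)" if "l < 6" "j < 6" for l j
  proof -
    have "b l \<in> Basis" "b j \<in> Basis" "b l = b j \<longleftrightarrow> l = j"
      using b that by (auto simp: bij_betw_def inj_on_def)
    then show ?thesis by (simp add: inner_Basis)
  qed
  define L where "L x = (\<Sum>j<6. e (Suc j) i q (\<lambda>_. x) *\<^sub>R b j)" for x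
  have lin: "linear (\<lambda>x. e (Suc j) i q (\<lambda>_. x))" if "j < 6" for j
    using alt[of "Suc j"] that unfolding One_nat_def alternating_1_iff by simp
  have "linear L"
    unfolding L_def[abs_def]
    by (intro linear_compose_sum ballI) (auto intro!: linearI simp: linear_add[OF lin] linear_scale[OF lin] scaleR_add_left)
  have inner: "L x \<bullet> b j = e (Suc j) i q (\<lambda>_. x)" if j: "j < 6" for x j
  proof -
    have "L x \<bullet> b j = (\<Sum>l<6. if l = j then e (Suc l) i q (\<lambda>_. x) else 0)"
      unfolding L_def inner_sum_left using j by (intro sum.cong) (auto simp: b_inner)
    then show ?thesis using j by simp
  qed
  have "x = 0" if "L x = 0" for x
  proof -
    have "e k i q (\<lambda>_. x) = 0" if "k \<in> {1..6}" for k
    proof -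
      have "k - 1 < 6" "Suc (k - 1) = k" using that by auto
      then show ?thesis using inner[of "k - 1" x] \<open>L x = 0\<close> by simp
    qed
    then show ?thesis
      using e q unfolding coframe_def by simp
  qed
  then have "inj L"
    using \<open>linear L\<close> linear_injective_0 by blast
  then have "surj L"
    using \<open>linear L\<close> linear_injective_imp_surjective by blast
  define u where "u j = inv L (b j)" for j
  have u: "L (u j) = b j" for j
    unfolding u_def by (rule surj_f_inv_f[OF \<open>surj L\<close>])
  have "su3_frame (\<lambda>k. e k i q) u"
  proof
    show "DIM(real^6) = 6" by simp
    fix k assume k: "k \<in> {1..6 :: nat}"
    show "alternating 1 (e k i q)" by (rule alt[OF k])
    fix j :: nat assume j: "j < 6"
    have "e k i q ((!) [u j]) = e k i q (\<lambda>_. u j)"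
      by (rule alternating_cong[OF alt[OF k]]) simp
    also have "\<dots> = b j \<bullet> b (k - 1)"
    proof -
      have "k - 1 < 6" "Suc (k - 1) = k" using k by auto
      then show ?thesis using inner[of "k - 1" "u j"] u by simp
    qed
    also have "\<dots> = (if k = Suc j then 1 else 0)"
      using b_inner[of j "k - 1"] j k by auto
    finally show "e k i q ((!) [u j]) = (if k = Suc j then 1 else 0)" .
  qed
  then show ?thesis by blast
qed

lemma su3_adapted_point:
  assumes e: "su3_adapted M U e \<omega> \<psi>p \<psi>m" and U: "openin (mtop M) U"
    and g: "su3_metric M \<omega> \<psi>p \<psi>m g" and q: "q \<in> cdom M i \<inter> U"
  shows "\<omega> i q = su3_omega (\<lambda>k. e k i q)" "\<psi>p i q = su3_psip (\<lambda>k. e k i q)"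
    "\<psi>m i q = su3_psim (\<lambda>k. e k i q)" "g i q = coframe_metric (\<lambda>k. e k i q)"
    "\<exists>u. su3_frame (\<lambda>k. e k i q) u"
proof -
  show "\<exists>u. su3_frame (\<lambda>k. e k i q) u"
    using e q by (intro coframe_dual_frame) (auto simp: su3_adapted_def)
  show "\<omega> i q = su3_omega (\<lambda>k. e k i q)" "\<psi>p i q = su3_psip (\<lambda>k. e k i q)"
    "\<psi>m i q = su3_psim (\<lambda>k. e k i q)"
    using e q unfolding su3_adapted_def feq_on_def su3_omega_def su3_psip_def su3_psim_def
    by (simp_all add: emon_pointwise del: emon.simps One_nat_def)
  have "orthonormal_coframe M U g e"
    using g e U unfolding su3_metric_def by blast
  then show "g i q = coframe_metric (\<lambda>k. e k i q)"
    using q by (intro ext) (simp add: orthonormal_coframe_def coframe_metric_def)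
qed

lemma vol6_point: "\<omega> i q = su3_omega \<theta> \<Longrightarrow> vol6 \<omega> i q = su3_vol \<theta>"
  by (simp add: vol6_def fscale_def wedge_def su3_vol_def)

section \<open>Closed warped G2-structures\<close>

text \<open>The situation at one instant of time.\<close>

locale closed_warped =
  fixes M :: "('i, 'm, real^6) manifold"
    and \<alpha> \<beta> f :: real
    and \<omega> \<psi>p \<psi>m \<sigma>0 \<pi>0 \<pi>1 \<nu>1 \<pi>2 \<sigma>2 \<nu>3 :: "('i, 'm, real^6) field"
    and g :: "('i, 'm, real^6) metric"
  assumes M: "smooth_manifold M"
    and ab: "\<alpha>\<^sup>2 + \<beta>\<^sup>2 = 1"
    and su3: "su3_structure M \<omega> \<psi>p \<psi>m"
    and metric: "su3_metric M \<omega> \<psi>p \<psi>m g"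
    and torsion: "torsion_forms M \<omega> \<psi>p \<psi>m g \<sigma>0 \<pi>0 \<pi>1 \<nu>1 \<pi>2 \<sigma>2 \<nu>3"
    and f: "f \<noteq> 0"
    and closed: "feq (times_circle M) (ext_deriv (times_circle M) 3 (warped_form \<alpha> \<beta> f \<omega> \<psi>p \<psi>m)) 0"
begin

abbreviation "P \<equiv> times_circle M"
abbreviation "\<phi> \<equiv> warped_form \<alpha> \<beta> f \<omega> \<psi>p \<psi>m"
abbreviation "G \<equiv> warped_metric f g"
abbreviation "V \<equiv> warped_vol f \<omega>"
abbreviation "\<sigma> \<equiv> \<alpha> *\<^sub>F \<sigma>2 + \<beta> *\<^sub>F \<pi>2"
abbreviation "\<Psi> \<equiv> \<alpha> *\<^sub>F \<psi>m + \<beta> *\<^sub>F \<psi>p"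

lemma Omega: "\<omega> \<in> Omega M 2" "\<psi>p \<in> Omega M 3" "\<psi>m \<in> Omega M 3" "\<sigma>2 \<in> Omega M 2" "\<pi>2 \<in> Omega M 2"
  "\<sigma>0 \<in> Omega M 0" "\<pi>0 \<in> Omega M 0" "\<pi>1 \<in> Omega M 1" "\<nu>1 \<in> Omega M 1" "\<nu>3 \<in> Omega M 3"
  using su3 torsion by (auto simp: su3_structure_def torsion_forms_def Omega2_8_def Omega3_12_def)

lemma open_top: "open (coord M i ` (cdom M i \<inter> topspace (mtop M)))"
  by (rule open_chart_image[OF M openin_topspace])

lemma Omega_\<sigma>: "\<sigma> \<in> Omega M 2" and Omega_\<Psi>: "\<Psi> \<in> Omega M 3"
  by (intro Omega_on_add Omega_on_fscale open_top Omega)+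

lemma su3_point:
  assumes q: "q \<in> cdom M i"
  obtains \<theta> u where "su3_frame \<theta> u" "\<omega> i q = su3_omega \<theta>" "\<psi>p i q = su3_psip \<theta>" "\<psi>m i q = su3_psim \<theta>"
    "g i q = coframe_metric \<theta>" "vol6 \<omega> i q = su3_vol \<theta>"
proof -
  have "q \<in> topspace (mtop M)"
    using q cdom_subset[OF M] by blast
  then obtain U e where U: "openin (mtop M) U" "q \<in> U" "su3_adapted M U e \<omega> \<psi>p \<psi>m"
    using su3 unfolding su3_structure_def by blast
  then have q': "q \<in> cdom M i \<inter> U" using q by simp
  note point = su3_adapted_point[OF U(3,1) metric q']
  from point(5) obtain u where "su3_frame (\<lambda>k. e k i q) u" by blast
  from that[OF this point(1-4) vol6_point[where \<omega> = \<omega> and i = i and q = q, OF point(1)]] show thesis .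
qed

lemma \<phi>_point: "\<phi> (i, a) (q, z) = (\<lambda>v. f * mwedge 2 1 (pull_fst (\<omega> i q)) dsnd v
    + pull_fst (\<lambda>v. \<alpha> * \<psi>p i q v - \<beta> * \<psi>m i q v) v)"
  unfolding warped_form_def plus_fun_def fun_diff_def fscale_def wedge_def pr1_pointwise ds_pointwise
  by (simp add: pull_fst_def)

lemma G_point: "G (i, a) (q, z) = (\<lambda>x y. g i q (fst x) (fst y) + f\<^sup>2 * (snd x * snd y))"
  by (simp add: warped_metric_def)

lemma V_point: "V (i, a) (q, z) = (\<lambda>v. f * mwedge 6 1 (pull_fst (vol6 \<omega> i q)) dsnd v)"
  unfolding warped_vol_def fscale_def wedge_def pr1_pointwise ds_pointwise ..

lemma torsion_point:
  assumes q: "q \<in> cdom M i"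
  shows d\<omega>: "ext_deriv M 2 \<omega> i q v = (- 3/2) * (\<sigma>0 i q (\<lambda>_. 0) * \<psi>p i q v)
      + (3/2) * (\<pi>0 i q (\<lambda>_. 0) * \<psi>m i q v) + mwedge 1 2 (\<nu>1 i q) (\<omega> i q) v + \<nu>3 i q v"
    and d\<psi>p: "ext_deriv M 3 \<psi>p i q v = \<pi>0 i q (\<lambda>_. 0) * mwedge 2 2 (\<omega> i q) (\<omega> i q) v
      + mwedge 1 3 (\<pi>1 i q) (\<psi>p i q) v - mwedge 2 2 (\<pi>2 i q) (\<omega> i q) v"
    and d\<psi>m: "ext_deriv M 3 \<psi>m i q v = \<sigma>0 i q (\<lambda>_. 0) * mwedge 2 2 (\<omega> i q) (\<omega> i q) v
      + mwedge 1 3 (\<pi>1 i q) (\<psi>m i q) v - mwedge 2 2 (\<sigma>2 i q) (\<omega> i q) v"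
    and \<nu>3: "mwedge 3 3 (\<nu>3 i q) (\<psi>p i q) v = 0" "mwedge 3 3 (\<nu>3 i q) (\<psi>m i q) v = 0"
    and star: "mhodge (g i q) (vol6 \<omega> i q) 2 (\<pi>2 i q) v = - mwedge 2 2 (\<pi>2 i q) (\<omega> i q) v"
      "mhodge (g i q) (vol6 \<omega> i q) 2 (\<sigma>2 i q) v = - mwedge 2 2 (\<sigma>2 i q) (\<omega> i q) v"
proof -
  have q': "q \<in> cdom M i \<inter> topspace (mtop M)"
    using q cdom_subset[OF M] by blast
  note alt = Omega_alternating[OF M q]
  have const: "\<kappa> i q v = \<kappa> i q (\<lambda>_. 0)" if "\<kappa> \<in> Omega M 0" for \<kappa> :: "('i, 'm, real^6) field" and v
    by (rule alternating_cong[OF alt[OF that]]) simp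
  have wedge0: "mwedge 0 k (\<kappa> i q) a v = \<kappa> i q (\<lambda>_. 0) * a v"
    if "\<kappa> \<in> Omega M 0" "alternating k a" for \<kappa> :: "('i, 'm, real^6) field" and k a v
    using mwedge_0_left[OF alt[OF that(1)] that(2)] const[OF that(1), of v] by simp
  have \<omega>\<omega>: "alternating 4 (mwedge 2 2 (\<omega> i q) (\<omega> i q))"
    using alternating_mwedge[OF alt alt, OF Omega(1) Omega(1)] by simp
  note tor = torsion[unfolded torsion_forms_def Omega2_8_def Omega3_12_def feq_on_def]
  have at: "\<eta> i q v = \<theta> i q v" if "\<forall>i. \<forall>p \<in> cdom M i \<inter> topspace (mtop M). \<eta> i p = \<theta> i p"
    for \<eta> \<theta> :: "('i, 'm, real^6) field" and v
    using that q' by simp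
  have "ext_deriv M 2 \<omega> i q v = ((- 3/2) *\<^sub>F (\<sigma>0 \<and>\<^bsub>0,3\<^esub> \<psi>p) + (3/2) *\<^sub>F (\<pi>0 \<and>\<^bsub>0,3\<^esub> \<psi>m)
      + (\<nu>1 \<and>\<^bsub>1,2\<^esub> \<omega>) + \<nu>3) i q v"
    using tor by (intro at) blast
  then show "ext_deriv M 2 \<omega> i q v = (- 3/2) * (\<sigma>0 i q (\<lambda>_. 0) * \<psi>p i q v)
      + (3/2) * (\<pi>0 i q (\<lambda>_. 0) * \<psi>m i q v) + mwedge 1 2 (\<nu>1 i q) (\<omega> i q) v + \<nu>3 i q v"
    unfolding plus_fun_def fscale_def wedge_def
    by (simp only: wedge0[OF Omega(6) alt[OF Omega(2)]] wedge0[OF Omega(7) alt[OF Omega(3)]])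
  have "ext_deriv M 3 \<psi>p i q v = ((\<pi>0 \<and>\<^bsub>0,4\<^esub> (\<omega> \<and>\<^bsub>2,2\<^esub> \<omega>)) + (\<pi>1 \<and>\<^bsub>1,3\<^esub> \<psi>p) - (\<pi>2 \<and>\<^bsub>2,2\<^esub> \<omega>)) i q v"
    using tor by (intro at) blast
  then show "ext_deriv M 3 \<psi>p i q v = \<pi>0 i q (\<lambda>_. 0) * mwedge 2 2 (\<omega> i q) (\<omega> i q) v
      + mwedge 1 3 (\<pi>1 i q) (\<psi>p i q) v - mwedge 2 2 (\<pi>2 i q) (\<omega> i q) v"
    unfolding plus_fun_def fun_diff_def wedge_def by (simp only: wedge0[OF Omega(7) \<omega>\<omega>])
  have "ext_deriv M 3 \<psi>m i q v = ((\<sigma>0 \<and>\<^bsub>0,4\<^esub> (\<omega> \<and>\<^bsub>2,2\<^esub> \<omega>)) + (\<pi>1 \<and>\<^bsub>1,3\<^esub> \<psi>m) - (\<sigma>2 \<and>\<^bsub>2,2\<^esub> \<omega>)) i q v"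
    using tor by (intro at) blast
  then show "ext_deriv M 3 \<psi>m i q v = \<sigma>0 i q (\<lambda>_. 0) * mwedge 2 2 (\<omega> i q) (\<omega> i q) v
      + mwedge 1 3 (\<pi>1 i q) (\<psi>m i q) v - mwedge 2 2 (\<sigma>2 i q) (\<omega> i q) v"
    unfolding plus_fun_def fun_diff_def wedge_def by (simp only: wedge0[OF Omega(6) \<omega>\<omega>])
  have "(\<nu>3 \<and>\<^bsub>3,3\<^esub> \<psi>p) i q v = 0 i q v" "(\<nu>3 \<and>\<^bsub>3,3\<^esub> \<psi>m) i q v = 0 i q v"
    by (rule at; use tor in blast)+
  then show "mwedge 3 3 (\<nu>3 i q) (\<psi>p i q) v = 0" "mwedge 3 3 (\<nu>3 i q) (\<psi>m i q) v = 0"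
    by (simp_all add: wedge_def)
  have "hodge g (vol6 \<omega>) 2 \<pi>2 i q v = (- (\<pi>2 \<and>\<^bsub>2,2\<^esub> \<omega>)) i q v"
    "hodge g (vol6 \<omega>) 2 \<sigma>2 i q v = (- (\<sigma>2 \<and>\<^bsub>2,2\<^esub> \<omega>)) i q v"
    by (rule at; use tor in blast)+
  then show "mhodge (g i q) (vol6 \<omega> i q) 2 (\<pi>2 i q) v = - mwedge 2 2 (\<pi>2 i q) (\<omega> i q) v"
      "mhodge (g i q) (vol6 \<omega> i q) 2 (\<sigma>2 i q) v = - mwedge 2 2 (\<sigma>2 i q) (\<omega> i q) v"
    by (simp_all add: wedge_def hodge_def)
qed

text \<open>The torsion equations express the exterior derivatives by wedge products.\<close>

lemma alternating_d:
  assumes q: "q \<in> cdom M i"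
  shows "alternating 3 (ext_deriv M 2 \<omega> i q)" "alternating 4 (ext_deriv M 3 \<psi>p i q)"
    "alternating 4 (ext_deriv M 3 \<psi>m i q)"
proof -
  note alt = Omega_alternating[OF M q]
  have w: "alternating 3 (mwedge 1 2 (\<nu>1 i q) (\<omega> i q))"
    "alternating 4 (mwedge 1 3 (\<pi>1 i q) (\<psi>p i q))" "alternating 4 (mwedge 1 3 (\<pi>1 i q) (\<psi>m i q))"
    "alternating 4 (mwedge 2 2 (\<pi>2 i q) (\<omega> i q))" "alternating 4 (mwedge 2 2 (\<sigma>2 i q) (\<omega> i q))"
    "alternating 4 (mwedge 2 2 (\<omega> i q) (\<omega> i q))"
    using alternating_mwedge[OF alt[OF Omega(9)] alt[OF Omega(1)]]
      alternating_mwedge[OF alt[OF Omega(8)] alt[OF Omega(2)]]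
      alternating_mwedge[OF alt[OF Omega(8)] alt[OF Omega(3)]]
      alternating_mwedge[OF alt[OF Omega(5)] alt[OF Omega(1)]]
      alternating_mwedge[OF alt[OF Omega(4)] alt[OF Omega(1)]]
      alternating_mwedge[OF alt[OF Omega(1)] alt[OF Omega(1)]] by (simp_all del: One_nat_def)
  show "alternating 3 (ext_deriv M 2 \<omega> i q)"
    unfolding d\<omega>[OF q, abs_def] by (intro alternating_add alternating_scale alt Omega w)
  show "alternating 4 (ext_deriv M 3 \<psi>p i q)"
    unfolding d\<psi>p[OF q, abs_def] by (intro alternating_add alternating_diff alternating_scale w)
  show "alternating 4 (ext_deriv M 3 \<psi>m i q)"
    unfolding d\<psi>m[OF q, abs_def] by (intro alternating_add alternating_diff alternating_scale w)
qed

text \<open>If all arguments are tangent to \<open>M\<close>, then \<open>d\<phi>\<close> gives \<open>d\<rho>\<close>; if the last one is \<open>\<partial>/\<partial>s\<close> instead, it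
  gives \<open>f d\<omega>\<close>.\<close>

lemma closed_point:
  assumes q: "q \<in> cdom M i"
  shows "ext_deriv M 2 \<omega> i q v = 0" and "\<alpha> * ext_deriv M 3 \<psi>p i q v - \<beta> * ext_deriv M 3 \<psi>m i q v = 0"
proof -
  \<comment> \<open>An arbitrary point in the domain of the chart \<open>0\<close> of the circle.\<close>
  define z where "z = cis pi"
  have p: "(q, z) \<in> cdom P (i, 0)"
  proof -
    have "cis pi \<in> cis ` {0<..<0 + 2 * pi}"
      by (rule imageI) simp
    then show ?thesis
      using q unfolding cdom_times_circle z_def by blast
  qed
  note diff = Omega_comp_diff[OF M q]
  note diffs = comp_diff_wedge_ds[OF M diff[OF Omega(1)] p, of 2]
    comp_diff_pr1[OF M diff[OF Omega(2)] p] comp_diff_pr1[OF M diff[OF Omega(3)] p]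
  let ?D = "\<lambda>v. \<alpha> * ext_deriv M 3 \<psi>p i q v - \<beta> * ext_deriv M 3 \<psi>m i q v"
  have "ext_deriv P 3 \<phi> (i, 0) (q, z) w = f * mwedge 3 1 (pull_fst (ext_deriv M 2 \<omega> i q)) dsnd w + pull_fst ?D w" for w
    unfolding warped_form_def
    by (simp add: ext_deriv_add ext_deriv_fscale ext_deriv_diff comp_diff_fscale comp_diff_diff diffs
        diffs(1)[unfolded One_nat_def]
        ext_deriv_wedge_ds_2[OF M Omega(1) p alternating_d(1)[OF q], unfolded One_nat_def]
        ext_deriv_pr1[OF M diff[OF Omega(2)] p] ext_deriv_pr1[OF M diff[OF Omega(3)] p] pull_fst_def)
  moreover have "ext_deriv P 3 \<phi> (i, 0) (q, z) w = 0" for w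
  proof -
    have "(q, z) \<in> topspace (mtop P)"
      using q cdom_subset[OF M] by (auto simp: topspace_times_circle z_def)
    then show ?thesis
      using closed p unfolding feq_on_def by simp
  qed
  ultimately have zero: "f * mwedge 3 1 (pull_fst (ext_deriv M 2 \<omega> i q)) dsnd w + pull_fst ?D w = 0" for w
    by metis
  have alt_D: "alternating 4 ?D"
    by (intro alternating_diff alternating_scale alternating_d q)
  have D: "?D ((!) [x1, x2, x3, x4]) = 0" for x1 x2 x3 x4
  proof -
    have "mwedge 3 1 (pull_fst (ext_deriv M 2 \<omega> i q)) dsnd ((!) [(x1, 0), (x2, 0), (x3, 0), (x4, 0)]) = 0"
      by (rule mwedge_snoc_zero[OF alternating_pull_fst[OF alternating_d(1)[OF q]] alternating_dsnd]) auto
    then show ?thesis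
      using zero[of "(!) [(x1, 0), (x2, 0), (x3, 0), (x4, 0)]"]
        pull_fst_nth[OF alt_D, of "[(x1, 0), (x2, 0), (x3, 0), (x4, 0)]"] by simp
  qed
  show "?D v = 0"
    using alternating_as_list[OF alt_D, of v] D by (simp add: upt_rec numeral_eq_Suc)
  have "ext_deriv M 2 \<omega> i q ((!) [x1, x2, x3]) = 0" for x1 x2 x3
  proof -
    have "mwedge 3 1 (pull_fst (ext_deriv M 2 \<omega> i q)) dsnd ((!) ([(x1, 0), (x2, 0), (x3, 0)] @ [(0, 1)]))
        = pull_fst (ext_deriv M 2 \<omega> i q) ((!) [(x1, 0), (x2, 0), (x3, 0)])"
      by (subst mwedge_snoc[OF alternating_pull_fst[OF alternating_d(1)[OF q]] alternating_dsnd]) auto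
    moreover have "pull_fst ?D ((!) [(x1, 0), (x2, 0), (x3, 0), (0, 1)]) = 0"
      using pull_fst_nth[OF alt_D, of "[(x1, 0), (x2, 0), (x3, 0), (0, 1)]"] D by simp
    ultimately show ?thesis
      using zero[of "(!) ([(x1, 0), (x2, 0), (x3, 0), (0, 1)])"] f
        pull_fst_nth[OF alternating_d(1)[OF q], of "[(x1, 0), (x2, 0), (x3, 0)]"] by simp
  qed
  then show "ext_deriv M 2 \<omega> i q v = 0"
    using alternating_as_list[OF alternating_d(1)[OF q], of v] by (simp add: upt_rec numeral_eq_Suc)
qed

lemma torsion_closed:
  assumes q: "q \<in> cdom M i"
  shows "\<alpha> * \<pi>2 i q v - \<beta> * \<sigma>2 i q v = 0"
    and "ext_deriv M 3 \<Psi> i q = mhodge (g i q) (vol6 \<omega> i q) 2 (\<sigma> i q)"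
proof -
  note alt = Omega_alternating[OF M q]
  obtain \<theta> u where F: "su3_frame \<theta> u" and eqs: "\<omega> i q = su3_omega \<theta>" "\<psi>p i q = su3_psip \<theta>" "\<psi>m i q = su3_psim \<theta>"
    "g i q = coframe_metric \<theta>" "vol6 \<omega> i q = su3_vol \<theta>"
    using su3_point[OF q] by blast
  interpret su3_frame \<theta> u by (rule F)
  note cl = closed_torsion[OF ab alt[OF Omega(8)] alt[OF Omega(9)] alt[OF Omega(10)] alt[OF Omega(5)] alt[OF Omega(4)]
     d\<omega>[OF q, unfolded eqs] d\<psi>p[OF q, unfolded eqs] d\<psi>m[OF q, unfolded eqs]
     \<nu>3[OF q, unfolded eqs] star[OF q, unfolded eqs] closed_point[OF q]]
  show "\<alpha> * \<pi>2 i q v - \<beta> * \<sigma>2 i q v = 0"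
    by (rule cl(1))
  note diff = Omega_comp_diff[OF M q]
  have "ext_deriv M 3 \<Psi> i q v = \<alpha> * ext_deriv M 3 \<psi>m i q v + \<beta> * ext_deriv M 3 \<psi>p i q v" for v
    by (simp add: ext_deriv_add ext_deriv_fscale comp_diff_fscale diff[OF Omega(2)] diff[OF Omega(3)])
  note d\<Psi> = this
  show "ext_deriv M 3 \<Psi> i q = mhodge (g i q) (vol6 \<omega> i q) 2 (\<sigma> i q)"
  proof -
    have "\<sigma> i q = (\<lambda>v. \<alpha> * \<sigma>2 i q v + \<beta> * \<pi>2 i q v)"
      by (intro ext) (simp add: fscale_def)
    then show ?thesis
      unfolding eqs using cl(2) d\<Psi> by (intro ext) simp
  qed
qed

lemma open_P: "open (coord P ia ` cdom P ia)"
proof -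
  obtain i a where ia: "ia = (i, a)" by (cases ia)
  have "cdom P ia \<inter> (topspace (mtop M) \<times> sphere 0 1) = cdom P ia"
    using cdom_subset[OF M, of i] by (auto simp: ia cdom_times_circle)
  then show ?thesis
    using open_image_times_circle[OF M openin_topspace, of ia] by simp
qed

lemma hodge_\<phi>:
  assumes p: "(q, z) \<in> cdom P (i, a)"
  shows "hodge G V 3 \<phi> (i, a) (q, z) = ((1/2) *\<^sub>F pr1 (\<omega> \<and>\<^bsub>2,2\<^esub> \<omega>) + f *\<^sub>F (pr1 \<Psi> \<and>\<^bsub>3,1\<^esub> ds)) (i, a) (q, z)"
proof -
  have q: "q \<in> cdom M i" using p by (simp add: cdom_times_circle)
  obtain \<theta> u where F: "su3_frame \<theta> u" and eqs: "\<omega> i q = su3_omega \<theta>" "\<psi>p i q = su3_psip \<theta>" "\<psi>m i q = su3_psim \<theta>"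
    "g i q = coframe_metric \<theta>" "vol6 \<omega> i q = su3_vol \<theta>"
    using su3_point[OF q] by blast
  interpret su3_frame \<theta> u by (rule F)
  have "hodge G V 3 \<phi> (i, a) (q, z) = (\<lambda>v. 1 / 2 * pull_fst (mwedge 2 2 (\<omega> i q) (\<omega> i q)) v
      + f * mwedge 3 1 (pull_fst (\<lambda>v. \<alpha> * \<psi>m i q v + \<beta> * \<psi>p i q v)) dsnd v)"
    unfolding hodge_def \<phi>_point G_point V_point eqs by (rule star_warped_form[OF ab f])
  then show ?thesis
    unfolding plus_fun_def fscale_def wedge_def pr1_pointwise ds_pointwise .
qed

text \<open>Here \<open>d\<star>\<phi> = f d\<Psi> \<and> ds = f (\<star>\<^sub>6 \<sigma>) \<and> ds\<close>, and the star of this form is \<open>\<sigma>\<close>. The sign is \<open>(-1)\<close> to the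
  power \<open>7 \<cdot> 4 + 1\<close>.\<close>

lemma codiff_\<phi>:
  assumes p: "(q, z) \<in> cdom P (i, a)"
  shows "codiff P G V 3 \<phi> (i, a) (q, z) = ((-1) *\<^sub>F pr1 \<sigma>) (i, a) (q, z)"
proof -
  have q: "q \<in> cdom M i" using p by (simp add: cdom_times_circle)
  obtain \<theta> u where F: "su3_frame \<theta> u" and eqs: "\<omega> i q = su3_omega \<theta>" "\<psi>p i q = su3_psip \<theta>" "\<psi>m i q = su3_psim \<theta>"
    "g i q = coframe_metric \<theta>" "vol6 \<omega> i q = su3_vol \<theta>"
    using su3_point[OF q] by blast
  interpret su3_frame \<theta> u by (rule F)
  have \<sigma>: "alternating 2 (\<sigma> i q)"
    by (rule Omega_alternating[OF M q Omega_\<sigma>])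
  have "alternating 4 (mhodge (g i q) (vol6 \<omega> i q) 2 (\<sigma> i q))"
    using alternating_mhodge[of "vol6 \<omega> i q" 2] alternating_vol unfolding eqs by simp
  then have alt: "alternating 4 (ext_deriv M 3 \<Psi> i q)"
    unfolding torsion_closed(2)[OF q] .
  note diff = Omega_comp_diff[OF M q]
  have diff_\<omega>\<omega>: "comp_diff M i q (\<omega> \<and>\<^bsub>2,2\<^esub> \<omega>)"
    by (rule comp_diff_wedge[OF diff[OF Omega(1)] diff[OF Omega(1)] cinv_coord[OF M q]])
  note diffs = comp_diff_pr1[OF M diff_\<omega>\<omega> p] comp_diff_wedge_ds[OF M diff[OF Omega_\<Psi>] p, of 3]
  have "ext_deriv P 4 (hodge G V 3 \<phi>) (i, a) (q, z)
      = ext_deriv P 4 ((1/2) *\<^sub>F pr1 (\<omega> \<and>\<^bsub>2,2\<^esub> \<omega>) + f *\<^sub>F (pr1 \<Psi> \<and>\<^bsub>3,1\<^esub> ds)) (i, a) (q, z)"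
  proof (rule ext_deriv_cong[OF open_P p])
    fix p' assume "p' \<in> cdom P (i, a)"
    then show "hodge G V 3 \<phi> (i, a) p' = ((1/2) *\<^sub>F pr1 (\<omega> \<and>\<^bsub>2,2\<^esub> \<omega>) + f *\<^sub>F (pr1 \<Psi> \<and>\<^bsub>3,1\<^esub> ds)) (i, a) p'"
      by (cases p') (simp only: hodge_\<phi>)
  qed
  also have "\<dots> = (\<lambda>v. f * mwedge 4 1 (pull_fst (mhodge (g i q) (vol6 \<omega> i q) 2 (\<sigma> i q))) dsnd v)"
  proof
    fix v :: "nat \<Rightarrow> (real^6) \<times> real"
    have "ext_deriv P 4 (pr1 (\<omega> \<and>\<^bsub>2,2\<^esub> \<omega>)) (i, a) (q, z) v = 0"
      unfolding ext_deriv_pr1[OF M diff_\<omega>\<omega> p] pull_fst_def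
      by (rule ext_deriv_square_closed[OF M Omega(1) q closed_point(1)[OF q]])
    then show "ext_deriv P 4 ((1/2) *\<^sub>F pr1 (\<omega> \<and>\<^bsub>2,2\<^esub> \<omega>) + f *\<^sub>F (pr1 \<Psi> \<and>\<^bsub>3,1\<^esub> ds)) (i, a) (q, z) v
        = f * mwedge 4 1 (pull_fst (mhodge (g i q) (vol6 \<omega> i q) 2 (\<sigma> i q))) dsnd v"
      unfolding ext_deriv_add[OF comp_diff_fscale[OF diffs(1)] comp_diff_fscale[OF diffs(2)]]
        ext_deriv_fscale[OF diffs(1)] ext_deriv_fscale[OF diffs(2)]
        ext_deriv_wedge_ds_3[OF M Omega_\<Psi> p alt] torsion_closed(2)[OF q] by simp
  qed
  finally have "hodge G V 5 (ext_deriv P 4 (hodge G V 3 \<phi>)) (i, a) (q, z) = pull_fst (\<sigma> i q)"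
    unfolding hodge_def[of _ _ 5] G_point V_point eqs using star_warped_4[OF ab f \<sigma>] by simp
  then show ?thesis
    by (simp add: codiff_def fscale_def pr1_pointwise)
qed

lemma laplacian_\<phi>:
  assumes p: "(q, z) \<in> cdom P (i, a)"
  shows "hodge_laplacian P G V 3 \<phi> (i, a) (q, z) v = - pull_fst (ext_deriv M 2 \<sigma> i q) v"
proof -
  have q: "q \<in> cdom M i" using p by (simp add: cdom_times_circle)
  note diff = Omega_comp_diff[OF M q Omega_\<sigma>]
  have "ext_deriv P 2 (codiff P G V 3 \<phi>) (i, a) (q, z) = ext_deriv P 2 ((-1) *\<^sub>F pr1 \<sigma>) (i, a) (q, z)"
  proof (rule ext_deriv_cong[OF open_P p])
    fix p' assume "p' \<in> cdom P (i, a)"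
    then show "codiff P G V 3 \<phi> (i, a) p' = ((-1) *\<^sub>F pr1 \<sigma>) (i, a) p'"
      by (cases p') (simp only: codiff_\<phi>)
  qed
  then have first: "ext_deriv P 2 (codiff P G V 3 \<phi>) (i, a) (q, z) v = - pull_fst (ext_deriv M 2 \<sigma> i q) v"
    by (simp only: ext_deriv_fscale[OF comp_diff_pr1[OF M diff p]] ext_deriv_pr1[OF M diff p])
  have zero: "hodge G V 4 (ext_deriv P 3 \<phi>) (i, a) p' = (\<lambda>_ _ _. 0) (i, a) p'" if "p' \<in> cdom P (i, a)" for p'
  proof -
    have "p' \<in> topspace (mtop P)"
      using that cdom_subset[OF M] by (auto simp: topspace_times_circle cdom_times_circle)
    then have "ext_deriv P 3 \<phi> (i, a) p' = (\<lambda>_. 0)"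
      using closed that unfolding feq_on_def by (simp add: zero_fun_def)
    then show ?thesis
      by (simp add: hodge_def mhodge_zero)
  qed
  have "ext_deriv P 3 (hodge G V 4 (ext_deriv P 3 \<phi>)) (i, a) (q, z) = ext_deriv P 3 (\<lambda>_ _ _. 0) (i, a) (q, z)"
    by (rule ext_deriv_cong[OF open_P p]) (simp add: zero)
  also have "\<dots> = (\<lambda>_. 0)"
    by (simp add: ext_deriv_def frechet_derivative_const)
  finally have "codiff P G V 4 (ext_deriv P 3 \<phi>) (i, a) (q, z) v = 0"
    by (simp add: codiff_def fscale_def hodge_def[of _ _ 4 "ext_deriv _ _ (hodge _ _ _ _)"] mhodge_zero)
  then show ?thesis
    using first by (simp add: hodge_laplacian_def)
qed

end

section \<open>The warped form is a G2-structure\<close>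

context closed_warped
begin

text \<open>The fields whose values at a point are \<open>rotate_coframe\<close> and \<open>warped_coframe\<close>.\<close>

definition rotated :: "(nat \<Rightarrow> ('i, 'm, real^6) field) \<Rightarrow> nat \<Rightarrow> ('i, 'm, real^6) field" where
  "rotated e = e(1 := \<alpha> *\<^sub>F e 1 - \<beta> *\<^sub>F e 2, 2 := \<beta> *\<^sub>F e 1 + \<alpha> *\<^sub>F e 2)"

definition warped :: "(nat \<Rightarrow> ('i, 'm, real^6) field) \<Rightarrow> nat \<Rightarrow> ('i \<times> real, 'm \<times> complex, (real^6) \<times> real) field" where
  "warped e k = (if k = 7 then f *\<^sub>F ds else pr1 (rotated e k))"

lemma warped_point:
  "(\<lambda>k. warped e k (i, a) (q, z)) = warped_coframe f (rotate_coframe \<alpha> \<beta> (\<lambda>k. e k i q))"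
  by (intro ext) (simp add: warped_def warped_coframe_def pr1_pointwise ds_pointwise fscale_def
      rotated_def rotate_coframe_def pull_fst_def)

lemma \<phi>_Omega: "\<phi> \<in> Omega P 3"
proof -
  have op: "open (coord P ia ` (cdom P ia \<inter> (topspace (mtop M) \<times> sphere 0 1)))" for ia
    by (rule open_image_times_circle[OF M openin_topspace])
  have "pr1 \<omega> \<and>\<^bsub>2,1\<^esub> ds \<in> Omega_on P (topspace (mtop M) \<times> sphere 0 1) (2 + 1)"
    by (intro Omega_on_wedge op Omega_on_pr1[OF M openin_topspace] Omega Omega_on_ds[OF M])
  then have "pr1 \<omega> \<and>\<^bsub>2,1\<^esub> ds \<in> Omega_on P (topspace (mtop M) \<times> sphere 0 1) 3"
    by simp
  then have "\<phi> \<in> Omega_on P (topspace (mtop M) \<times> sphere 0 1) 3"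
    unfolding warped_form_def
    by (intro Omega_on_add Omega_on_diff Omega_on_fscale op Omega_on_pr1[OF M openin_topspace] Omega)
  then show ?thesis
    by (simp only: topspace_times_circle)
qed

lemma warped_coframe_adapted:
  assumes U: "openin (mtop M) U" and e: "su3_adapted M U e \<omega> \<psi>p \<psi>m"
  defines "U' \<equiv> U \<times> sphere 0 1"
  shows "g2_adapted P U' (warped e) \<phi>" "orthonormal_coframe P U' G (warped e)"
    "feq_on P U' V (emon (warped e) [1,2,3,4,5,6,7])"
proof -
  have op: "open (coord M i ` (cdom M i \<inter> U))" for i
    by (rule open_chart_image[OF M U])
  have op': "open (coord P ia ` (cdom P ia \<inter> U'))" for ia
    unfolding U'_def by (rule open_image_times_circle[OF M U])
  have frame: "\<exists>u. su3_frame (rotate_coframe \<alpha> \<beta> (\<lambda>k. e k i q)) u \<and>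
      \<omega> i q = su3_omega (rotate_coframe \<alpha> \<beta> (\<lambda>k. e k i q)) \<and>
      (\<lambda>v. \<alpha> * \<psi>p i q v - \<beta> * \<psi>m i q v) = su3_psip (rotate_coframe \<alpha> \<beta> (\<lambda>k. e k i q)) \<and>
      g i q = coframe_metric (rotate_coframe \<alpha> \<beta> (\<lambda>k. e k i q)) \<and>
      vol6 \<omega> i q = su3_vol (rotate_coframe \<alpha> \<beta> (\<lambda>k. e k i q))"
    if "q \<in> cdom M i \<inter> U" for i q
  proof -
    note point = su3_adapted_point[OF e U metric that]
    obtain u where u: "su3_frame (\<lambda>k. e k i q) u"
      using point(5) by blast
    note rotate = su3_frame_rotate[OF u ab]
    have \<omega>: "\<omega> i q = su3_omega (rotate_coframe \<alpha> \<beta> (\<lambda>k. e k i q))"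
      unfolding rotate(2) by (rule point(1))
    show ?thesis
      using rotate(1) \<omega> vol6_point[where \<omega> = \<omega> and i = i and q = q, OF \<omega>] point rotate(3,5) by auto
  qed
  have chart: "\<exists>i a q z. ia = (i, a) \<and> p = (q, z) \<and> q \<in> cdom M i \<inter> U"
    if "p \<in> cdom P ia \<inter> U'" for ia p
    using that by (cases ia; cases p) (auto simp: cdom_times_circle U'_def)
  have "coframe P U' (warped e)"
    unfolding coframe_def
  proof (intro conjI ballI allI impI)
    fix k assume k: "k \<in> {1..DIM((real^6) \<times> real)}"
    have eO: "e k \<in> Omega_on M U 1" if "k \<in> {1..6}" for k
      using e that by (simp add: su3_adapted_def coframe_def)
    show "warped e k \<in> Omega_on P U' 1"
    proof (cases "k = 7")
      case True
      then show ?thesis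
        unfolding warped_def by (simp only: simp_thms if_True) (intro Omega_on_fscale op' Omega_on_ds M)
    next
      case False
      then have "k \<in> {1..6}" using k by auto
      then have "rotated e k \<in> Omega_on M U 1"
        unfolding rotated_def
        by (auto intro!: Omega_on_add Omega_on_diff Omega_on_fscale op eO[unfolded One_nat_def])
      from Omega_on_pr1[OF M U this] show ?thesis
        using False by (simp add: warped_def U'_def)
    qed
  next
    fix ia p x assume p: "p \<in> cdom P ia \<inter> U'"
      and zero: "\<forall>k\<in>{1..DIM((real^6) \<times> real)}. warped e k ia p (\<lambda>_. x) = 0"
    obtain i a q z where eqs: "ia = (i, a)" "p = (q, z)" "q \<in> cdom M i \<inter> U"
      using chart[OF p] by blast
    define \<eta> where "\<eta> = rotate_coframe \<alpha> \<beta> (\<lambda>k. e k i q)"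
    obtain u where "su3_frame \<eta> u"
      using frame[OF eqs(3)] unfolding \<eta>_def by blast
    then interpret F: su3_frame \<eta> u .
    have zero': "warped_coframe f \<eta> k (\<lambda>_. x) = 0" if "k \<in> {1..7}" for k
    proof -
      have "warped e k ia p (\<lambda>_. x) = 0"
        using bspec[OF zero, of k] that by simp
      then show ?thesis
        using fun_cong[OF warped_point[of e i a q z], of k] by (simp add: eqs \<eta>_def)
    qed
    have "coframe_metric \<eta> (fst x) y = 0" for y
      unfolding coframe_metric_def
    proof (rule sum.neutral, rule ballI)
      fix k assume "k \<in> {1..DIM(real^6)}"
      then have "k \<noteq> 7" "k \<in> {1..7}" by auto
      then show "\<eta> k (\<lambda>_. fst x) * \<eta> k (\<lambda>_. y) = 0"
        using zero'[of k] by (simp add: warped_coframe_def pull_fst_def)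
    qed
    then have "fst x = 0"
      using F.span[of "fst x"] by simp
    moreover have "snd x = 0"
      using zero'[of 7] f by (simp add: warped_coframe_def dsnd_def)
    ultimately show "x = 0"
      by (simp add: prod_eq_iff)
  qed
  moreover have "feq_on P U' \<phi> (emon (warped e) [1,2,7] + emon (warped e) [3,4,7] + emon (warped e) [5,6,7]
       + emon (warped e) [1,3,5] - emon (warped e) [1,4,6] - emon (warped e) [2,3,6] - emon (warped e) [2,4,5])"
    unfolding feq_on_def
  proof (intro allI ballI)
    fix ia p assume p: "p \<in> cdom P ia \<inter> U'"
    obtain i a q z where eqs: "ia = (i, a)" "p = (q, z)" "q \<in> cdom M i \<inter> U"
      using chart[OF p] by blast
    define \<eta> where "\<eta> = rotate_coframe \<alpha> \<beta> (\<lambda>k. e k i q)"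
    obtain u where u: "su3_frame \<eta> u" and \<omega>: "\<omega> i q = su3_omega \<eta>"
      and \<psi>: "(\<lambda>v. \<alpha> * \<psi>p i q v - \<beta> * \<psi>m i q v) = su3_psip \<eta>"
      using frame[OF eqs(3)] unfolding \<eta>_def by blast
    have em: "emon (warped e) ks ia p = cmon (warped_coframe f \<eta>) ks" for ks
      unfolding emon_pointwise eqs warped_point \<eta>_def ..
    show "\<phi> ia p = (emon (warped e) [1,2,7] + emon (warped e) [3,4,7] + emon (warped e) [5,6,7]
       + emon (warped e) [1,3,5] - emon (warped e) [1,4,6] - emon (warped e) [2,3,6] - emon (warped e) [2,4,5]) ia p"
      unfolding plus_fun_def fun_diff_def em
      unfolding eqs \<phi>_point \<omega> \<psi>
      by (intro ext) (rule su3_frame.warped_coframe_form[OF u, unfolded plus_fun_def fun_diff_def])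
  qed
  ultimately show "g2_adapted P U' (warped e) \<phi>"
    by (simp only: g2_adapted_def)
  show "orthonormal_coframe P U' G (warped e)"
    unfolding orthonormal_coframe_def
  proof (intro allI ballI)
    fix ia p x y assume p: "p \<in> cdom P ia \<inter> U'"
    obtain i a q z where eqs: "ia = (i, a)" "p = (q, z)" "q \<in> cdom M i \<inter> U"
      using chart[OF p] by blast
    define \<eta> where "\<eta> = rotate_coframe \<alpha> \<beta> (\<lambda>k. e k i q)"
    obtain u where u: "su3_frame \<eta> u" and g: "g i q = coframe_metric \<eta>"
      using frame[OF eqs(3)] unfolding \<eta>_def by blast
    have "warped e k ia p = warped_coframe f \<eta> k" for k
      using fun_cong[OF warped_point[of e i a q z], of k] by (simp add: eqs \<eta>_def)
    then show "G ia p x y = (\<Sum>k = 1..DIM((real^6) \<times> real). warped e k ia p (\<lambda>_. x) * warped e k ia p (\<lambda>_. y))"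
      using su3_frame.warped_coframe_metric[OF u, of f x y] by (simp add: eqs G_point g)
  qed
  show "feq_on P U' V (emon (warped e) [1,2,3,4,5,6,7])"
    unfolding feq_on_def
  proof (intro allI ballI)
    fix ia p assume p: "p \<in> cdom P ia \<inter> U'"
    obtain i a q z where eqs: "ia = (i, a)" "p = (q, z)" "q \<in> cdom M i \<inter> U"
      using chart[OF p] by blast
    define \<eta> where "\<eta> = rotate_coframe \<alpha> \<beta> (\<lambda>k. e k i q)"
    obtain u where u: "su3_frame \<eta> u" and vol: "vol6 \<omega> i q = su3_vol \<eta>"
      using frame[OF eqs(3)] unfolding \<eta>_def by blast
    show "V ia p = emon (warped e) [1,2,3,4,5,6,7] ia p"
      unfolding emon_pointwise eqs warped_point V_point \<eta>_def[symmetric] vol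
      by (rule su3_frame.warped_coframe_vol[OF u f])
  qed
qed

lemma g2_structure_\<phi>: "g2_structure P \<phi> G V"
  unfolding g2_structure_def
proof (intro conjI ballI)
  show "DIM((real^6) \<times> real) = 7" by simp
  show "\<phi> \<in> Omega P 3" by (rule \<phi>_Omega)
  fix p assume "p \<in> topspace (mtop P)"
  then obtain q z where p: "p = (q, z)" "q \<in> topspace (mtop M)" "z \<in> sphere 0 1"
    by (auto simp: topspace_times_circle)
  then obtain U e where U: "openin (mtop M) U" "q \<in> U" "su3_adapted M U e \<omega> \<psi>p \<psi>m"
    using su3 unfolding su3_structure_def by blast
  have "openin (mtop P) (U \<times> sphere 0 1)"
    using U(1) by (simp add: prod_manifold_def circle_def openin_prod_Times_iff)
  moreover have "p \<in> U \<times> sphere 0 1"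
    using p U by blast
  ultimately show "\<exists>U e. openin (mtop P) U \<and> p \<in> U \<and> g2_adapted P U e \<phi> \<and> orthonormal_coframe P U G e \<and>
      feq_on P U V (emon e [1,2,3,4,5,6,7])"
    using warped_coframe_adapted[OF U(1,3)] by blast
qed

end

section \<open>The flow equation\<close>

lemma mwedge_has_real_derivative:
  assumes "\<And>w. ((\<lambda>\<tau>. a \<tau> w) has_real_derivative a' w) (at t within T)"
  shows "((\<lambda>\<tau>. mwedge k l (a \<tau>) b v) has_real_derivative mwedge k l a' b v) (at t within T)"
  unfolding mwedge_def
  by (intro DERIV_cdivide DERIV_sum DERIV_cmult_right DERIV_cmult assms)

lemma tderiv_works:
  assumes "form_family M T k \<eta>" "t \<in> T" "q \<in> cdom M i"
  shows "((\<lambda>\<tau>. \<eta> \<tau> i q v) has_real_derivative tderiv T \<eta> t i q v) (at t within T)"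
  using assms unfolding form_family_def differentiable_on_def tderiv_def
  by (simp add: has_real_derivative_iff_has_vector_derivative flip: vector_derivative_works)

text \<open>So derivatives along \<open>T\<close> are unique, also at an endpoint.\<close>

lemma at_within_interval_nontrivial:
  fixes T :: "real set"
  assumes "is_interval T" "interior T \<noteq> {}" "t \<in> T"
  shows "at t within T \<noteq> bot"
proof -
  have "T \<noteq> {a}" for a
    using assms(2) by (auto simp: interior_singleton)
  then have "t islimpt T"
    using connected_imp_perfect[OF is_interval_connected[OF assms(1)] assms(3)] by blast
  then show ?thesis
    by (simp add: trivial_limit_within)
qed

text \<open>The components of the flow equation along \<open>ds\<close> and along \<open>M\<close>.\<close>

lemma flow_equation_split:
  fixes \<omega> \<psi>p \<psi>m :: "real \<Rightarrow> ('i, 'm, real^6) field" and b :: "(real^6) mform"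
  assumes T: "is_interval T" "interior T \<noteq> {}" and t: "t \<in> T" and M: "smooth_manifold M" and q: "q \<in> cdom M i"
    and fam: "form_family M T 2 \<omega>" "form_family M T 3 \<psi>p" "form_family M T 3 \<psi>m"
    and f: "f differentiable_on T"
  shows "(\<forall>v. ((\<lambda>\<tau>. warped_form \<alpha> \<beta> (f \<tau>) (\<omega> \<tau>) (\<psi>p \<tau>) (\<psi>m \<tau>) (i, a) (q, z) v)
        has_real_derivative pull_fst b v) (at t within T)) \<longleftrightarrow>
    (\<forall>w. vector_derivative f (at t within T) * \<omega> t i q w + f t * tderiv T \<omega> t i q w = 0) \<and>
    (\<forall>w. \<alpha> * tderiv T \<psi>p t i q w - \<beta> * tderiv T \<psi>m t i q w = b w)"
    (is "(\<forall>v. (?\<Phi> v has_real_derivative _) _) \<longleftrightarrow> _")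
proof -
  define f' where "f' = vector_derivative f (at t within T)"
  define A where "A = (\<lambda>w. f' * \<omega> t i q w + f t * tderiv T \<omega> t i q w)"
  define B where "B = (\<lambda>w. \<alpha> * tderiv T \<psi>p t i q w - \<beta> * tderiv T \<psi>m t i q w)"
  have unique: "y = y'"
    if "(h has_real_derivative y) (at t within T)" "(h has_real_derivative y') (at t within T)" for h y y'
    using vector_derivative_unique_within[OF at_within_interval_nontrivial[OF T t]] that
    unfolding has_real_derivative_iff_has_vector_derivative by blast
  have df: "(f has_real_derivative f') (at t within T)"
    using f t unfolding f'_def differentiable_on_def
    by (simp add: has_real_derivative_iff_has_vector_derivative flip: vector_derivative_works)
  note d = tderiv_works[OF fam(1) t q] tderiv_works[OF fam(2) t q] tderiv_works[OF fam(3) t q]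
  have form: "?\<Phi> v = (\<lambda>\<tau>. f \<tau> * mwedge 2 1 (pull_fst (\<omega> \<tau> i q)) dsnd v
      + (\<alpha> * \<psi>p \<tau> i q (\<lambda>j. fst (v j)) - \<beta> * \<psi>m \<tau> i q (\<lambda>j. fst (v j))))" for v
    unfolding warped_form_def plus_fun_def fun_diff_def fscale_def wedge_def pr1_pointwise ds_pointwise
    by (simp add: pull_fst_def)
  have d_wedge: "((\<lambda>\<tau>. mwedge 2 1 (pull_fst (\<omega> \<tau> i q)) dsnd v) has_real_derivative
      mwedge 2 1 (pull_fst (tderiv T \<omega> t i q)) dsnd v) (at t within T)" for v
    by (rule mwedge_has_real_derivative) (simp add: pull_fst_def d)
  have "(?\<Phi> v has_real_derivative (f' * mwedge 2 1 (pull_fst (\<omega> t i q)) dsnd v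
      + mwedge 2 1 (pull_fst (tderiv T \<omega> t i q)) dsnd v * f t) + pull_fst B v) (at t within T)" for v
    unfolding form B_def pull_fst_def
    by (intro DERIV_add DERIV_diff DERIV_cmult DERIV_mult df d d_wedge[unfolded pull_fst_def])
  moreover have "f' * mwedge 2 1 (pull_fst (\<omega> t i q)) dsnd v + mwedge 2 1 (pull_fst (tderiv T \<omega> t i q)) dsnd v * f t
      = mwedge 2 1 (pull_fst A) dsnd v" for v
    unfolding A_def pull_fst_def by (simp only: mwedge_add_left mwedge_scale_left mult.commute[of _ "f t"])
  ultimately have D: "(?\<Phi> v has_real_derivative mwedge 2 1 (pull_fst A) dsnd v + pull_fst B v) (at t within T)" for v
    by simp
  show ?thesis
    unfolding f'_def[symmetric]
  proof
    assume "\<forall>v. (?\<Phi> v has_real_derivative pull_fst b v) (at t within T)"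
    then have eq: "mwedge 2 1 (pull_fst A) dsnd v + pull_fst B v = pull_fst b v" for v
      using unique[OF D[of v]] by simp
    have B: "B w = b w" for w
    proof -
      have "mwedge 2 1 (pull_fst A) dsnd (\<lambda>j. (w j, 0)) = 0"
        by (simp add: mwedge_def dsnd_def)
      then show ?thesis
        using eq[of "\<lambda>j. (w j, 0)"] by (simp add: pull_fst_def)
    qed
    then have A0: "mwedge 2 1 (pull_fst A) dsnd v = 0" for v
      using eq[of v] by (simp add: pull_fst_def)
    have "A w = 0" for w
    proof -
      \<comment> \<open>The value of \<open>A\<close> is read off by contracting with the vector \<open>\<partial>/\<partial>s\<close> in the last argument.\<close>
      define v where "v = (!) ([(w 0, 0), (w 1, 0)] @ [(0, 1 :: real)])"
      have contract: "mwedge 2 1 (pull_fst (\<omega> \<tau> i q)) dsnd v = \<omega> \<tau> i q w" if "\<tau> \<in> T" for \<tau>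
      proof -
        have alt: "alternating 2 (\<omega> \<tau> i q)"
          using fam(1) that by (intro Omega_alternating[OF M q]) (auto simp: form_family_def)
        have "mwedge 2 1 (pull_fst (\<omega> \<tau> i q)) dsnd v = pull_fst (\<omega> \<tau> i q) ((!) [(w 0, 0), (w 1, 0)])"
          unfolding v_def by (subst mwedge_snoc[OF alternating_pull_fst[OF alt] alternating_dsnd]) auto
        also have "\<dots> = \<omega> \<tau> i q ((!) [w 0, w 1])"
          using pull_fst_nth[OF alt, of "[(w 0, 0), (w 1, 0)]"] by simp
        also have "\<dots> = \<omega> \<tau> i q w"
          using alternating_as_list[OF alt, of w] by (simp add: upt_rec numeral_eq_Suc)
        finally show ?thesis .
      qed
      have "((\<lambda>\<tau>. \<omega> \<tau> i q w) has_real_derivative mwedge 2 1 (pull_fst (tderiv T \<omega> t i q)) dsnd v) (at t within T)"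
        by (rule has_field_derivative_transform_within[OF d_wedge zero_less_one t]) (rule contract)
      then have d\<omega>: "mwedge 2 1 (pull_fst (tderiv T \<omega> t i q)) dsnd v = tderiv T \<omega> t i q w"
        using unique d(1) by blast
      have "pull_fst A = (\<lambda>v. f' * pull_fst (\<omega> t i q) v + f t * pull_fst (tderiv T \<omega> t i q) v)"
        by (simp add: A_def pull_fst_def)
      then have "mwedge 2 1 (pull_fst A) dsnd v = A w"
        by (simp only: mwedge_add_left mwedge_scale_left contract[OF t] d\<omega>) (simp add: A_def)
      then show ?thesis using A0 by simp
    qed
    with B show "(\<forall>w. f' * \<omega> t i q w + f t * tderiv T \<omega> t i q w = 0) \<and>
        (\<forall>w. \<alpha> * tderiv T \<psi>p t i q w - \<beta> * tderiv T \<psi>m t i q w = b w)"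
      by (simp add: A_def B_def)
  next
    assume "(\<forall>w. f' * \<omega> t i q w + f t * tderiv T \<omega> t i q w = 0) \<and>
        (\<forall>w. \<alpha> * tderiv T \<psi>p t i q w - \<beta> * tderiv T \<psi>m t i q w = b w)"
    then have "A = (\<lambda>_. 0)" "B = b"
      by (auto simp: A_def B_def)
    then have "mwedge 2 1 (pull_fst A) dsnd v + pull_fst B v = pull_fst b v" for v
      by (simp add: pull_fst_def mwedge_zero)
    then show "\<forall>v. (?\<Phi> v has_real_derivative pull_fst b v) (at t within T)"
      using D by simp
  qed
qed

theorem proposition3p4:
  fixes M :: "('i, 'm, real^6) manifold"
    and T :: "real set"
    and \<alpha> \<beta> :: real
    and f :: "real \<Rightarrow> real"
    and \<omega> \<psi>p \<psi>m \<sigma>0 \<pi>0 \<pi>1 \<nu>1 \<pi>2 \<sigma>2 \<nu>3 :: "real \<Rightarrow> ('i, 'm, real^6) field"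
    and g :: "real \<Rightarrow> ('i, 'm, real^6) metric"
  assumes "smooth_manifold M"
    and "is_interval T" and "interior T \<noteq> {}"
    and "\<alpha>\<^sup>2 + \<beta>\<^sup>2 = 1"
    and "form_family M T 2 \<omega>" and "form_family M T 3 \<psi>p" and "form_family M T 3 \<psi>m"
    and "\<And>t. t \<in> T \<Longrightarrow> su3_structure M (\<omega> t) (\<psi>p t) (\<psi>m t)"
    and "\<And>t. t \<in> T \<Longrightarrow> su3_metric M (\<omega> t) (\<psi>p t) (\<psi>m t) (g t)"
    and "\<And>t. t \<in> T \<Longrightarrow>
           torsion_forms M (\<omega> t) (\<psi>p t) (\<psi>m t) (g t)
             (\<sigma>0 t) (\<pi>0 t) (\<pi>1 t) (\<nu>1 t) (\<pi>2 t) (\<sigma>2 t) (\<nu>3 t)"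
    and "f differentiable_on T" and "\<And>t. t \<in> T \<Longrightarrow> f t \<noteq> 0"
    and "\<And>t. t \<in> T \<Longrightarrow>
           feq (prod_manifold M circle)
             (ext_deriv (prod_manifold M circle) 3
               (warped_form \<alpha> \<beta> (f t) (\<omega> t) (\<psi>p t) (\<psi>m t))) 0"
  shows "(\<forall>t\<in>T. feq M (\<alpha> *\<^sub>F \<pi>2 t - \<beta> *\<^sub>F \<sigma>2 t) 0) \<and>
    (laplacian_flow (prod_manifold M circle) T
       (\<lambda>t. warped_form \<alpha> \<beta> (f t) (\<omega> t) (\<psi>p t) (\<psi>m t))
       (\<lambda>t. warped_metric (f t) (g t))
       (\<lambda>t. warped_vol (f t) (\<omega> t))
     \<longleftrightarrow>
     (\<forall>t\<in>T.
        feq M (vector_derivative f (at t within T) *\<^sub>F \<omega> t + f t *\<^sub>F tderiv T \<omega> t) 0 \<and>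
        feq M (\<alpha> *\<^sub>F tderiv T \<psi>p t - \<beta> *\<^sub>F tderiv T \<psi>m t)
          (- ext_deriv M 2 (\<alpha> *\<^sub>F \<sigma>2 t + \<beta> *\<^sub>F \<pi>2 t))))"
proof -
  let ?P = "prod_manifold M circle"
  let ?\<phi> = "\<lambda>t. warped_form \<alpha> \<beta> (f t) (\<omega> t) (\<psi>p t) (\<psi>m t)"
  let ?\<Delta> = "\<lambda>t. hodge_laplacian ?P (warped_metric (f t) (g t)) (warped_vol (f t) (\<omega> t)) 3 (?\<phi> t)"
  have closed: "closed_warped M \<alpha> \<beta> (f t) (\<omega> t) (\<psi>p t) (\<psi>m t) (\<sigma>0 t) (\<pi>0 t) (\<pi>1 t) (\<nu>1 t) (\<pi>2 t) (\<sigma>2 t) (\<nu>3 t) (g t)"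
    if "t \<in> T" for t
    by unfold_locales (use assms that in blast)+
  have feq_iff: "feq M \<eta> \<theta> \<longleftrightarrow> (\<forall>i. \<forall>q\<in>cdom M i. \<forall>v. \<eta> i q v = \<theta> i q v)" for \<eta> \<theta> :: "('i, 'm, real^6) field"
  proof -
    have "cdom M i \<inter> topspace (mtop M) = cdom M i" for i
      using cdom_subset[OF assms(1)] by (simp add: Int_absorb2)
    then show ?thesis
      by (simp add: feq_on_def fun_eq_iff)
  qed
  have "feq M (\<alpha> *\<^sub>F \<pi>2 t - \<beta> *\<^sub>F \<sigma>2 t) 0" if "t \<in> T" for t
    unfolding feq_iff using closed_warped.torsion_closed(1)[OF closed[OF that]] by (simp add: fscale_def)
  moreover have "(\<forall>ia. \<forall>p\<in>cdom ?P ia. \<forall>v. ((\<lambda>\<tau>. ?\<phi> \<tau> ia p v) has_real_derivative ?\<Delta> t ia p v) (at t within T)) \<longleftrightarrow>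
      feq M (vector_derivative f (at t within T) *\<^sub>F \<omega> t + f t *\<^sub>F tderiv T \<omega> t) 0 \<and>
      feq M (\<alpha> *\<^sub>F tderiv T \<psi>p t - \<beta> *\<^sub>F tderiv T \<psi>m t) (- ext_deriv M 2 (\<alpha> *\<^sub>F \<sigma>2 t + \<beta> *\<^sub>F \<pi>2 t))"
    (is "?flow \<longleftrightarrow> ?system") if t: "t \<in> T" for t
  proof -
    let ?b = "\<lambda>i q w. - ext_deriv M 2 (\<alpha> *\<^sub>F \<sigma>2 t + \<beta> *\<^sub>F \<pi>2 t) i q w"
    have laplacian: "?\<Delta> t (i, a) (q, z) v = pull_fst (?b i q) v" if "(q, z) \<in> cdom ?P (i, a)" for i a q z v
      using closed_warped.laplacian_\<phi>[OF closed[OF t] that] by (simp add: pull_fst_def)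
    have split: "(\<forall>v. ((\<lambda>\<tau>. ?\<phi> \<tau> (i, a) (q, z) v) has_real_derivative ?\<Delta> t (i, a) (q, z) v) (at t within T)) \<longleftrightarrow>
        (\<forall>w. vector_derivative f (at t within T) * \<omega> t i q w + f t * tderiv T \<omega> t i q w = 0) \<and>
        (\<forall>w. \<alpha> * tderiv T \<psi>p t i q w - \<beta> * tderiv T \<psi>m t i q w = ?b i q w)"
      if "(q, z) \<in> cdom ?P (i, a)" for i a q z
    proof -
      have "q \<in> cdom M i" using that by (simp add: cdom_times_circle)
      from flow_equation_split[OF assms(2,3) t assms(1) this assms(5-7,11)]
      show ?thesis unfolding laplacian[OF that] .
    qed
    have system: "?system \<longleftrightarrow> (\<forall>i. \<forall>q\<in>cdom M i.
        (\<forall>w. vector_derivative f (at t within T) * \<omega> t i q w + f t * tderiv T \<omega> t i q w = 0) \<and>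
        (\<forall>w. \<alpha> * tderiv T \<psi>p t i q w - \<beta> * tderiv T \<psi>m t i q w = ?b i q w))"
      unfolding feq_iff by (auto simp: fscale_def)
    show ?thesis
    proof
      assume flow: ?flow
      show ?system
        unfolding system
      proof (intro allI ballI)
        fix i q assume q: "q \<in> cdom M i"
        have "cis pi \<in> cis ` {0<..<0 + 2 * pi}"
          by (rule imageI) simp
        then have p: "(q, cis pi) \<in> cdom ?P (i, 0)"
          using q unfolding cdom_times_circle by blast
        show "(\<forall>w. vector_derivative f (at t within T) * \<omega> t i q w + f t * tderiv T \<omega> t i q w = 0) \<and>
          (\<forall>w. \<alpha> * tderiv T \<psi>p t i q w - \<beta> * tderiv T \<psi>m t i q w = ?b i q w)"
          using flow p by (subst split[OF p, symmetric]) blast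
      qed
    next
      assume sys: ?system
      show ?flow
      proof (intro allI ballI)
        fix ia p v assume "p \<in> cdom ?P ia"
        moreover obtain i a q z where "ia = (i, a)" "p = (q, z)"
          by (cases ia; cases p) blast
        ultimately show "((\<lambda>\<tau>. ?\<phi> \<tau> ia p v) has_real_derivative ?\<Delta> t ia p v) (at t within T)"
          using sys[unfolded system] split[of q z i a] by (simp add: cdom_times_circle)
      qed
    qed
  qed
  moreover have "g2_structure ?P (?\<phi> t) (warped_metric (f t) (g t)) (warped_vol (f t) (\<omega> t))" if "t \<in> T" for t
    by (rule closed_warped.g2_structure_\<phi>[OF closed[OF that]])
  ultimately show ?thesis
    unfolding laplacian_flow_def using assms(13) by blast
qed

end
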